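(* Let $\Omega\subset\mathbb{R}^n$ be a convex domain and $u:\Omega\to\mathcal{A}_Q(\mathbb{R}^m)$. Let $\Gamma\subset\overline\Omega$ be a closed subset and let $\Omega'\subset\Omega''\subset\overline\Omega$ be open such that $\overline{\Omega'}\subset\Omega''$ and $\overline{\Omega''}\subset\Omega$ are compact. Suppose also that $\Omega'$ is a convex $A$-weighted domain. Suppose there are numbers $k\in\{0,1,\dots\}$, $q\in[1,\infty)$, $\beta_1,\beta_2,\beta\in(0,\infty)$, $\mu\in(0,1)$ and $\epsilon\in(0,1/4)$ such that: (I) for each $x_0\in\Gamma\cap\overline{\Omega''}$ there exists $P_{x_0}\in\mathcal{P}_k$ with $\sup_\Omega|P_{x_0}|\le\beta$ such that for all $0<\sigma\le\rho/2\le\epsilon/2$, $$\sigma^{-n-kq}\int_{B_\sigma(x_0)\cap\Omega}\mathcal{G}(u(x),P_{x_0}(x))^q\,dx\le\beta_1\Big(\frac\sigma\rho\Big)^{q\mu}\rho^{-n-kq}\int_{B_\rho(x_0)\cap\Omega}\mathcal{G}(u(x),P_{x_0}(x))^q\,dx;$$ (II) for each $x_0\in\overline{\Omega''}\setminus\Gamma$ there exists $P_{x_0}\in\mathcal{P}_k$ such that for every $y\in\Gamma\cap\overline{\Omega''}$ and every $0<\sigma\le\rho/2<\frac12\min\{1/4,\mathrm{dist}(x_0,\Gamma)\}$, $$\sigma^{-n-kq}\int_{B_\sigma(x_0)\cap\Omega}\mathcal{G}(u(x),P_{x_0}(x))^q\,dx\le\beta_2\Big(\frac\sigma\rho\Big)^{q\mu}\rho^{-n-kq}\int_{B_\rho(x_0)\cap\Omega}\mathcal{G}(u(x),P_y(x))^q\,dx.$$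 Then $u\in C^{k,\lambda}(\overline{\Omega'};\mathcal{A}_Q(\mathbb{R}^m))$ for some $\lambda=\lambda(n,m,k,q,Q,A,\beta_1,\beta_2,\epsilon,\mu,\mathrm{dist}(\Omega',\Omega''))$, with the estimate $$\|u\|_{k,\lambda;\Omega'}\le C\Big(\beta^q+\int_{\Omega''}|u|^q\Big)^{1/q},$$ where $C=C(n,m,k,q,Q,A,\beta_1,\beta_2,\epsilon,\mathrm{dist}(\Omega',\Omega''))$.
   Context: $\mathcal{A}_Q(\mathbb{R}^m)$ is the set of unordered $Q$-tuples $\sum_{i=1}^Q[\![T_i]\!]$, $T_i\in\mathbb{R}^m$ ($[\![T]\!]$ being the Dirac mass at $T$), with metric $\mathcal{G}(\sum_i[\![R_i]\!],\sum_i[\![T_i]\!])=\min_{\sigma\in S_Q}(\sum_i|R_i-T_{\sigma(i)}|^2)^{1/2}$, where $S_Q$ is the group of permutations of $\{1,\dots,Q\}$; $|T|=\mathcal{G}(T,Q[\![0]\!])$. A $Q$-valued polynomial is $P=\sum_{i=1}^Q[\![p_i]\!]$ with $p_i:\mathbb{R}^n\to\mathbb{R}^m$ having polynomial components, its degree being the maximal degree of these components; $\mathcal{P}_k$ is the set of $Q$-valued polynomials $\mathbb{R}^n\to\mathcal{A}_Q(\mathbb{R}^m)$ of degree $\le k$. $B_\rho(x)$ is the ball in $\mathbb{R}^n$ of radius $\rho$ centred at $x$. A $Q$-valued function $u=\sum_i[\![u_i]\!]$ is differentiable at $x_0$ if there are $A_1,\dots,A_Q\in\mathbb{R}^{m\times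 n}$ with $\mathcal{G}(u(x_0+h),\sum_i[\![u_i(x_0)+A_ih]\!])=o(|h|)$ as $h\to0$; then $Du(x_0)=\sum_i[\![A_i]\!]$. The space $C^{k,\lambda}(\overline{\Omega'};\mathcal{A}_Q(\mathbb{R}^m))$ is defined from this in the natural way: $u,Du,\dots,D^ku$ exist, extend continuously to $\overline{\Omega'}$, and $D^ku$ is $\lambda$-Hölder for $\mathcal{G}$; $\|u\|_{k,\lambda;\Omega'}$ is the corresponding "norm", i.e. the sum of $\sup|D^ju|$, $0\le j\le k$, and the $\lambda$-Hölder seminorm of $D^ku$. A bounded domain $\Omega'$ is $A$-weighted (for $A>0$) if $\mathcal{H}^n(\Omega'\cap B_\rho(x))\ge A\rho^n$ for all $x\in\overline{\Omega'}$ and $\rho\in(0,\mathrm{diam}(\Omega')]$, where $\mathcal{H}^n$ is $n$-dimensional Hausdorff measure. $\mathrm{dist}(\Omega',\Omega'')$ denotes the distance from $\Omega'$ to the complement of $\Omega''$.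
   Formalization: It is assumed that Γ meets the closure of Ω'' (otherwise (I), (II) are vacuous and the claim fails), that u is measurable with finite integral of |u|^q over Ω'', and the conclusion is for a function equal to u almost everywhere on Ω'. *)

theory Defs
  imports "HOL-Analysis.Analysis" "HOL-Library.Function_Algebras"
begin

subsection \<open>Unordered tuples\<close>

text \<open>
  An unordered \<open>Q\<close>-tuple is a multiset of size \<open>Q\<close>.  The distance is parametrised by the norm
  \<open>N\<close> of the ambient space, because it is used both for \<open>real ^ 'm\<close> and for the tensors below.
  It is meant for multisets of equal size only.  The enumerations \<open>xs\<close>, \<open>ys\<close> range over a finite
  set, and the minimum over \<open>\<sigma>\<close> is the same for all of them.
\<close>

definition qdist :: "('a::minus \<Rightarrow> real) \<Rightarrow> 'a multiset \<Rightarrow> 'a multiset \<Rightarrow> real" where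
  "qdist N R T = Min {sqrt (\<Sum>i<size R. (N (xs ! i - ys ! \<sigma> i))\<^sup>2) | xs ys \<sigma>.
     mset xs = R \<and> mset ys = T \<and> \<sigma> permutes {..<size R}}"

definition qabs :: "('a::{minus,zero} \<Rightarrow> real) \<Rightarrow> 'a multiset \<Rightarrow> real" where
  "qabs N T = qdist N T (replicate_mset (size T) 0)"

abbreviation G :: "(real ^ 'm) multiset \<Rightarrow> (real ^ 'm) multiset \<Rightarrow> real" where
  "G \<equiv> qdist norm"

text \<open>
  The space of unordered \<open>Q\<close>-tuples is separable, so its Borel sets are generated by balls and
  measurability of \<open>u\<close> is measurability of the distance functions \<open>G (u x) T\<close>.
\<close>

definition qmeasurable_on ::
    "nat \<Rightarrow> (real ^ 'n) set \<Rightarrow> (real ^ 'n \<Rightarrow> (real ^ 'm) multiset) \<Rightarrow> bool" where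
  "qmeasurable_on Q S u \<longleftrightarrow>
     (\<forall>T. size T = Q \<longrightarrow> (\<lambda>x. G (u x) T) \<in> borel_measurable (lebesgue_on S))"

subsection \<open>Polynomials\<close>

text \<open>The exponents \<open>\<alpha> :: 'n \<Rightarrow> nat\<close> are multi-indices, so the degree is the total degree.\<close>

definition poly_fun :: "nat \<Rightarrow> (real ^ 'n \<Rightarrow> real) set" where
  "poly_fun k = {f. \<exists>c. \<forall>x. f x =
     (\<Sum>\<alpha> | (\<Sum>i\<in>UNIV. \<alpha> i) \<le> k. c \<alpha> * (\<Prod>i\<in>UNIV. (x $ i) ^ \<alpha> i))}"

definition qpoly :: "nat \<Rightarrow> nat \<Rightarrow> (real ^ 'n \<Rightarrow> (real ^ 'm) multiset) set" where
  "qpoly Q k = {P. \<exists>M. size M = Q \<and> (\<forall>p\<in>#M. \<forall>i. (\<lambda>x. p x $ i) \<in> poly_fun k) \<and>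
     P = (\<lambda>x. image_mset (\<lambda>p. p x) M)}"

subsection \<open>Derivatives of multivalued functions\<close>

text \<open>
  The \<open>j\<close>-th derivative takes values in unordered \<open>Q\<close>-tuples of arrays of \<open>m n ^ j\<close> real
  numbers, a space that depends on the number \<open>j\<close>.  To have one type for all \<open>j\<close>,
  such an element is stored as a function \<open>T\<close> on lists of indices that vanishes on all lists of
  length other than \<open>j\<close>; \<open>T [i\<^sub>1, \<dots>, i\<^sub>j]\<close> is a vector of \<open>real ^ 'm\<close>.  The index of the most
  recent differentiation comes first.  The norm is the Euclidean norm of the array of components.
\<close>

type_synonym ('n, 'm) tensor = "'n list \<Rightarrow> real ^ 'm"

definition tensors :: "nat \<Rightarrow> ('n, 'm::finite) tensor set" where
  "tensors j = {T. \<forall>is. length is \<noteq> j \<longrightarrow> T is = 0}"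

definition tensor_norm :: "nat \<Rightarrow> ('n::finite, 'm::finite) tensor \<Rightarrow> real" where
  "tensor_norm j T = sqrt (\<Sum>is | length is = j. (norm (T is))\<^sup>2)"

definition tensor0 :: "real ^ 'm \<Rightarrow> ('n, 'm::finite) tensor" where
  "tensor0 a = (\<lambda>is. if is = [] then a else 0)"

abbreviation tdist ::
    "nat \<Rightarrow> ('n::finite, 'm::finite) tensor multiset \<Rightarrow> ('n, 'm) tensor multiset \<Rightarrow> real" where
  "tdist j \<equiv> qdist (tensor_norm j)"

definition tensor_affine ::
    "('n, 'm) tensor \<Rightarrow> ('n, 'm) tensor \<Rightarrow> real ^ 'n \<Rightarrow> ('n::finite, 'm::finite) tensor" where
  "tensor_affine a A h = (\<lambda>is. a is + (\<Sum>l\<in>UNIV. h $ l *\<^sub>R A (l # is)))"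

text \<open>
  The multiset \<open>M\<close> consists of the pairs formed by a value \<open>u\<^sub>i x\<close> and its derivative \<open>A\<^sub>i\<close>.
  In the limit, \<open>at 0\<close> imposes no restriction on \<open>h\<close>, so this is used at interior points of the
  domain only.
\<close>

definition has_qderiv ::
    "nat \<Rightarrow> (real ^ 'n \<Rightarrow> ('n, 'm::finite) tensor multiset) \<Rightarrow> real ^ 'n \<Rightarrow> ('n, 'm::finite) tensor multiset \<Rightarrow> bool"
  where
  "has_qderiv j U x D \<longleftrightarrow>
     (\<exists>M. image_mset fst M = U x \<and> image_mset snd M = D \<and>
        (\<forall>A\<in>#D. A \<in> tensors (Suc j)) \<and>
        ((\<lambda>h. tdist j (U (x + h)) (image_mset (\<lambda>(a, A). tensor_affine a A h) M) / norm h)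
           \<longlongrightarrow> 0) (at 0))"

subsection \<open>Hoelder spaces of multivalued functions\<close>

definition holder_seminorm ::
    "nat \<Rightarrow> real \<Rightarrow> (real ^ 'n) set \<Rightarrow> (real ^ 'n \<Rightarrow> ('n, 'm::finite) tensor multiset) \<Rightarrow> ennreal" where
  "holder_seminorm j l W U =
     (SUP (x, y)\<in>{(x, y). x \<in> W \<and> y \<in> W \<and> x \<noteq> y}.
        ennreal (tdist j (U x) (U y) / dist x y powr l))"

text \<open>
  \<open>V j\<close> is the \<open>j\<close>-th derivative of \<open>v\<close> on the open set \<open>W\<close>, extended continuously to
  \<open>closure W\<close>.
\<close>

definition holder_jets ::
    "nat \<Rightarrow> nat \<Rightarrow> real \<Rightarrow> (real ^ 'n) set \<Rightarrow> (real ^ 'n \<Rightarrow> (real ^ 'm) multiset) \<Rightarrow>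
     (nat \<Rightarrow> real ^ 'n \<Rightarrow> ('n, 'm::finite) tensor multiset) set" where
  "holder_jets Q k l W v = {V.
     (\<forall>x\<in>closure W. V 0 x = image_mset tensor0 (v x)) \<and>
     (\<forall>j\<le>k. \<forall>x\<in>closure W. size (V j x) = Q \<and> (\<forall>T\<in>#V j x. T \<in> tensors j)) \<and>
     (\<forall>j<k. \<forall>x\<in>W. has_qderiv j (V j) x (V (Suc j) x)) \<and>
     (\<forall>j\<le>k. \<forall>x\<in>closure W. \<forall>e>0. \<exists>r>0. \<forall>y\<in>closure W.
        dist y x < r \<longrightarrow> tdist j (V j y) (V j x) < e) \<and>
     holder_seminorm k l W (V k) < \<infinity>}"

definition holder_space ::
    "nat \<Rightarrow> nat \<Rightarrow> real \<Rightarrow> (real ^ 'n) set \<Rightarrow> (real ^ 'n \<Rightarrow> (real ^ 'm) multiset) set" where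
  "holder_space Q k l W = {v. holder_jets Q k l W v \<noteq> {}}"

text \<open>
  Derivatives at interior points are unique, so all jets of \<open>v\<close> agree on \<open>W\<close> and the infimum is
  the value at the only jet; it is \<open>\<infinity>\<close> if \<open>v\<close> has none, i.e. is not in the space.
\<close>

definition holder_norm ::
    "nat \<Rightarrow> nat \<Rightarrow> real \<Rightarrow> (real ^ 'n) set \<Rightarrow> (real ^ 'n \<Rightarrow> (real ^ 'm) multiset) \<Rightarrow> ennreal" where
  "holder_norm Q k l W v = (INF V\<in>holder_jets Q k l W v.
     (\<Sum>j\<le>k. SUP x\<in>W. ennreal (qabs (tensor_norm j) (V j x))) + holder_seminorm k l W (V k))"

subsection \<open>Weighted domains\<close>

text \<open>
  Hausdorff measure of integer dimension \<open>n \<ge> 1\<close>, normalised to agree with Lebesgue measure on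
  \<open>real ^ 'n\<close>, \<open>n = CARD('n)\<close>.  Boundedness is required because \<open>diameter\<close> is unspecified on unbounded sets.
\<close>

definition hausdorff_pre :: "nat \<Rightarrow> real \<Rightarrow> 'a::metric_space set \<Rightarrow> ennreal" where
  "hausdorff_pre n \<delta> E =
     (INF U\<in>{U :: nat \<Rightarrow> 'a set. E \<subseteq> (\<Union>i. U i) \<and> (\<forall>i. bounded (U i) \<and> diameter (U i) \<le> \<delta>)}.
        \<Sum>i. ennreal (unit_ball_vol (real n) * (diameter (U i) / 2) ^ n))"

definition hausdorff :: "nat \<Rightarrow> 'a::metric_space set \<Rightarrow> ennreal" where
  "hausdorff n E = (SUP \<delta>\<in>{0<..}. hausdorff_pre n \<delta> E)"

definition weighted :: "real \<Rightarrow> (real ^ 'n) set \<Rightarrow> bool" where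
  "weighted A W \<longleftrightarrow> (\<forall>x\<in>closure W. \<forall>\<rho>. 0 < \<rho> \<and> \<rho> \<le> diameter W \<longrightarrow>
     ennreal (A * \<rho> ^ CARD('n)) \<le> hausdorff CARD('n) (W \<inter> ball x \<rho>))"

end

theory Submission imports Defs
begin

text \<open>
  The argument is Campanato's. A function that is approximated near every point \<open>x\<close> by a polynomial
  \<open>P x\<close> of degree at most \<open>k\<close>, with an error of order \<open>k + \<mu>\<close> and uniform constants, has derivatives up to
  order \<open>k\<close>, namely those of \<open>P x\<close> at \<open>x\<close>, and the last one is Hoelder continuous with exponent \<open>\<mu>\<close>. The
  approximating polynomials are given at every point, so none has to be built as a limit over dyadic radii.
  No geometric series in \<open>\<mu>\<close> is summed, the constant does not depend on \<open>\<mu>\<close>, and the exponent is \<open>\<mu>\<close> itself.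
  
  The two hypotheses merge into one estimate, \<open>decay\<close>: the integral of the \<open>q\<close>-th power of the distance
  of \<open>u\<close> and \<open>P x\<close> over the ball of radius \<open>\<sigma>\<close> about \<open>x\<close> is at most a constant times \<open>\<sigma> powr e\<close>, where
  \<open>e = n + k q + q \<mu>\<close>. On \<open>\<Gamma>\<close> this is the first hypothesis with a fixed outer radius. At distance \<open>\<delta>\<close> from
  \<open>\<Gamma>\<close>, for \<open>\<sigma> \<le> \<delta> / 4\<close>, it is the second one, whose right-hand side is controlled by the estimate at the
  nearest point \<open>y\<close> of \<open>\<Gamma>\<close>. For larger \<open>\<sigma>\<close>, \<open>P x\<close> and \<open>P y\<close> are close at scale \<open>\<delta>\<close>, and polynomials of
  degree \<open>k\<close> that are close at scale \<open>\<delta>\<close> drift apart by a factor \<open>(\<sigma> / \<delta>) ^ k\<close> at most, up to constants.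
  
  That the values are unordered matters in the comparison of two multivalued polynomials,
  \<open>matched_polynomials_close\<close>: if both are close to \<open>u\<close> in the mean on a ball, then a single permutation
  matches their branches, with all derivatives close. The distance only provides a permutation at each
  point. But there are \<open>Q!\<close> permutations, so among many nodes one of them serves at sufficiently many nodes
  to determine a polynomial of degree \<open>k\<close>. The nodes lie on a curve along which
  polynomials in \<open>n\<close> variables become polynomials in one variable with the same coefficients, so that
  Lagrange interpolation applies; and they are translated so that \<open>u\<close> is close to both polynomials at all
  of them at once.
  
  The representative of \<open>u\<close> is \<open>v x = P x x\<close>. It agrees with \<open>u\<close> almost everywhere by the Lebesgue density
  theorem (\<open>values_ae\<close>). Comparing \<open>P x\<close> and \<open>P y\<close> at the scale of the distance of \<open>x\<close> and \<open>y\<close> yields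
  differentiability, continuity and the Hoelder bound, and comparing \<open>P x\<close> with the zero polynomial bounds
  the derivatives (\<open>holder_estimate\<close>).
\<close>

section \<open>Distances between unordered tuples\<close>

lemma finite_enumerations: "finite {xs. mset xs = R}"
proof (rule finite_subset)
  show "{xs. mset xs = R} \<subseteq> {xs. set xs \<subseteq> set_mset R \<and> length xs = size R}" by auto
  show "finite {xs. set xs \<subseteq> set_mset R \<and> length xs = size R}"
    by (rule finite_lists_length_eq) simp
qed

lemma finite_matching_costs:
  "finite {sqrt (\<Sum>i<size R. (N (xs ! i - ys ! \<sigma> i))\<^sup>2) | xs ys \<sigma>.
     mset xs = R \<and> mset ys = T \<and> \<sigma> permutes {..<size R}}" (is "finite ?S")
proof (rule finite_subset)
  show "?S \<subseteq> (\<lambda>(xs, ys, \<sigma>). sqrt (\<Sum>i<size R. (N (xs ! i - ys ! \<sigma> i))\<^sup>2)) `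
     ({xs. mset xs = R} \<times> {ys. mset ys = T} \<times> {\<sigma>. \<sigma> permutes {..<size R}})"
    by (auto simp: image_iff) blast
  show "finite \<dots>"
    by (intro finite_imageI finite_cartesian_product finite_enumerations finite_permutations) simp
qed

lemma qdist_le:
  assumes "length ys = length xs"
  shows "qdist N (mset xs) (mset ys) \<le> L2_set (\<lambda>i. N (xs ! i - ys ! i)) {..<length xs}"
  unfolding qdist_def L2_set_def
proof (rule Min_le[OF finite_matching_costs])
  show "sqrt (\<Sum>i<length xs. (N (xs ! i - ys ! i))\<^sup>2)
    \<in> {sqrt (\<Sum>i<size (mset xs). (N (xs' ! i - ys' ! \<sigma> i))\<^sup>2) | xs' ys' \<sigma>.
     mset xs' = mset xs \<and> mset ys' = mset ys \<and> \<sigma> permutes {..<size (mset xs)}}"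
    by (rule CollectI, rule exI[of _ xs], rule exI[of _ ys], rule exI[of _ id])
       (simp add: permutes_id)
qed

text \<open>
  Changing the enumerations only composes the permutation with other permutations. Hence for fixed
  enumerations the minimum over the permutations alone is already the distance.
\<close>

lemma qdist_attained:
  assumes "length ys = length xs"
  obtains \<sigma> where "\<sigma> permutes {..<length xs}"
    "qdist N (mset xs) (mset ys) = L2_set (\<lambda>i. N (xs ! i - ys ! \<sigma> i)) {..<length xs}"
proof -
  let ?S = "{sqrt (\<Sum>i<size (mset xs). (N (xs' ! i - ys' ! \<sigma> i))\<^sup>2) | xs' ys' \<sigma>.
     mset xs' = mset xs \<and> mset ys' = mset ys \<and> \<sigma> permutes {..<size (mset xs)}}"
  have "?S \<noteq> {}" using permutes_id by blast
  then have "Min ?S \<in> ?S" by (intro Min_in finite_matching_costs)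
  then obtain xs' ys' \<tau> where 1: "mset xs' = mset xs" "mset ys' = mset ys"
      "\<tau> permutes {..<length xs}"
      "qdist N (mset xs) (mset ys) = L2_set (\<lambda>i. N (xs' ! i - ys' ! \<tau> i)) {..<length xs}"
    unfolding qdist_def L2_set_def by auto
  obtain p where p: "p permutes {..<length xs}" "permute_list p xs = xs'"
    using mset_eq_permutation[OF 1(1)] .
  obtain r where r: "r permutes {..<length xs}" "permute_list r ys = ys'"
    using mset_eq_permutation[OF 1(2)] assms by metis
  let ?\<sigma> = "r \<circ> \<tau> \<circ> inv p"
  have pinv: "inv p permutes {..<length xs}" by (rule permutes_inv[OF p(1)])
  have perm: "?\<sigma> permutes {..<length xs}"
    by (intro permutes_compose pinv r 1)
  have "(\<Sum>i<length xs. (N (xs' ! i - ys' ! \<tau> i))\<^sup>2)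
      = (\<Sum>i<length xs. (N (xs' ! inv p i - ys' ! \<tau> (inv p i)))\<^sup>2)"
    using sum.permute[OF pinv, of "\<lambda>i. (N (xs' ! i - ys' ! \<tau> i))\<^sup>2"] by (simp add: o_def)
  also have "\<dots> = (\<Sum>i<length xs. (N (xs ! i - ys ! ?\<sigma> i))\<^sup>2)"
  proof (rule sum.cong[OF refl])
    fix i assume i: "i \<in> {..<length xs}"
    have a: "inv p i < length xs" using permutes_in_image[OF pinv] i by auto
    have b: "\<tau> (inv p i) < length ys" using permutes_in_image[OF 1(3)] a assms by auto
    have "xs' ! inv p i = xs ! i"
      using permute_list_nth[OF p(1) a] p(2) permutes_inverses(1)[OF p(1)] by simp
    moreover have "ys' ! \<tau> (inv p i) = ys ! (?\<sigma> i)"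
      using permute_list_nth[of r ys] r b assms by simp
    ultimately show "(N (xs' ! inv p i - ys' ! \<tau> (inv p i)))\<^sup>2 = (N (xs ! i - ys ! ?\<sigma> i))\<^sup>2"
      by simp
  qed
  finally show thesis using that[OF perm] 1(4) by (simp add: L2_set_def)
qed

text \<open>
  With the permutation absorbed into the second list, several distances can be aligned to one
  enumeration; the triangle inequality then is that of the Euclidean norm on lists.
\<close>

lemma qdist_attained_list:
  assumes "size T = length xs"
  obtains ys where "mset ys = T" "length ys = length xs"
    "qdist N (mset xs) T = L2_set (\<lambda>i. N (xs ! i - ys ! i)) {..<length xs}"
proof -
  obtain ys0 where ys0: "mset ys0 = T" using ex_mset by blast
  with assms have len: "length ys0 = length xs" by auto
  obtain \<sigma> where s: "\<sigma> permutes {..<length xs}"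
    "qdist N (mset xs) (mset ys0) = L2_set (\<lambda>i. N (xs ! i - ys0 ! \<sigma> i)) {..<length xs}"
    using qdist_attained[OF len] .
  show thesis
  proof (rule that[of "permute_list \<sigma> ys0"])
    show "mset (permute_list \<sigma> ys0) = T" using s len ys0 by simp
    show "length (permute_list \<sigma> ys0) = length xs" using len by simp
    show "qdist N (mset xs) T = L2_set (\<lambda>i. N (xs ! i - permute_list \<sigma> ys0 ! i)) {..<length xs}"
      using s(2) permute_list_nth[of \<sigma> ys0] s(1) len ys0 by (auto intro!: L2_set_cong)
  qed
qed

lemma qdist_nonneg:
  assumes "size T = size R" shows "0 \<le> qdist N R T"
proof -
  obtain xs where "mset xs = R" using ex_mset by blast
  then show ?thesis using qdist_attained_list[of T xs N] assms by (metis L2_set_nonneg size_mset)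
qed

lemma qdist_sym:
  assumes "size T = size R" and N: "\<And>a b. N (a - b) = N (b - a)"
  shows "qdist N R T = qdist N T R"
proof -
  have le: "qdist N R T \<le> qdist N T R" if "size T = size R" for R T
  proof -
    obtain ts where ts: "mset ts = T" using ex_mset by blast
    obtain rs where rs: "mset rs = R" "length rs = length ts"
      "qdist N (mset ts) R = L2_set (\<lambda>i. N (ts ! i - rs ! i)) {..<length ts}"
      using qdist_attained_list[of R ts N] ts \<open>size T = size R\<close> by (metis size_mset)
    have "qdist N (mset rs) (mset ts) \<le> L2_set (\<lambda>i. N (rs ! i - ts ! i)) {..<length rs}"
      by (rule qdist_le) (use rs in simp)
    then show ?thesis using rs ts N by simp
  qed
  show ?thesis using le[of T R] le[of R T] assms(1) by simp
qed

lemma G_sym: "size T = size R \<Longrightarrow> G R T = G T R"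
  by (rule qdist_sym) (auto simp: norm_minus_commute)

lemma G_triangle:
  fixes R S T :: "(real ^ 'm) multiset"
  assumes "size S = size R" "size T = size R"
  shows "G R T \<le> G R S + G S T"
proof -
  obtain rs where rs: "mset rs = R" using ex_mset by blast
  obtain ss where ss: "mset ss = S" "length ss = length rs"
    "G (mset rs) S = L2_set (\<lambda>i. norm (rs ! i - ss ! i)) {..<length rs}"
    using qdist_attained_list[of S rs norm] rs assms by (metis size_mset)
  obtain ts where ts: "mset ts = T" "length ts = length ss"
    "G (mset ss) T = L2_set (\<lambda>i. norm (ss ! i - ts ! i)) {..<length ss}"
    using qdist_attained_list[of T ss norm] ss assms by (metis size_mset)
  have "G R T \<le> L2_set (\<lambda>i. norm (rs ! i - ts ! i)) {..<length rs}"
    using qdist_le[of ts rs norm] rs ss ts by simp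
  also have "\<dots> \<le> L2_set (\<lambda>i. norm (rs ! i - ss ! i) + norm (ss ! i - ts ! i)) {..<length rs}"
    by (rule L2_set_mono) (use norm_triangle_ineq[of "rs ! i - ss ! i" "ss ! i - ts ! i" for i] in auto)
  also have "\<dots> \<le> L2_set (\<lambda>i. norm (rs ! i - ss ! i)) {..<length rs}
      + L2_set (\<lambda>i. norm (ss ! i - ts ! i)) {..<length rs}"
    by (rule L2_set_triangle_ineq)
  finally show ?thesis using rs ss ts by simp
qed

lemma G_eq_0:
  fixes R T :: "(real ^ 'm) multiset"
  assumes "size T = size R" "G R T = 0" shows "R = T"
proof -
  obtain rs where rs: "mset rs = R" using ex_mset by blast
  obtain ts where ts: "mset ts = T" "length ts = length rs"
    "G (mset rs) T = L2_set (\<lambda>i. norm (rs ! i - ts ! i)) {..<length rs}"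
    using qdist_attained_list[of T rs norm] rs assms by (metis size_mset)
  then have "\<forall>i<length rs. rs ! i = ts ! i"
    using assms rs by (simp add: L2_set_eq_0_iff)
  then have "rs = ts" using ts by (auto intro: nth_equalityI)
  then show ?thesis using rs ts by simp
qed

lemma qdist_aligned_le:
  assumes "length ys = length xs" "0 \<le> E" "\<And>i. i < length xs \<Longrightarrow> \<bar>N (xs ! i - ys ! i)\<bar> \<le> E"
  shows "qdist N (mset xs) (mset ys) \<le> real (length xs) * E"
proof -
  have "qdist N (mset xs) (mset ys) \<le> L2_set (\<lambda>i. N (xs ! i - ys ! i)) {..<length xs}"
    by (rule qdist_le) fact
  also have "\<dots> \<le> (\<Sum>i<length xs. \<bar>N (xs ! i - ys ! i)\<bar>)" by (rule L2_set_le_sum_abs)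
  also have "\<dots> \<le> (\<Sum>i<length xs. E)" by (rule sum_mono) (use assms in auto)
  finally show ?thesis by simp
qed

lemma mset_map_permuted:
  assumes "\<sigma> permutes {..<length ys}"
  shows "mset (map (\<lambda>i. f (ys ! \<sigma> i)) [0..<length ys]) = mset (map f ys)"
proof -
  have "permute_list \<sigma> (map f ys) = map (\<lambda>i. f (ys ! \<sigma> i)) [0..<length ys]"
    unfolding permute_list_def using permutes_in_image[OF assms] by (auto intro!: nth_equalityI)
  then show ?thesis using mset_permute_list[of \<sigma> "map f ys"] assms by simp
qed

text \<open>
  Distances between two multivalued polynomials, and between their jets, are bounded in this form: a
  permutation matches the branches, and \<open>f\<close> and \<open>g\<close> evaluate a branch or its derivatives at a point.
\<close>

lemma qdist_map_le:
  assumes "length xs = Q" "length ys = Q" "\<sigma> permutes {..<Q}" "0 \<le> E"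
    and "\<And>i. i < Q \<Longrightarrow> \<bar>N (f (xs ! i) - g (ys ! \<sigma> i))\<bar> \<le> E"
  shows "qdist N (mset (map f xs)) (mset (map g ys)) \<le> real Q * E"
proof -
  have "qdist N (mset (map f xs)) (mset (map (\<lambda>i. g (ys ! \<sigma> i)) [0..<length ys])) \<le> real (length (map f xs)) * E"
    by (rule qdist_aligned_le) (use assms in auto)
  then show ?thesis using mset_map_permuted[of \<sigma> ys g] assms by simp
qed

section \<open>Measurability\<close>

lemma tuples_separable:
  obtains D :: "(real ^ 'm) multiset set" where "countable D" "\<And>T. T \<in> D \<Longrightarrow> size T = Q"
    "\<And>T \<eta>. size T = Q \<Longrightarrow> 0 < \<eta> \<Longrightarrow> \<exists>S\<in>D. G T S < \<eta>"
proof -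
  obtain D0 :: "(real ^ 'm) set" where D0: "countable D0"
    "\<And>X. open X \<Longrightarrow> X \<noteq> {} \<Longrightarrow> \<exists>d\<in>D0. d \<in> X"
    using countable_dense_setE by blast
  let ?D = "mset ` {xs \<in> lists D0. length xs = Q}"
  show thesis
  proof (rule that[of ?D])
    show "countable ?D"
      by (intro countable_image countable_subset[OF _ countable_lists[OF D0(1)]]) auto
    show "size T = Q" if "T \<in> ?D" for T using that by auto
    show "\<exists>S\<in>?D. G T S < \<eta>" if T: "size T = Q" and \<eta>: "0 < \<eta>" for T \<eta>
    proof -
      obtain ts where ts: "mset ts = T" using ex_mset by blast
      define E where "E = \<eta> / (real Q + 1)"
      have E: "E > 0" using \<eta> by (simp add: E_def)
      have "\<exists>d\<in>D0. d \<in> ball x E" for x :: "real ^ 'm" by (rule D0(2)) (use E in auto)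
      then obtain g where g: "\<And>x :: real ^ 'm. g x \<in> D0" "\<And>x :: real ^ 'm. g x \<in> ball x E" by metis
      have "G (mset ts) (mset (map g ts)) \<le> real (length ts) * E"
        using g(2) E by (intro qdist_aligned_le) (auto simp: dist_norm less_imp_le)
      also have "\<dots> < \<eta>" using ts T \<eta> by (auto simp: E_def field_simps)
      finally have "G T (mset (map g ts)) < \<eta>" using ts by simp
      moreover have "mset (map g ts) \<in> ?D" using g(1) ts T by (intro imageI) auto
      ultimately show ?thesis by blast
    qed
  qed
qed

text \<open>
  By separability, \<open>G (u x) (w x) > a\<close> holds if and only if \<open>G (u x) T - G (w x) T > a\<close> for some \<open>T\<close> in a
  countable dense set: the triangle inequality gives one direction, \<open>T\<close> close to \<open>w x\<close> the other.
\<close>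

lemma G_measurable:
  fixes u w :: "real ^ 'n \<Rightarrow> (real ^ 'm) multiset"
  assumes u: "qmeasurable_on Q S u" and w: "qmeasurable_on Q S w"
    and su: "\<And>x. x \<in> S \<Longrightarrow> size (u x) = Q" and sw: "\<And>x. x \<in> S \<Longrightarrow> size (w x) = Q"
  shows "(\<lambda>x. G (u x) (w x)) \<in> borel_measurable (lebesgue_on S)"
proof -
  obtain D :: "(real ^ 'm) multiset set" where D: "countable D" "\<And>T. T \<in> D \<Longrightarrow> size T = Q"
    "\<And>T \<eta>. size T = Q \<Longrightarrow> 0 < \<eta> \<Longrightarrow> \<exists>S\<in>D. G T S < \<eta>"
    using tuples_separable[of Q thesis] by blast
  show ?thesis
    unfolding borel_measurable_iff_greater
  proof
    fix a :: real
    have "{x \<in> space (lebesgue_on S). a < G (u x) (w x)}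
        = (\<Union>T\<in>D. {x \<in> space (lebesgue_on S). a < G (u x) T - G (w x) T})" (is "?L = ?R")
    proof (intro equalityI subsetI)
      fix x assume "x \<in> ?L"
      then have x: "x \<in> S" "a < G (u x) (w x)" by auto
      obtain T where T: "T \<in> D" "G (w x) T < (G (u x) (w x) - a) / 2"
        using D(3)[of "w x" "(G (u x) (w x) - a) / 2"] x sw by auto
      have "G (u x) (w x) \<le> G (u x) T + G T (w x)"
        using x su sw D(2) T by (intro G_triangle) auto
      then have "a < G (u x) T - G (w x) T"
        using T G_sym[of T "w x"] x sw D(2)[OF T(1)] by auto
      then show "x \<in> ?R" using x T by auto
    next
      fix x assume "x \<in> ?R"
      then obtain T where x: "x \<in> S" "T \<in> D" "a < G (u x) T - G (w x) T" by auto
      have "G (u x) T \<le> G (u x) (w x) + G (w x) T"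
        using x su sw D(2) by (intro G_triangle) auto
      then show "x \<in> ?L" using x by auto
    qed
    also have "\<dots> \<in> sets (lebesgue_on S)"
    proof (rule sets.countable_UN''[OF D(1)])
      fix T assume "T \<in> D"
      then have "(\<lambda>x. G (u x) T - G (w x) T) \<in> borel_measurable (lebesgue_on S)"
        using u w D(2) unfolding qmeasurable_on_def by (intro borel_measurable_diff) auto
      then show "{x \<in> space (lebesgue_on S). a < G (u x) T - G (w x) T} \<in> sets (lebesgue_on S)"
        unfolding borel_measurable_iff_greater by blast
    qed
    finally show "?L \<in> sets (lebesgue_on S)" .
  qed
qed

lemma G_tuple_isCont:
  fixes ps :: "(real ^ 'n \<Rightarrow> real ^ 'm) list"
  assumes "\<And>p. p \<in> set ps \<Longrightarrow> isCont p x" and T: "size T = length ps"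
  shows "isCont (\<lambda>x. G (mset (map (\<lambda>p. p x) ps)) T) x"
proof -
  let ?P = "\<lambda>x. mset (map (\<lambda>p. p x) ps)"
  let ?b = "\<lambda>y. \<Sum>i<length ps. norm ((ps ! i) y - (ps ! i) x)"
  have le: "norm (G (?P y) T - G (?P x) T) \<le> ?b y" for y
  proof -
    have "G (?P y) (?P x) \<le> L2_set (\<lambda>i. norm (map (\<lambda>p. p y) ps ! i - map (\<lambda>p. p x) ps ! i))
        {..<length (map (\<lambda>p. p y) ps)}"
      by (rule qdist_le) simp
    also have "\<dots> \<le> (\<Sum>i<length (map (\<lambda>p. p y) ps). norm (map (\<lambda>p. p y) ps ! i - map (\<lambda>p. p x) ps ! i))"
      by (rule L2_set_le_sum) auto
    also have "\<dots> = ?b y" by simp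
    finally have "G (?P y) (?P x) \<le> ?b y" .
    moreover have "G (?P y) T \<le> G (?P y) (?P x) + G (?P x) T"
      "G (?P x) T \<le> G (?P x) (?P y) + G (?P y) T"
      using T by (auto intro!: G_triangle)
    moreover have "G (?P x) (?P y) = G (?P y) (?P x)" by (rule G_sym) simp
    ultimately show ?thesis unfolding real_norm_def by linarith
  qed
  have "(?b \<longlongrightarrow> 0) (at x)"
  proof (rule tendsto_null_sum)
    fix i assume "i \<in> {..<length ps}"
    then have "isCont (ps ! i) x" using assms by simp
    then show "((\<lambda>y. norm ((ps ! i) y - (ps ! i) x)) \<longlongrightarrow> 0) (at x)"
      unfolding isCont_def by (intro tendsto_norm_zero LIM_zero)
  qed
  then have "((\<lambda>y. G (?P y) T - G (?P x) T) \<longlongrightarrow> 0) (at x)"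
    by (rule Lim_null_comparison[rotated]) (use le in auto)
  then show ?thesis unfolding isCont_def by (rule LIM_zero_cancel)
qed

lemma qmeasurable_on_continuous:
  fixes ps :: "(real ^ 'n \<Rightarrow> real ^ 'm) list"
  assumes "\<And>p x. p \<in> set ps \<Longrightarrow> isCont p x"
  shows "qmeasurable_on (length ps) S (\<lambda>x. mset (map (\<lambda>p. p x) ps))"
  unfolding qmeasurable_on_def
proof (intro allI impI)
  fix T :: "(real ^ 'm) multiset" assume T: "size T = length ps"
  let ?P = "\<lambda>x. mset (map (\<lambda>p. p x) ps)"
  have "continuous_on UNIV (\<lambda>x. G (?P x) T)"
    using G_tuple_isCont[OF assms T] by (simp add: continuous_on_eq_continuous_at)
  then have "(\<lambda>x. G (?P x) T) \<in> borel_measurable lborel"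
    by (simp add: borel_measurable_continuous_onI)
  then have "(\<lambda>x. G (?P x) T) \<in> borel_measurable lebesgue" by (rule measurable_completion)
  then show "(\<lambda>x. G (?P x) T) \<in> borel_measurable (lebesgue_on S)"
    by (rule measurable_restrict_space1)
qed

section \<open>Polynomials and their partial derivatives\<close>

abbreviation multi_indices :: "nat \<Rightarrow> ('n::finite \<Rightarrow> nat) set" where
  "multi_indices k \<equiv> {\<alpha>. (\<Sum>i\<in>UNIV. \<alpha> i) \<le> k}"

abbreviation monomial :: "('n \<Rightarrow> nat) \<Rightarrow> real ^ 'n \<Rightarrow> real" where
  "monomial \<alpha> x \<equiv> (\<Prod>i\<in>UNIV. (x $ i) ^ \<alpha> i)"

lemma multi_index_le: "\<alpha> \<in> multi_indices k \<Longrightarrow> \<alpha> i \<le> k"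
  using member_le_sum[of i UNIV \<alpha>] by simp

lemma finite_multi_indices: "finite (multi_indices k :: ('n::finite \<Rightarrow> nat) set)"
proof (rule finite_subset)
  show "(multi_indices k :: ('n \<Rightarrow> nat) set) \<subseteq> PiE UNIV (\<lambda>_. {..k})"
    using multi_index_le by (auto simp: PiE_UNIV_domain)
  show "finite (PiE (UNIV :: 'n set) (\<lambda>_. {..k}))" by (intro finite_PiE) auto
qed

lemma poly_funI: "(\<And>x. f x = (\<Sum>\<alpha>\<in>multi_indices k. c \<alpha> * monomial \<alpha> x)) \<Longrightarrow> f \<in> poly_fun k"
  unfolding poly_fun_def by auto

lemma poly_fun_monomial:
  assumes "\<alpha> \<in> multi_indices k" shows "(\<lambda>x. c * monomial \<alpha> x) \<in> poly_fun k"
  unfolding poly_fun_def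
proof (intro CollectI exI allI)
  fix x :: "real ^ 'a"
  have "(\<Sum>\<beta>\<in>multi_indices k. (if \<beta> = \<alpha> then c else 0) * monomial \<beta> x)
      = (\<Sum>\<beta>\<in>multi_indices k. if \<beta> = \<alpha> then c * monomial \<beta> x else 0)"
    by (intro sum.cong) auto
  also have "\<dots> = c * monomial \<alpha> x" using assms finite_multi_indices by (subst sum.delta) auto
  finally show "c * monomial \<alpha> x = (\<Sum>\<beta>\<in>multi_indices k. (if \<beta> = \<alpha> then c else 0) * monomial \<beta> x)"
    by simp
qed

lemma poly_fun_add:
  assumes "f \<in> poly_fun k" "g \<in> poly_fun k" shows "(\<lambda>x. f x + g x) \<in> poly_fun k"
proof -
  obtain c d where "\<And>x. f x = (\<Sum>\<alpha>\<in>multi_indices k. c \<alpha> * monomial \<alpha> x)"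
    "\<And>x. g x = (\<Sum>\<alpha>\<in>multi_indices k. d \<alpha> * monomial \<alpha> x)"
    using assms unfolding poly_fun_def by auto
  then have "\<And>x. f x + g x = (\<Sum>\<alpha>\<in>multi_indices k. (c \<alpha> + d \<alpha>) * monomial \<alpha> x)"
    by (simp add: sum.distrib distrib_right)
  then show ?thesis by (rule poly_funI)
qed

lemma poly_fun_cmult:
  assumes "f \<in> poly_fun k" shows "(\<lambda>x. a * f x) \<in> poly_fun k"
proof -
  obtain c where "\<And>x. f x = (\<Sum>\<alpha>\<in>multi_indices k. c \<alpha> * monomial \<alpha> x)"
    using assms unfolding poly_fun_def by auto
  then have "\<And>x. a * f x = (\<Sum>\<alpha>\<in>multi_indices k. (a * c \<alpha>) * monomial \<alpha> x)"
    by (simp add: sum_distrib_left mult.assoc)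
  then show ?thesis by (rule poly_funI)
qed

lemma poly_fun_const: "(\<lambda>x. a) \<in> poly_fun k"
  using poly_fun_monomial[of "\<lambda>_. 0" k a] by simp

lemma poly_fun_diff:
  assumes "f \<in> poly_fun k" "g \<in> poly_fun k" shows "(\<lambda>x. f x - g x) \<in> poly_fun k"
  using poly_fun_add[OF assms(1) poly_fun_cmult[OF assms(2), of "-1"]] by simp

lemma poly_fun_sum:
  assumes "\<And>i. i \<in> I \<Longrightarrow> f i \<in> poly_fun k" shows "(\<lambda>x. \<Sum>i\<in>I. f i x) \<in> poly_fun k"
  using assms
proof (induction I rule: infinite_finite_induct)
  case (insert i I)
  then show ?case using poly_fun_add[of "f i" k "\<lambda>x. \<Sum>i\<in>I. f i x"] by simp
qed (auto intro: poly_fun_const)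

lemma poly_fun_mult:
  assumes "f \<in> poly_fun a" "g \<in> poly_fun b" shows "(\<lambda>x. f x * g x) \<in> poly_fun (a + b)"
proof -
  obtain c d where cd: "\<And>x. f x = (\<Sum>\<alpha>\<in>multi_indices a. c \<alpha> * monomial \<alpha> x)"
    "\<And>x. g x = (\<Sum>\<beta>\<in>multi_indices b. d \<beta> * monomial \<beta> x)"
    using assms unfolding poly_fun_def by auto
  have "(\<lambda>x. f x * g x) = (\<lambda>x. \<Sum>\<alpha>\<in>multi_indices a. \<Sum>\<beta>\<in>multi_indices b.
      (c \<alpha> * d \<beta>) * monomial (\<lambda>i. \<alpha> i + \<beta> i) x)"
    by (auto simp: cd sum_product power_add prod.distrib mult_ac intro!: sum.cong)
  also have "\<dots> \<in> poly_fun (a + b)"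
    by (intro poly_fun_sum poly_fun_monomial) (auto simp: sum.distrib)
  finally show ?thesis .
qed

lemma poly_fun_affine_coordinate: "(\<lambda>x :: real ^ 'n. a + s * x $ i) \<in> poly_fun 1"
proof -
  let ?\<alpha> = "\<lambda>j. if j = i then 1 else 0 :: nat"
  have "(\<lambda>x :: real ^ 'n. s * monomial ?\<alpha> x) = (\<lambda>x. s * x $ i)"
  proof (rule ext)
    fix x :: "real ^ 'n"
    have "monomial ?\<alpha> x = (\<Prod>j\<in>UNIV. if j = i then x $ j else 1)" by (intro prod.cong) auto
    then show "s * monomial ?\<alpha> x = s * x $ i" by simp
  qed
  moreover have "(\<lambda>x. s * monomial ?\<alpha> x) \<in> poly_fun 1" by (rule poly_fun_monomial) simp
  ultimately have "(\<lambda>x :: real ^ 'n. s * x $ i) \<in> poly_fun 1" by simp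
  then show ?thesis by (rule poly_fun_add[OF poly_fun_const])
qed

lemma poly_fun_power:
  assumes "f \<in> poly_fun a" shows "(\<lambda>x. f x ^ j) \<in> poly_fun (j * a)"
proof (induction j)
  case (Suc j) then show ?case using poly_fun_mult[OF assms Suc] by simp
qed (simp add: poly_fun_const)

lemma poly_fun_prod:
  assumes "finite I" "\<And>i. i \<in> I \<Longrightarrow> f i \<in> poly_fun (a i)"
  shows "(\<lambda>x. \<Prod>i\<in>I. f i x) \<in> poly_fun (\<Sum>i\<in>I. a i)"
  using assms
proof (induction I rule: finite_induct)
  case (insert i I)
  then show ?case using poly_fun_mult[of "f i" "a i" "\<lambda>x. \<Prod>i\<in>I. f i x"] by simp
qed (simp add: poly_fun_const)

lemma poly_fun_mono:
  fixes f :: "real ^ 'n \<Rightarrow> real"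
  assumes "f \<in> poly_fun j" "j \<le> k" shows "f \<in> poly_fun k"
proof -
  obtain c where c: "\<And>x. f x = (\<Sum>\<alpha>\<in>multi_indices j. c \<alpha> * monomial \<alpha> x)"
    using assms unfolding poly_fun_def by auto
  have "(\<lambda>x. \<Sum>\<alpha>\<in>multi_indices j. c \<alpha> * monomial \<alpha> x) \<in> poly_fun k"
    by (intro poly_fun_sum poly_fun_monomial) (use assms in auto)
  moreover have "f = (\<lambda>x. \<Sum>\<alpha>\<in>multi_indices j. c \<alpha> * monomial \<alpha> x)" by (rule ext) (rule c)
  ultimately show ?thesis by simp
qed

lemma poly_fun_affine:
  fixes f :: "real ^ 'n \<Rightarrow> real"
  assumes "f \<in> poly_fun k" shows "(\<lambda>w. f (a + s *\<^sub>R w)) \<in> poly_fun k"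
proof -
  obtain c where c: "\<And>x. f x = (\<Sum>\<alpha>\<in>multi_indices k. c \<alpha> * monomial \<alpha> x)"
    using assms unfolding poly_fun_def by auto
  have "(\<lambda>w. \<Sum>\<alpha>\<in>multi_indices k. c \<alpha> * (\<Prod>i\<in>UNIV. (a $ i + s * w $ i) ^ \<alpha> i)) \<in> poly_fun k"
  proof (intro poly_fun_sum poly_fun_cmult)
    fix \<alpha> :: "'n \<Rightarrow> nat" assume \<alpha>: "\<alpha> \<in> multi_indices k"
    have "(\<lambda>w :: real ^ 'n. \<Prod>i\<in>UNIV. (a $ i + s * w $ i) ^ \<alpha> i) \<in> poly_fun (\<Sum>i\<in>UNIV. \<alpha> i * 1)"
      by (intro poly_fun_prod poly_fun_power poly_fun_affine_coordinate) auto
    then show "(\<lambda>w :: real ^ 'n. \<Prod>i\<in>UNIV. (a $ i + s * w $ i) ^ \<alpha> i) \<in> poly_fun k"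
      by (rule poly_fun_mono) (use \<alpha> in simp)
  qed
  then show ?thesis by (simp add: c)
qed

text \<open>
  Bounds are carried by the coefficients: they survive differentiation and control values, with
  constants that depend on the degree and the dimension only.
\<close>

definition coeff_bounded :: "nat \<Rightarrow> real \<Rightarrow> (real ^ 'n \<Rightarrow> real) \<Rightarrow> bool" where
  "coeff_bounded k E f \<longleftrightarrow> (\<exists>c. (\<forall>x. f x = (\<Sum>\<alpha>\<in>multi_indices k. c \<alpha> * monomial \<alpha> x)) \<and>
     (\<forall>\<alpha>\<in>multi_indices k. \<bar>c \<alpha>\<bar> \<le> E))"

lemma coeff_bounded_pointwise:
  fixes f :: "real ^ 'n \<Rightarrow> real"
  assumes "coeff_bounded k E f"
  shows "\<bar>f x\<bar> \<le> real (card (multi_indices k :: ('n \<Rightarrow> nat) set)) * E * (1 + norm x) ^ k"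
proof -
  obtain c where c: "f x = (\<Sum>\<alpha>\<in>multi_indices k. c \<alpha> * monomial \<alpha> x)"
    "\<And>\<alpha>. \<alpha> \<in> multi_indices k \<Longrightarrow> \<bar>c \<alpha>\<bar> \<le> E"
    using assms unfolding coeff_bounded_def by auto
  have "\<bar>f x\<bar> \<le> (\<Sum>\<alpha>\<in>multi_indices k. \<bar>c \<alpha>\<bar> * \<bar>monomial \<alpha> x\<bar>)"
    unfolding c(1) abs_mult[symmetric] by (rule sum_abs)
  also have "\<dots> \<le> (\<Sum>\<alpha>\<in>(multi_indices k :: ('n \<Rightarrow> nat) set). E * (1 + norm x) ^ k)"
  proof (rule sum_mono)
    fix \<alpha> :: "'n \<Rightarrow> nat" assume \<alpha>: "\<alpha> \<in> multi_indices k"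
    have "\<bar>monomial \<alpha> x\<bar> = (\<Prod>i\<in>UNIV. \<bar>x $ i\<bar> ^ \<alpha> i)" by (simp add: abs_prod power_abs)
    also have "\<dots> \<le> (\<Prod>i\<in>UNIV. (1 + norm x) ^ \<alpha> i)"
      using component_le_norm_cart[of x] by (intro prod_mono conjI power_mono) (auto intro: add_increasing)
    also have "\<dots> = (1 + norm x) ^ (\<Sum>i\<in>UNIV. \<alpha> i)" by (rule power_sum[symmetric])
    also have "\<dots> \<le> (1 + norm x) ^ k" using \<alpha> by (intro power_increasing) auto
    finally show "\<bar>c \<alpha>\<bar> * \<bar>monomial \<alpha> x\<bar> \<le> E * (1 + norm x) ^ k"
      using c(2)[OF \<alpha>] by (intro mult_mono) auto
  qed
  finally show ?thesis by simp
qed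

definition partial :: "'n \<Rightarrow> (real ^ 'n \<Rightarrow> real) \<Rightarrow> real ^ 'n \<Rightarrow> real" where
  "partial l f x = frechet_derivative f (at x) (axis l 1)"

text \<open>
  Iterated partial derivatives run along a list whose head is the last differentiation, since this is
  how the components of the tensors of higher derivatives are indexed.
\<close>

fun partials :: "'n list \<Rightarrow> (real ^ 'n \<Rightarrow> real) \<Rightarrow> real ^ 'n \<Rightarrow> real" where
  "partials [] f = f"
| "partials (l # is) f = partial l (partials is f)"

lemma partial_eq:
  assumes "(f has_derivative f') (at x)" shows "partial l f x = f' (axis l 1)"
  using frechet_derivative_at[OF assms] by (simp add: partial_def)

lemma monomial_has_derivative:
  "(monomial \<alpha> has_derivative
    (\<lambda>h. \<Sum>i\<in>UNIV. h $ i * (real (\<alpha> i) * monomial (\<alpha>(i := \<alpha> i - 1)) x))) (at x)"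
proof -
  have 1: "((\<lambda>x. x $ i ^ \<alpha> i) has_derivative (\<lambda>h. real (\<alpha> i) * h $ i * x $ i ^ (\<alpha> i - 1))) (at x)" for i
    by (auto intro!: derivative_eq_intros bounded_linear.has_derivative[OF bounded_linear_vec_nth])
  have "((\<lambda>x. \<Prod>i\<in>UNIV. (x $ i) ^ \<alpha> i) has_derivative
     (\<lambda>h. \<Sum>i\<in>UNIV. (real (\<alpha> i) * h $ i * x $ i ^ (\<alpha> i - 1)) * (\<Prod>j\<in>UNIV - {i}. x $ j ^ \<alpha> j))) (at x)"
    by (rule has_derivative_prod) (rule 1)
  moreover have "monomial (\<alpha>(i := \<alpha> i - 1)) x = x $ i ^ (\<alpha> i - 1) * (\<Prod>j\<in>UNIV - {i}. x $ j ^ \<alpha> j)" for i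
    by (subst prod.remove[of _ i]) (auto intro!: prod.cong)
  ultimately show ?thesis by (simp add: mult_ac)
qed

lemma poly_expansion_has_derivative:
  fixes f :: "real ^ 'n \<Rightarrow> real"
  assumes "\<And>x. f x = (\<Sum>\<alpha>\<in>multi_indices k. c \<alpha> * monomial \<alpha> x)"
  shows "(f has_derivative (\<lambda>h. \<Sum>i\<in>UNIV. h $ i *
      (\<Sum>\<alpha>\<in>multi_indices k. c \<alpha> * (real (\<alpha> i) * monomial (\<alpha>(i := \<alpha> i - 1)) x)))) (at x)"
proof -
  have "((\<lambda>x. \<Sum>\<alpha>\<in>multi_indices k. c \<alpha> * monomial \<alpha> x) has_derivative
     (\<lambda>h. \<Sum>\<alpha>\<in>multi_indices k. c \<alpha> *
       (\<Sum>i\<in>UNIV. h $ i * (real (\<alpha> i) * monomial (\<alpha>(i := \<alpha> i - 1)) x)))) (at x)"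
    by (intro has_derivative_sum has_derivative_mult_right monomial_has_derivative)
  moreover have "(\<Sum>\<alpha>\<in>multi_indices k. c \<alpha> *
       (\<Sum>i\<in>UNIV. h $ i * (real (\<alpha> i) * monomial (\<alpha>(i := \<alpha> i - 1)) x)))
     = (\<Sum>i\<in>UNIV. h $ i *
      (\<Sum>\<alpha>\<in>multi_indices k. c \<alpha> * (real (\<alpha> i) * monomial (\<alpha>(i := \<alpha> i - 1)) x)))" for h :: "real ^ 'n"
    by (simp add: sum_distrib_left) (subst sum.swap, simp add: mult_ac)
  moreover have "f = (\<lambda>x. \<Sum>\<alpha>\<in>multi_indices k. c \<alpha> * monomial \<alpha> x)"
    by (rule ext) (rule assms)
  ultimately show ?thesis by (simp only:)
qed

lemma partial_expansion:
  fixes f :: "real ^ 'n \<Rightarrow> real"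
  assumes "\<And>x. f x = (\<Sum>\<alpha>\<in>multi_indices k. c \<alpha> * monomial \<alpha> x)"
  shows "partial l f x = (\<Sum>\<alpha>\<in>multi_indices k. c \<alpha> * (real (\<alpha> l) * monomial (\<alpha>(l := \<alpha> l - 1)) x))"
proof -
  have "(\<Sum>i\<in>UNIV. axis l 1 $ i * g i) = g l" for g :: "'n \<Rightarrow> real"
  proof -
    have "(\<Sum>i\<in>UNIV. axis l 1 $ i * g i) = (\<Sum>i\<in>UNIV. if i = l then g i else 0)"
      by (intro sum.cong) (auto simp: axis_def)
    then show ?thesis by simp
  qed
  then show ?thesis by (subst partial_eq[OF poly_expansion_has_derivative[OF assms]]) simp
qed

lemma poly_fun_has_derivative:
  assumes "f \<in> poly_fun k"
  shows "(f has_derivative (\<lambda>h. \<Sum>l\<in>UNIV. h $ l * partial l f x)) (at x)"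
proof -
  obtain c where c: "\<And>x. f x = (\<Sum>\<alpha>\<in>multi_indices k. c \<alpha> * monomial \<alpha> x)"
    using assms unfolding poly_fun_def by auto
  show ?thesis using poly_expansion_has_derivative[OF c] partial_expansion[OF c] by simp
qed

lemma poly_fun_isCont: "f \<in> poly_fun k \<Longrightarrow> isCont f x"
  by (rule has_derivative_continuous[OF poly_fun_has_derivative])

lemma coeff_bounded_partial:
  fixes f :: "real ^ 'n \<Rightarrow> real"
  assumes f: "coeff_bounded k E f" and E: "0 \<le> E"
  shows "coeff_bounded (k - 1) (real k * E) (partial l f)"
proof -
  obtain c where c: "\<And>x. f x = (\<Sum>\<alpha>\<in>multi_indices k. c \<alpha> * monomial \<alpha> x)"
    "\<And>\<alpha>. \<alpha> \<in> multi_indices k \<Longrightarrow> \<bar>c \<alpha>\<bar> \<le> E"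
    using f unfolding coeff_bounded_def by auto
  note pd = partial_expansion[OF c(1)]
  have upd: "(\<Sum>i\<in>UNIV. (\<alpha>(l := a)) i) = a + (\<Sum>i\<in>UNIV - {l}. \<alpha> i)" for \<alpha> :: "'n \<Rightarrow> nat" and a
    by (subst sum.remove[of _ l]) (auto intro!: sum.cong)
  have self: "(\<Sum>i\<in>UNIV. \<alpha> i) = \<alpha> l + (\<Sum>i\<in>UNIV - {l}. \<alpha> i)" for \<alpha> :: "'n \<Rightarrow> nat"
    by (subst sum.remove[of _ l]) auto
  show ?thesis
  proof (cases k)
    case 0
    have "partial l f x = 0" for x
      unfolding pd using multi_index_le[of _ k l] 0 by (intro sum.neutral) auto
    then show ?thesis unfolding coeff_bounded_def 0
      by (intro exI[of _ "\<lambda>_. 0"]) auto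
  next
    case (Suc k')
    define d where "d \<beta> = c (\<beta>(l := \<beta> l + 1)) * real (\<beta> l + 1)" for \<beta>
    show ?thesis
      unfolding coeff_bounded_def
    proof (intro exI[of _ d] conjI allI ballI)
      fix x
      have "partial l f x = (\<Sum>\<alpha>\<in>multi_indices k \<inter> {\<alpha>. \<alpha> l \<noteq> 0}.
          c \<alpha> * (real (\<alpha> l) * monomial (\<alpha>(l := \<alpha> l - 1)) x))"
        unfolding pd by (rule sum.mono_neutral_right) (auto simp: finite_multi_indices)
      also have "\<dots> = (\<Sum>\<beta>\<in>multi_indices (k - 1). d \<beta> * monomial \<beta> x)"
      proof (rule sum.reindex_bij_witness[of _ "\<lambda>\<beta>. \<beta>(l := \<beta> l + 1)" "\<lambda>\<alpha>. \<alpha>(l := \<alpha> l - 1)"])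
        fix \<alpha> assume \<alpha>: "\<alpha> \<in> multi_indices k \<inter> {\<alpha>. \<alpha> l \<noteq> 0}"
        then show "\<alpha>(l := \<alpha> l - 1, l := (\<alpha>(l := \<alpha> l - 1)) l + 1) = \<alpha>" by auto
        show "\<alpha>(l := \<alpha> l - 1) \<in> multi_indices (k - 1)"
          using \<alpha> upd[of \<alpha> "\<alpha> l - 1"] self[of \<alpha>] by auto
        show "d (\<alpha>(l := \<alpha> l - 1)) * monomial (\<alpha>(l := \<alpha> l - 1)) x
            = c \<alpha> * (real (\<alpha> l) * monomial (\<alpha>(l := \<alpha> l - 1)) x)"
          using \<alpha> by (simp add: d_def of_nat_diff del: fun_upd_apply)
             (simp add: fun_upd_idem)
      next
        fix \<beta> :: "'n \<Rightarrow> nat" assume \<beta>: "\<beta> \<in> multi_indices (k - 1)"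
        show "\<beta>(l := \<beta> l + 1, l := (\<beta>(l := \<beta> l + 1)) l - 1) = \<beta>" by auto
        show "\<beta>(l := \<beta> l + 1) \<in> multi_indices k \<inter> {\<alpha>. \<alpha> l \<noteq> 0}"
          using \<beta> upd[of \<beta> "\<beta> l + 1"] self[of \<beta>] Suc by auto
      qed
      finally show "partial l f x = (\<Sum>\<beta>\<in>multi_indices (k - 1). d \<beta> * monomial \<beta> x)" .
    next
      fix \<beta> :: "'n \<Rightarrow> nat" assume \<beta>: "\<beta> \<in> multi_indices (k - 1)"
      have "\<beta>(l := \<beta> l + 1) \<in> multi_indices k"
        using \<beta> upd[of \<beta> "\<beta> l + 1"] self[of \<beta>] Suc by auto
      then have 1: "\<bar>c (\<beta>(l := \<beta> l + 1))\<bar> \<le> E" "\<beta> l + 1 \<le> k"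
        using c(2) multi_index_le[of "\<beta>(l := \<beta> l + 1)" k l] by auto
      have "\<bar>d \<beta>\<bar> = real (\<beta> l + 1) * \<bar>c (\<beta>(l := \<beta> l + 1))\<bar>" by (simp add: d_def abs_mult)
      also have "\<dots> \<le> real k * E" using 1 E by (intro mult_mono) auto
      finally show "\<bar>d \<beta>\<bar> \<le> real k * E" .
    qed
  qed
qed

lemma coeff_bounded_partials:
  assumes "coeff_bounded k E f" "0 \<le> E"
  shows "coeff_bounded (k - length is) (real k ^ length is * E) (partials is f)"
proof (induction "is")
  case (Cons l ls)
  let ?E = "real k ^ length ls * E"
  have "coeff_bounded (k - length ls - 1) (real (k - length ls) * ?E) (partials (l # ls) f)"
    using coeff_bounded_partial[OF Cons] assms(2) by simp
  moreover have "real (k - length ls) * ?E \<le> real k ^ length (l # ls) * E"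
    using assms(2) by (simp add: mult.assoc mult_right_mono)
  ultimately show ?case
    unfolding coeff_bounded_def by (auto intro: order_trans)
qed (use assms in simp)

lemma poly_fun_coeff_bounded:
  fixes f :: "real ^ 'n \<Rightarrow> real"
  assumes "f \<in> poly_fun k" obtains E where "0 \<le> E" "coeff_bounded k E f"
proof -
  obtain c where c: "\<And>x. f x = (\<Sum>\<alpha>\<in>multi_indices k. c \<alpha> * monomial \<alpha> x)"
    using assms unfolding poly_fun_def by auto
  show thesis
  proof (rule that)
    show "0 \<le> (\<Sum>\<alpha>\<in>multi_indices k. \<bar>c \<alpha>\<bar>)" by (rule sum_nonneg) simp
    show "coeff_bounded k (\<Sum>\<alpha>\<in>multi_indices k. \<bar>c \<alpha>\<bar>) f"
      unfolding coeff_bounded_def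
      using c by (intro exI[of _ c]) (auto intro!: member_le_sum finite_multi_indices)
  qed
qed

lemma partials_poly_fun:
  assumes "f \<in> poly_fun k" shows "partials is f \<in> poly_fun (k - length is)"
proof -
  obtain E where "0 \<le> E" "coeff_bounded k E f" using poly_fun_coeff_bounded[OF assms] .
  then show ?thesis using coeff_bounded_partials[of k E f "is"]
    unfolding coeff_bounded_def poly_fun_def by blast
qed

lemma partials_top_const:
  assumes "f \<in> poly_fun k" "length is = k" shows "partials is f x = partials is f y"
proof -
  have "partials is f \<in> poly_fun 0" using partials_poly_fun[OF assms(1), of "is"] assms(2) by simp
  then show ?thesis unfolding poly_fun_def by auto
qed

lemma partials_diff:
  assumes "f \<in> poly_fun k" "g \<in> poly_fun k"
  shows "partials is (\<lambda>x. f x - g x) = (\<lambda>x. partials is f x - partials is g x)"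
proof (induction "is")
  case (Cons l ls)
  have "partial l (\<lambda>x. partials ls f x - partials ls g x) x
      = partial l (partials ls f) x - partial l (partials ls g) x" for x
  proof -
    note df = poly_fun_has_derivative[OF partials_poly_fun[OF assms(1), of ls], of x]
    note dg = poly_fun_has_derivative[OF partials_poly_fun[OF assms(2), of ls], of x]
    show ?thesis
      by (subst partial_eq[OF has_derivative_diff[OF df dg]])
         (simp only: partial_eq[OF df, symmetric] partial_eq[OF dg, symmetric])
  qed
  then show ?case using Cons by auto
qed simp

lemma partials_affine:
  fixes f :: "real ^ 'n \<Rightarrow> real"
  assumes "f \<in> poly_fun k"
  shows "partials is (\<lambda>w. f (a + s *\<^sub>R w)) = (\<lambda>w. s ^ length is * partials is f (a + s *\<^sub>R w))"
proof (induction "is")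
  case (Cons l ls)
  have "partial l (\<lambda>w. s ^ length ls * partials ls f (a + s *\<^sub>R w)) w
      = s ^ Suc (length ls) * partial l (partials ls f) (a + s *\<^sub>R w)" for w
  proof -
    let ?g = "\<lambda>h. \<Sum>l\<in>UNIV. h $ l * partial l (partials ls f) (a + s *\<^sub>R w)"
    have g: "(partials ls f has_derivative ?g) (at (a + s *\<^sub>R w))"
      by (rule poly_fun_has_derivative[OF partials_poly_fun[OF assms]])
    have "((\<lambda>w. a + s *\<^sub>R w) has_derivative (\<lambda>h. s *\<^sub>R h)) (at w)"
      by (auto intro!: derivative_eq_intros)
    from has_derivative_compose[OF this g]
    have d: "((\<lambda>w. s ^ length ls * partials ls f (a + s *\<^sub>R w)) has_derivative
        (\<lambda>h. s ^ length ls * ?g (s *\<^sub>R h))) (at w)"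
      by (rule has_derivative_mult_right)
    have "?g (s *\<^sub>R axis l 1) = s * partial l (partials ls f) (a + s *\<^sub>R w)"
      using partial_eq[OF g, of l] by (simp add: mult.assoc flip: sum_distrib_left)
    then show ?thesis by (subst partial_eq[OF d]) (simp only: power_Suc mult_ac)
  qed
  then show ?case using Cons by auto
qed simp

section \<open>Coefficients from the values on a curve\<close>

lemma digits_unique:
  fixes a b :: "nat \<Rightarrow> nat"
  assumes "\<And>j. j < n \<Longrightarrow> a j < K" "\<And>j. j < n \<Longrightarrow> b j < K"
    "(\<Sum>j<n. a j * K ^ j) = (\<Sum>j<n. b j * K ^ j)" "j < n"
  shows "a j = b j"
  using assms
proof (induction n arbitrary: a b j)
  case (Suc n)
  have split: "(\<Sum>j<Suc n. c j * K ^ j) = c 0 + K * (\<Sum>j<n. c (Suc j) * K ^ j)" for c :: "nat \<Rightarrow> nat"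
    by (simp add: sum.lessThan_Suc_shift sum_distrib_left mult_ac del: sum.lessThan_Suc)
  have K: "a 0 < K" "b 0 < K" using Suc.prems by auto
  have eq: "a 0 + K * (\<Sum>j<n. a (Suc j) * K ^ j) = b 0 + K * (\<Sum>j<n. b (Suc j) * K ^ j)"
    using Suc.prems(3) unfolding split .
  have 0: "a 0 = b 0" using arg_cong[OF eq, of "\<lambda>m. m mod K"] K by simp
  with eq K have S: "(\<Sum>j<n. a (Suc j) * K ^ j) = (\<Sum>j<n. b (Suc j) * K ^ j)" by simp
  show ?case
  proof (cases j)
    case (Suc i)
    have "a (Suc i) = b (Suc i)"
      by (rule Suc.IH[of "\<lambda>j. a (Suc j)" "\<lambda>j. b (Suc j)" i]) (use Suc.prems S Suc in auto)
    then show ?thesis using Suc by simp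
  qed (use 0 in simp)
qed simp

text \<open>
  Kronecker's substitution \<open>x\<^sub>i = t ^ w i\<close> with \<open>w i = (k + 1) ^ e i\<close>, where \<open>e\<close> numbers the coordinates: the exponent of \<open>t\<close> that a monomial
  of degree at most \<open>k\<close> turns into has the multi-index as its digits in base \<open>k + 1\<close>. Different monomials
  therefore stay different, and the coefficients of the polynomial can be read off from its restriction to
  the curve.
\<close>

lemma kronecker_exponents:
  obtains w :: "'n::finite \<Rightarrow> nat" where
    "inj_on (\<lambda>\<alpha>. \<Sum>i\<in>UNIV. \<alpha> i * w i) (multi_indices k)" "\<And>i. 0 < w i"
proof -
  obtain e :: "'n \<Rightarrow> nat" where e: "bij_betw e UNIV {..<CARD('n)}"
    using ex_bij_betw_finite_nat[of "UNIV :: 'n set"] by (auto simp: atLeast0LessThan)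
  let ?w = "\<lambda>i. (Suc k) ^ e i"
  show thesis
  proof (rule that[of ?w])
    show "0 < ?w i" for i by simp
    show "inj_on (\<lambda>\<alpha>. \<Sum>i\<in>UNIV. \<alpha> i * ?w i) (multi_indices k)"
    proof (rule inj_onI)
      fix \<alpha> \<beta> :: "'n \<Rightarrow> nat"
      assume a: "\<alpha> \<in> multi_indices k" and b: "\<beta> \<in> multi_indices k"
        and eq: "(\<Sum>i\<in>UNIV. \<alpha> i * ?w i) = (\<Sum>i\<in>UNIV. \<beta> i * ?w i)"
      let ?d = "\<lambda>\<alpha> j. \<alpha> (inv_into UNIV e j)"
      have inv: "inv_into UNIV e (e i) = i" for i
        using e by (intro inv_into_f_f) (auto simp: bij_betw_def)
      have re: "(\<Sum>i\<in>UNIV. \<alpha> i * ?w i) = (\<Sum>j<CARD('n). ?d \<alpha> j * Suc k ^ j)" for \<alpha> :: "'n \<Rightarrow> nat"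
        using sum.reindex_bij_betw[OF e, of "\<lambda>j. ?d \<alpha> j * Suc k ^ j"] by (simp add: inv)
      show "\<alpha> = \<beta>"
      proof
        fix i
        have "?d \<alpha> (e i) = ?d \<beta> (e i)"
        proof (rule digits_unique[of "CARD('n)" "?d \<alpha>" "Suc k" "?d \<beta>"])
          show "?d \<alpha> j < Suc k" "?d \<beta> j < Suc k" for j
            using multi_index_le[OF a] multi_index_le[OF b] by (auto simp: less_Suc_eq_le)
          show "(\<Sum>j<CARD('n). ?d \<alpha> j * Suc k ^ j) = (\<Sum>j<CARD('n). ?d \<beta> j * Suc k ^ j)"
            using eq unfolding re .
          show "e i < CARD('n)" using e by (auto simp: bij_betw_def)
        qed
        then show "\<alpha> i = \<beta> i" by (simp add: inv)
      qed
    qed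
  qed
qed

lemma lagrange_coeff_bound:
  fixes T :: "real set"
  assumes "finite T"
  obtains C where "0 \<le> C"
    "\<And>p E j. degree p < card T \<Longrightarrow> (\<And>t. t \<in> T \<Longrightarrow> \<bar>poly p t\<bar> \<le> E) \<Longrightarrow> \<bar>coeff p j\<bar> \<le> C * E"
proof -
  define L where "L t = (\<Prod>s\<in>T - {t}. smult (1 / (t - s)) [:- s, 1:])" for t
  have L: "poly (L t) s = (if s = t then 1 else 0)" if "t \<in> T" "s \<in> T" for s t
  proof (cases "s = t")
    case True
    have "poly (smult (1 / (t - r)) [:- r, 1:]) t = 1" if "r \<in> T - {t}" for r
    proof -
      have "poly [:- r, 1:] t = t - r" "t - r \<noteq> 0" using that by auto
      then show ?thesis by (simp only: poly_smult) simp
    qed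
    then show ?thesis using True by (simp add: L_def poly_prod del: poly_smult poly_pCons)
  next
    case False
    have "poly (L t) s = 0" unfolding L_def poly_prod
      by (rule prod_zero) (use that assms False in \<open>auto intro!: bexI[of _ s]\<close>)
    then show ?thesis using False by simp
  qed
  have degL: "degree (L t) < card T" if "t \<in> T" for t
  proof -
    have "degree (L t) \<le> (\<Sum>s\<in>T - {t}. degree (smult (1 / (t - s)) [:- s, 1:]))"
      using degree_prod_sum_le[OF finite_Diff[OF assms], of "\<lambda>s. smult (1 / (t - s)) [:- s, 1:]" "{t}"]
      unfolding L_def o_def .
    also have "\<dots> \<le> (\<Sum>s\<in>T - {t}. 1)"
      by (intro sum_mono order_trans[OF degree_smult_le]) simp
    also have "\<dots> < card T" using card_Diff1_less[OF assms that] by simp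
    finally show ?thesis .
  qed
  define C where "C = (\<Sum>j<card T. \<Sum>t\<in>T. \<bar>coeff (L t) j\<bar>)"
  show thesis
  proof (rule that[of C])
    show "0 \<le> C" unfolding C_def by (intro sum_nonneg) auto
    fix p E j assume p: "degree p < card T" and E: "\<And>t. t \<in> T \<Longrightarrow> \<bar>poly p t\<bar> \<le> E"
    have "T \<noteq> {}" using p by auto
    then have E0: "0 \<le> E" using E by (meson abs_ge_zero all_not_in_conv order_trans)
    have pL: "p = (\<Sum>t\<in>T. smult (poly p t) (L t))" (is "p = ?q")
    proof (rule poly_eqI_degree)
      show "poly p x = poly ?q x" if "x \<in> T" for x
      proof -
        have "poly ?q x = (\<Sum>t\<in>T. if t = x then poly p t else 0)"
          using L that by (auto simp: poly_sum intro!: sum.cong)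
        then show ?thesis using that assms by simp
      qed
      show "degree p < card T" by fact
      show "degree ?q < card T"
        by (rule degree_sum_less) (use degL p in \<open>auto intro: le_less_trans[OF degree_smult_le]\<close>)
    qed
    show "\<bar>coeff p j\<bar> \<le> C * E"
    proof (cases "j < card T")
      case True
      have "\<bar>coeff p j\<bar> = \<bar>\<Sum>t\<in>T. poly p t * coeff (L t) j\<bar>" by (subst pL) (simp add: coeff_sum)
      also have "\<dots> \<le> (\<Sum>t\<in>T. \<bar>poly p t\<bar> * \<bar>coeff (L t) j\<bar>)"
        unfolding abs_mult[symmetric] by (rule sum_abs)
      also have "\<dots> \<le> (\<Sum>t\<in>T. E * \<bar>coeff (L t) j\<bar>)" by (intro sum_mono mult_right_mono E) auto
      also have "\<dots> = (\<Sum>t\<in>T. \<bar>coeff (L t) j\<bar>) * E" by (simp add: sum_distrib_left mult.commute)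
      also have "\<dots> \<le> C * E" unfolding C_def
        by (intro mult_right_mono E0 member_le_sum[of j "{..<card T}" "\<lambda>j. \<Sum>t\<in>T. \<bar>coeff (L t) j\<bar>"])
           (use True in \<open>auto intro: sum_nonneg\<close>)
      finally show ?thesis .
    next
      case False
      then have "coeff p j = 0" using p by (intro coeff_eq_0) simp
      then show ?thesis using \<open>0 \<le> C\<close> E0 by simp
    qed
  qed
qed

text \<open>
  If the nodes are covered by at most \<open>N\<close> classes, then one class determines all polynomials of degree \<open>k\<close>,
  quantitatively. On the curve of Kronecker's substitution any \<open>D\<close> nodes suffice, where \<open>D\<close> exceeds all
  exponents that occur, so \<open>N * D + 1\<close> nodes force some class to contain enough of them. The classes will be
  the permutations that are optimal at a node.
\<close>

lemma nodes_robust_to_colouring: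
  obtains X :: "(real ^ 'n) set" and C where "finite X" "\<And>x. x \<in> X \<Longrightarrow> norm x \<le> 1" "0 \<le> C"
    "\<And>(F :: 'c set) Y. finite F \<Longrightarrow> card F \<le> N \<Longrightarrow> X \<subseteq> (\<Union>s\<in>F. Y s) \<Longrightarrow>
      \<exists>s\<in>F. \<forall>f\<in>poly_fun k. \<forall>E. (\<forall>x\<in>X \<inter> Y s. \<bar>f x\<bar> \<le> E) \<longrightarrow> coeff_bounded k (C * E) f"
proof -
  obtain w :: "'n \<Rightarrow> nat" where w: "inj_on (\<lambda>\<alpha>. \<Sum>i\<in>UNIV. \<alpha> i * w i) (multi_indices k)" "\<And>i. 0 < w i"
    using kronecker_exponents[of k] by blast
  define code where "code \<alpha> = (\<Sum>i\<in>UNIV. \<alpha> i * w i)" for \<alpha>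
  have "finite (code ` multi_indices k)" by (intro finite_imageI finite_multi_indices)
  then obtain D where D: "\<And>\<alpha>. \<alpha> \<in> multi_indices k \<Longrightarrow> code \<alpha> < D"
    unfolding finite_nat_set_iff_bounded by auto
  have "D > 0" using D[of "\<lambda>_. 0"] by auto
  define curve :: "real \<Rightarrow> real ^ 'n" where "curve t = (\<chi> i. t ^ w i)" for t
  (* The bound on the parameter keeps the curve in the unit ball, since its norm is at most \<open>n t\<close>. *)
  define node where "node j = 1 / (real CARD('n) * real (Suc j))" for j :: nat
  define T where "T = node ` {..N * D}"
  have node_inj: "inj node" by (rule injI) (simp add: node_def)
  have finT: "finite T" by (simp add: T_def)
  have cardT: "card T = Suc (N * D)"
    unfolding T_def by (subst card_image) (auto intro: inj_on_subset[OF node_inj])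
  have "\<exists>c. 0 \<le> c \<and> (\<forall>p E j. degree p < card T' \<longrightarrow> (\<forall>t\<in>T'. \<bar>poly p t\<bar> \<le> E) \<longrightarrow> \<bar>coeff p j\<bar> \<le> c * E)"
    if "T' \<in> Pow T" for T'
    using lagrange_coeff_bound[of T'] that finT finite_subset by (metis PowD)
  then obtain c where c: "\<And>T'. T' \<in> Pow T \<Longrightarrow> 0 \<le> c T'"
    "\<And>T' p E j. T' \<in> Pow T \<Longrightarrow> degree p < card T' \<Longrightarrow> (\<And>t. t \<in> T' \<Longrightarrow> \<bar>poly p t\<bar> \<le> E) \<Longrightarrow> \<bar>coeff p j\<bar> \<le> c T' * E"
    by metis
  (* One constant for all subsets of nodes, as the subset depends on the covering. *)
  define C where "C = sum c (Pow T)"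
  have C: "c T' \<le> C" if "T' \<in> Pow T" for T'
    unfolding C_def by (rule member_le_sum) (use that c finT in auto)
  show thesis
  proof (rule that[of "curve ` T" C])
    show "finite (curve ` T)" using finT by simp
    show "0 \<le> C" unfolding C_def using c(1) by (rule sum_nonneg)
    show "norm x \<le> 1" if x: "x \<in> curve ` T" for x
    proof -
      obtain j where j: "x = curve (node j)" using x by (auto simp: T_def)
      have n1: "real CARD('n) \<ge> 1" by (simp add: Suc_leI)
      have nj: "0 \<le> node j" "real CARD('n) * node j \<le> 1" by (auto simp: node_def)
      have "node j \<le> real CARD('n) * node j" using mult_right_mono[OF n1 nj(1)] by simp
      then have nj1: "node j \<le> 1" using nj(2) by linarith
      have "norm x \<le> (\<Sum>i\<in>UNIV. \<bar>x $ i\<bar>)" by (rule norm_le_l1_cart)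
      also have "\<dots> \<le> (\<Sum>i\<in>(UNIV :: 'n set). node j)"
      proof (rule sum_mono)
        fix i
        have "node j ^ w i \<le> node j ^ 1" using w(2)[of i] nj nj1 by (intro power_decreasing) auto
        then show "\<bar>x $ i\<bar> \<le> node j" using nj by (simp add: j curve_def)
      qed
      also have "\<dots> \<le> 1" using nj by simp
      finally show ?thesis .
    qed
    fix F :: "'c set" and Y assume F: "finite F" "card F \<le> N" and Y: "curve ` T \<subseteq> (\<Union>s\<in>F. Y s)"
    have "\<exists>s\<in>F. D \<le> card {t \<in> T. curve t \<in> Y s}"
    proof (rule ccontr)
      assume "\<not> ?thesis"
      then have less: "card {t \<in> T. curve t \<in> Y s} \<le> D" if "s \<in> F" for s using that by force
      have "card T \<le> card (\<Union>s\<in>F. {t \<in> T. curve t \<in> Y s})"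
        by (rule card_mono) (use F finT Y in auto)
      also have "\<dots> \<le> (\<Sum>s\<in>F. card {t \<in> T. curve t \<in> Y s})" by (rule card_UN_le) fact
      also have "\<dots> \<le> card F * D" using sum_bounded_above[of F, OF less] by simp
      also have "\<dots> \<le> N * D" using F by simp
      finally show False using cardT by simp
    qed
    then obtain s where s: "s \<in> F" "D \<le> card {t \<in> T. curve t \<in> Y s}" by blast
    obtain T' where T': "T' \<subseteq> {t \<in> T. curve t \<in> Y s}" "card T' = D"
      using obtain_subset_with_card_n[OF s(2)] by metis
    show "\<exists>s\<in>F. \<forall>f\<in>poly_fun k. \<forall>E. (\<forall>x\<in>curve ` T \<inter> Y s. \<bar>f x\<bar> \<le> E) \<longrightarrow> coeff_bounded k (C * E) f"
    proof (intro bexI[OF _ s(1)] ballI allI impI)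
      fix f :: "real ^ 'n \<Rightarrow> real" and E
      assume f: "f \<in> poly_fun k" and E: "\<forall>x\<in>curve ` T \<inter> Y s. \<bar>f x\<bar> \<le> E"
      obtain b where b: "\<And>x. f x = (\<Sum>\<alpha>\<in>multi_indices k. b \<alpha> * monomial \<alpha> x)"
        using f unfolding poly_fun_def by auto
      define g where "g = (\<Sum>\<alpha>\<in>multi_indices k. monom (b \<alpha>) (code \<alpha>))"
      have g_curve: "poly g t = f (curve t)" for t
      proof -
        have "monomial \<alpha> (curve t) = t ^ code \<alpha>" for \<alpha>
          by (simp add: curve_def code_def power_sum mult.commute flip: power_mult)
        then show ?thesis by (simp add: g_def b poly_sum poly_monom)
      qed
      have g_deg: "degree g < card T'"
        unfolding g_def T'(2)
        by (rule degree_sum_less) (use D \<open>D > 0\<close> in \<open>auto intro: le_less_trans[OF degree_monom_le]\<close>)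
      have g_coeff: "coeff g (code \<alpha>) = b \<alpha>" if \<alpha>: "\<alpha> \<in> multi_indices k" for \<alpha>
      proof -
        have "coeff g (code \<alpha>) = (\<Sum>\<beta>\<in>multi_indices k. if \<beta> = \<alpha> then b \<beta> else 0)"
          unfolding g_def coeff_sum
          using w(1) \<alpha> by (intro sum.cong) (auto simp: inj_on_def code_def)
        also have "\<dots> = b \<alpha>" using \<alpha> by (simp add: sum.delta[OF finite_multi_indices])
        finally show ?thesis .
      qed
      have gE: "\<bar>poly g t\<bar> \<le> E" if "t \<in> T'" for t
        using E T' that by (auto simp: g_curve)
      obtain t where "t \<in> T'" using T'(2) \<open>D > 0\<close> by (metis card_gt_0_iff ex_in_conv)
      then have "0 \<le> E" using gE abs_ge_zero order_trans by blast
      have T'P: "T' \<in> Pow T" using T' by auto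
      have "\<bar>b \<alpha>\<bar> \<le> C * E" if \<alpha>: "\<alpha> \<in> multi_indices k" for \<alpha>
      proof -
        have "\<bar>b \<alpha>\<bar> \<le> c T' * E" using c(2)[OF T'P g_deg gE] g_coeff[OF \<alpha>] by metis
        also have "\<dots> \<le> C * E" using C[OF T'P] \<open>0 \<le> E\<close> by (rule mult_right_mono)
        finally show ?thesis .
      qed
      then show "coeff_bounded k (C * E) f" unfolding coeff_bounded_def using b by blast
    qed
  qed
qed

section \<open>Matching the branches of two multivalued polynomials\<close>

definition poly_maps :: "nat \<Rightarrow> nat \<Rightarrow> (real ^ 'n \<Rightarrow> real ^ 'm) list \<Rightarrow> bool" where
  "poly_maps Q k ps \<longleftrightarrow> length ps = Q \<and> (\<forall>p\<in>set ps. \<forall>j. (\<lambda>x. p x $ j) \<in> poly_fun k)"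

abbreviation tuple_at :: "('a \<Rightarrow> 'b) list \<Rightarrow> 'a \<Rightarrow> 'b multiset" where
  "tuple_at ps x \<equiv> mset (map (\<lambda>p. p x) ps)"

lemma matching_from_nodes:
  obtains X :: "(real ^ 'n) set" and C where "finite X" "\<And>x. x \<in> X \<Longrightarrow> norm x \<le> 1" "0 \<le> C"
    "\<And>(ps :: (real ^ 'n \<Rightarrow> real ^ 'm) list) rs a s E. poly_maps Q k ps \<Longrightarrow> poly_maps Q k rs \<Longrightarrow>
      (\<And>x. x \<in> X \<Longrightarrow> G (tuple_at ps (a + s *\<^sub>R x)) (tuple_at rs (a + s *\<^sub>R x)) \<le> E) \<Longrightarrow>
      \<exists>\<sigma>. \<sigma> permutes {..<Q} \<and> (\<forall>i<Q. \<forall>j. coeff_bounded k (C * E)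
        (\<lambda>w. (ps ! i) (a + s *\<^sub>R w) $ j - (rs ! \<sigma> i) (a + s *\<^sub>R w) $ j))"
proof -
  obtain X :: "(real ^ 'n) set" and C where X: "finite X" "\<And>x. x \<in> X \<Longrightarrow> norm x \<le> 1" "0 \<le> C"
    "\<And>(F :: (nat \<Rightarrow> nat) set) Y. finite F \<Longrightarrow> card F \<le> fact Q \<Longrightarrow> X \<subseteq> (\<Union>s\<in>F. Y s) \<Longrightarrow>
      \<exists>s\<in>F. \<forall>f\<in>poly_fun k. \<forall>E. (\<forall>x\<in>X \<inter> Y s. \<bar>f x\<bar> \<le> E) \<longrightarrow> coeff_bounded k (C * E) f"
    using nodes_robust_to_colouring[of "fact Q" k thesis] by blast
  show thesis
  proof (rule that[OF X(1-3)])
    fix ps rs :: "(real ^ 'n \<Rightarrow> real ^ 'm) list" and a s E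
    assume ps: "poly_maps Q k ps" and rs: "poly_maps Q k rs"
      and E: "\<And>x. x \<in> X \<Longrightarrow> G (tuple_at ps (a + s *\<^sub>R x)) (tuple_at rs (a + s *\<^sub>R x)) \<le> E"
    let ?F = "{\<sigma>. \<sigma> permutes {..<Q}}"
    define Y where "Y \<sigma> = {x. \<forall>i<Q. norm ((ps ! i) (a + s *\<^sub>R x) - (rs ! \<sigma> i) (a + s *\<^sub>R x)) \<le> E}" for \<sigma>
    have len: "length ps = Q" "length rs = Q" using ps rs by (auto simp: poly_maps_def)
    have cover: "X \<subseteq> (\<Union>\<sigma>\<in>?F. Y \<sigma>)"
    proof
      fix x assume x: "x \<in> X"
      let ?xs = "map (\<lambda>p. p (a + s *\<^sub>R x)) ps" and ?ys = "map (\<lambda>p. p (a + s *\<^sub>R x)) rs"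
      have "length ?ys = length ?xs" using len by simp
      from qdist_attained[OF this, of norm]
      obtain \<sigma> where \<sigma>: "\<sigma> permutes {..<length ?xs}"
        "G (mset ?xs) (mset ?ys) = L2_set (\<lambda>i. norm (?xs ! i - ?ys ! \<sigma> i)) {..<length ?xs}" .
      have \<sigma>Q: "\<sigma> permutes {..<Q}" using \<sigma>(1) len by simp
      have "norm ((ps ! i) (a + s *\<^sub>R x) - (rs ! \<sigma> i) (a + s *\<^sub>R x)) \<le> E" if i: "i < Q" for i
      proof -
        have "\<sigma> i < Q" using permutes_in_image[OF \<sigma>Q] i by auto
        then have "norm ((ps ! i) (a + s *\<^sub>R x) - (rs ! \<sigma> i) (a + s *\<^sub>R x)) = norm (?xs ! i - ?ys ! \<sigma> i)"
          using i len by simp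
        also have "\<dots> \<le> L2_set (\<lambda>i. norm (?xs ! i - ?ys ! \<sigma> i)) {..<length ?xs}"
          by (rule member_le_L2_set) (use i len in auto)
        also have "\<dots> \<le> E" using \<sigma>(2) E[OF x] by simp
        finally show ?thesis .
      qed
      then show "x \<in> (\<Union>\<sigma>\<in>?F. Y \<sigma>)" using \<sigma>Q by (auto simp: Y_def)
    qed
    have "card ?F = fact Q" by (rule card_permutations) auto
    then obtain \<sigma> where \<sigma>: "\<sigma> permutes {..<Q}"
      "\<forall>f\<in>poly_fun k. \<forall>E. (\<forall>x\<in>X \<inter> Y \<sigma>. \<bar>f x\<bar> \<le> E) \<longrightarrow> coeff_bounded k (C * E) f"
      using X(4)[of ?F Y] cover finite_permutations[of "{..<Q}"] by auto
    have "coeff_bounded k (C * E) (\<lambda>w. (ps ! i) (a + s *\<^sub>R w) $ j - (rs ! \<sigma> i) (a + s *\<^sub>R w) $ j)"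
      if i: "i < Q" for i j
    proof (rule \<sigma>(2)[rule_format])
      have "\<sigma> i < Q" using permutes_in_image[OF \<sigma>(1)] i by auto
      then show "(\<lambda>w. (ps ! i) (a + s *\<^sub>R w) $ j - (rs ! \<sigma> i) (a + s *\<^sub>R w) $ j) \<in> poly_fun k"
        using ps rs i
        by (intro poly_fun_diff poly_fun_affine[of "\<lambda>x. (ps ! i) x $ j"]
            poly_fun_affine[of "\<lambda>x. (rs ! \<sigma> i) x $ j"]) (auto simp: poly_maps_def)
      fix x assume "x \<in> X \<inter> Y \<sigma>"
      then have "norm ((ps ! i) (a + s *\<^sub>R x) - (rs ! \<sigma> i) (a + s *\<^sub>R x)) \<le> E"
        using i by (auto simp: Y_def)
      then show "\<bar>(ps ! i) (a + s *\<^sub>R x) $ j - (rs ! \<sigma> i) (a + s *\<^sub>R x) $ j\<bar> \<le> E"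
        using component_le_norm_cart[of "(ps ! i) (a + s *\<^sub>R x) - (rs ! \<sigma> i) (a + s *\<^sub>R x)" j] by simp
    qed
    then show "\<exists>\<sigma>. \<sigma> permutes {..<Q} \<and> (\<forall>i<Q. \<forall>j. coeff_bounded k (C * E)
        (\<lambda>w. (ps ! i) (a + s *\<^sub>R w) $ j - (rs ! \<sigma> i) (a + s *\<^sub>R w) $ j))"
      using \<sigma>(1) by blast
  qed
qed

text \<open>
  The centre \<open>a\<close> of the expansion will only be known to lie within \<open>s\<close> of the given point \<open>x0\<close>; the bound is
  expressed by \<open>x0\<close>. It serves both near \<open>x0\<close>, as a bound for derivatives, and far away, as a bound for the growth.
\<close>

lemma rescaled_poly_bound:
  fixes f :: "real ^ 'n \<Rightarrow> real"
  assumes f: "f \<in> poly_fun k" and s: "0 < s" and E: "0 \<le> E"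
    and cb: "coeff_bounded k E (\<lambda>w. f (a + s *\<^sub>R w))" and a: "norm (a - x0) \<le> s"
    and len: "length is \<le> k"
  shows "\<bar>partials is f z\<bar> \<le> real (card (multi_indices k :: ('n \<Rightarrow> nat) set)) * (real k + 1) ^ k * 2 ^ k
      * E / s ^ length is * (1 + norm (z - x0) / s) ^ k"
proof -
  define t where "t = norm (z - x0) / s"
  have t: "0 \<le> t" using s by (simp add: t_def)
  define w where "w = (z - a) /\<^sub>R s"
  have z: "z = a + s *\<^sub>R w" using s by (simp add: w_def)
  have "norm (z - a) \<le> norm (z - x0) + norm (a - x0)"
    using norm_triangle_ineq4[of "z - x0" "a - x0"] by simp
  then have "norm (z - a) / s \<le> (norm (z - x0) + s) / s"
    using a s by (intro divide_right_mono) auto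
  moreover have "norm w = norm (z - a) / s" using s by (simp add: w_def divide_inverse mult.commute)
  ultimately have "norm w \<le> t + 1" using s by (simp add: t_def add_divide_distrib)
  then have w1: "1 + norm w \<le> 2 * (1 + t)" using t by simp
  let ?N = "real (card (multi_indices k :: ('n \<Rightarrow> nat) set))"
  let ?j = "length is"
  have cp: "coeff_bounded (k - ?j) (real k ^ ?j * E) (\<lambda>w. s ^ ?j * partials is f (a + s *\<^sub>R w))"
    using coeff_bounded_partials[OF cb E, of "is"] partials_affine[OF f] by metis
  have "s ^ ?j * \<bar>partials is f z\<bar> = \<bar>s ^ ?j * partials is f (a + s *\<^sub>R w)\<bar>"
    using s z by (simp add: abs_mult)
  also have "\<dots> \<le> real (card (multi_indices (k - ?j) :: ('n \<Rightarrow> nat) set)) * (real k ^ ?j * E) * (1 + norm w) ^ (k - ?j)"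
    by (rule coeff_bounded_pointwise[OF cp])
  also have "\<dots> \<le> ?N * ((real k + 1) ^ k * E) * (2 ^ k * (1 + t) ^ k)"
  proof (intro mult_mono)
    show "real (card (multi_indices (k - ?j) :: ('n \<Rightarrow> nat) set)) \<le> ?N"
      by (intro of_nat_mono card_mono finite_multi_indices) auto
    have "real k ^ ?j \<le> (real k + 1) ^ ?j" by (rule power_mono) auto
    also have "\<dots> \<le> (real k + 1) ^ k" using len by (intro power_increasing) auto
    finally show "real k ^ ?j \<le> (real k + 1) ^ k" .
    have "(1 + norm w) ^ (k - ?j) \<le> (1 + norm w) ^ k" by (intro power_increasing) auto
    also have "\<dots> \<le> (2 * (1 + t)) ^ k" using w1 by (intro power_mono) auto
    finally show "(1 + norm w) ^ (k - ?j) \<le> 2 ^ k * (1 + t) ^ k" by (simp only: power_mult_distrib)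
  qed (use E in auto)
  also have "\<dots> = ?N * (real k + 1) ^ k * 2 ^ k * E * (1 + t) ^ k" by simp
  finally show ?thesis using s unfolding t_def[symmetric]
    by (simp add: field_simps)
qed

text \<open>
  The translations that move a given node into \<open>B\<close> have the measure of \<open>B\<close>, so for small \<open>B\<close> the
  translations that move some node into \<open>B\<close> do not exhaust the ball.
\<close>

lemma translated_nodes_avoid:
  fixes X :: "(real ^ 'n) set"
  assumes X: "finite X" and B: "B \<in> lmeasurable"
    and small: "real (card X) * measure lebesgue B < measure lebesgue (ball x0 s)"
  obtains a where "a \<in> ball x0 s" "\<And>x. x \<in> X \<Longrightarrow> a + s *\<^sub>R x \<notin> B"
proof (rule ccontr)
  assume "\<not> thesis"
  then have "\<forall>a\<in>ball x0 s. \<exists>x\<in>X. a + s *\<^sub>R x \<in> B" using that by blast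
  then have sub: "ball x0 s \<subseteq> (\<Union>x\<in>X. (+) (- (s *\<^sub>R x)) ` B)"
    by (force simp: image_iff)
  have Bx: "(+) c ` B \<in> lmeasurable" for c using B by (rule measurable_translation)
  have "measure lebesgue (ball x0 s) \<le> measure lebesgue (\<Union>x\<in>X. (+) (- (s *\<^sub>R x)) ` B)"
  proof (rule measure_mono_fmeasurable[OF sub])
    show "(\<Union>x\<in>X. (+) (- (s *\<^sub>R x)) ` B) \<in> lmeasurable"
      by (rule fmeasurable.finite_UN[OF X]) (rule Bx)
  qed simp
  also have "\<dots> \<le> (\<Sum>x\<in>X. measure lebesgue ((+) (- (s *\<^sub>R x)) ` B))"
    by (rule measure_UNION_le[OF X]) (rule fmeasurableD[OF Bx])
  also have "\<dots> = real (card X) * measure lebesgue B" by (simp only: measure_translation sum_constant)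
  finally show False using small by simp
qed

lemma weak_type_bound:
  fixes g :: "real ^ 'n \<Rightarrow> real"
  assumes g: "g \<in> borel_measurable (lebesgue_on \<Omega>)" "open \<Omega>" and S: "S \<subseteq> \<Omega>" "S \<in> lmeasurable"
    and E: "0 < E" "1 \<le> q" "0 \<le> b"
    and le: "(\<integral>\<^sup>+z\<in>S. ennreal (g z powr q) \<partial>lebesgue) \<le> ennreal b"
  shows "{z \<in> S. E < g z} \<in> lmeasurable" "measure lebesgue {z \<in> S. E < g z} \<le> b / E powr q"
proof -
  let ?B = "{z \<in> S. E < g z}"
  have "{z \<in> space (lebesgue_on \<Omega>). E < g z} \<in> sets (lebesgue_on \<Omega>)"
    using g(1) unfolding borel_measurable_iff_greater by blast
  then have "{z \<in> \<Omega>. E < g z} \<in> sets lebesgue"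
    using g(2) by (auto simp: sets_restrict_space_iff lborelD)
  then have "S \<inter> {z \<in> \<Omega>. E < g z} \<in> sets lebesgue" using S by (intro sets.Int) (auto simp: fmeasurableD)
  moreover have "S \<inter> {z \<in> \<Omega>. E < g z} = ?B" using S by auto
  ultimately have Bs: "?B \<in> sets lebesgue" by simp
  show Bm: "?B \<in> lmeasurable" by (rule fmeasurableI2[OF S(2) _ Bs]) auto
  have "ennreal (E powr q * measure lebesgue ?B) = ennreal (E powr q) * emeasure lebesgue ?B"
    using Bm by (simp add: emeasure_eq_measure2 fmeasurableD2 ennreal_mult)
  also have "\<dots> = (\<integral>\<^sup>+z. ennreal (E powr q) * indicator ?B z \<partial>lebesgue)"
    using Bs by (simp add: nn_integral_cmult_indicator)
  also have "\<dots> \<le> (\<integral>\<^sup>+z\<in>S. ennreal (g z powr q) \<partial>lebesgue)"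
  proof (rule nn_integral_mono)
    fix z
    have "E powr q \<le> g z powr q" if "z \<in> ?B" using that E by (intro powr_mono2) auto
    then show "ennreal (E powr q) * indicator ?B z \<le> ennreal (g z powr q) * indicator S z"
      by (auto simp: indicator_def intro: ennreal_leI)
  qed
  also have "\<dots> \<le> ennreal b" by (rule le)
  finally have "E powr q * measure lebesgue ?B \<le> b" using E by (simp add: ennreal_le_iff)
  then show "measure lebesgue ?B \<le> b / E powr q"
    using E by (simp add: field_simps)
qed

lemma poly_maps_isCont:
  fixes ps :: "(real ^ 'n \<Rightarrow> real ^ 'm) list"
  assumes "poly_maps Q k ps" "p \<in> set ps" shows "isCont p x"
proof -
  have "isCont (\<lambda>x. p x $ j) x" for j using assms poly_fun_isCont unfolding poly_maps_def by blast
  then show ?thesis unfolding isCont_def by (intro vec_tendstoI) auto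
qed

lemma poly_maps_measurable:
  assumes "poly_maps Q k ps" shows "qmeasurable_on Q S (tuple_at ps)"
  using qmeasurable_on_continuous[of ps S] poly_maps_isCont[OF assms] assms
  by (auto simp: poly_maps_def)

abbreviation deviation ::
  "real \<Rightarrow> (real ^ 'n \<Rightarrow> (real ^ 'm) multiset) \<Rightarrow> (real ^ 'n \<Rightarrow> real ^ 'm) list \<Rightarrow> (real ^ 'n) set \<Rightarrow> ennreal"
  where "deviation q u ps S \<equiv> \<integral>\<^sup>+z\<in>S. ennreal (G (u z) (tuple_at ps z) powr q) \<partial>lebesgue"

text \<open>
  The number \<open>s\<close> is the scale at which the polynomials are compared and \<open>b\<close> the size of their difference at
  that scale: each derivative costs a factor \<open>1 / s\<close>, and the last factor is the growth of a polynomial of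
  degree \<open>k\<close> away from \<open>x\<close>. The permutation is the same for all derivatives and all points.
\<close>

definition matched_within ::
  "nat \<Rightarrow> nat \<Rightarrow> (real ^ 'n \<Rightarrow> real ^ 'm) list \<Rightarrow> (real ^ 'n \<Rightarrow> real ^ 'm) list \<Rightarrow> real ^ 'n \<Rightarrow> real \<Rightarrow> real \<Rightarrow> bool"
  where "matched_within Q k vs rs x s b \<longleftrightarrow> (\<exists>\<sigma>. \<sigma> permutes {..<Q} \<and>
    (\<forall>i<Q. \<forall>j is z. length is \<le> k \<longrightarrow>
      \<bar>partials is (\<lambda>x. (vs ! i) x $ j) z - partials is (\<lambda>x. (rs ! \<sigma> i) x $ j) z\<bar>
        \<le> b / s ^ length is * (1 + norm (z - x) / s) ^ k))"

text \<open>
  By Chebyshev's inequality, \<open>u\<close> is within a multiple of \<open>a\<close> of both polynomials off a small set, which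
  suitably translated nodes avoid. At these nodes the two polynomials are then close to each other, and the
  permutation comes from \<open>matching_from_nodes\<close>. The dependence on \<open>q\<close> disappears because \<open>L \<le> L powr q\<close>.
\<close>

lemma matched_polynomials_close:
  obtains C where "0 < C"
    "\<And>\<Omega> u (ps :: (real ^ 'n \<Rightarrow> real ^ 'm) list) rs x0 s q a.
      poly_maps Q k ps \<Longrightarrow> poly_maps Q k rs \<Longrightarrow> open \<Omega> \<Longrightarrow> qmeasurable_on Q \<Omega> u \<Longrightarrow>
      (\<And>x. x \<in> \<Omega> \<Longrightarrow> size (u x) = Q) \<Longrightarrow> ball x0 (2 * s) \<subseteq> \<Omega> \<Longrightarrow> 0 < s \<Longrightarrow> 0 < a \<Longrightarrow> 1 \<le> q \<Longrightarrow>
      deviation q u ps (ball x0 (2 * s)) \<le> ennreal (a powr q * s ^ CARD('n)) \<Longrightarrow>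
      deviation q u rs (ball x0 (2 * s)) \<le> ennreal (a powr q * s ^ CARD('n)) \<Longrightarrow>
      matched_within Q k ps rs x0 s (C * a)"
proof -
  obtain X :: "(real ^ 'n) set" and C0 where X: "finite X" "\<And>x. x \<in> X \<Longrightarrow> norm x \<le> 1" "0 \<le> C0"
    "\<And>(ps :: (real ^ 'n \<Rightarrow> real ^ 'm) list) rs a s E. poly_maps Q k ps \<Longrightarrow> poly_maps Q k rs \<Longrightarrow>
      (\<And>x. x \<in> X \<Longrightarrow> G (tuple_at ps (a + s *\<^sub>R x)) (tuple_at rs (a + s *\<^sub>R x)) \<le> E) \<Longrightarrow>
      \<exists>\<sigma>. \<sigma> permutes {..<Q} \<and> (\<forall>i<Q. \<forall>j. coeff_bounded k (C0 * E)
        (\<lambda>w. (ps ! i) (a + s *\<^sub>R w) $ j - (rs ! \<sigma> i) (a + s *\<^sub>R w) $ j))"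
    using matching_from_nodes[of Q k thesis] by blast
  define \<omega> where "\<omega> = unit_ball_vol (real CARD('n))"
  have \<omega>: "0 < \<omega>" by (simp add: \<omega>_def)
  (* Chosen so that the number of nodes times the measure of both bad sets stays below the measure of
     the ball of radius \<open>s\<close>. *)
  define L where "L = 1 + (2 * real (card X) + 1) / \<omega>"
  have L: "1 \<le> L" "(2 * real (card X) + 1) / \<omega> \<le> L" using \<omega> by (auto simp: L_def)
  define K where "K = real (card (multi_indices k :: ('n \<Rightarrow> nat) set)) * (real k + 1) ^ k * 2 ^ k"
  have K: "0 \<le> K" by (simp add: K_def)
  show thesis
  proof (rule that[of "K * (C0 * (2 * L)) + 1"])
    show "0 < K * (C0 * (2 * L)) + 1" using K X(3) L by (simp add: add_nonneg_pos)
    fix \<Omega> u x0 s q a and ps rs :: "(real ^ 'n \<Rightarrow> real ^ 'm) list"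
    assume ps: "poly_maps Q k ps" and rs: "poly_maps Q k rs" and \<Omega>: "open \<Omega>"
      and u: "qmeasurable_on Q \<Omega> u" and su: "\<And>x. x \<in> \<Omega> \<Longrightarrow> size (u x) = Q"
      and ball: "ball x0 (2 * s) \<subseteq> \<Omega>" and s: "0 < s" and a: "0 < a" and q: "1 \<le> q"
      and ip: "deviation q u ps (ball x0 (2 * s)) \<le> ennreal (a powr q * s ^ CARD('n))"
      and ir: "deviation q u rs (ball x0 (2 * s)) \<le> ennreal (a powr q * s ^ CARD('n))"
    have len: "length ps = Q" "length rs = Q" using ps rs by (auto simp: poly_maps_def)
    define E where "E = a * L"
    have E: "0 < E" using a L by (simp add: E_def)
    define B where "B vs = {z \<in> ball x0 (2 * s). E < G (u z) (tuple_at vs z)}"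
      for vs :: "(real ^ 'n \<Rightarrow> real ^ 'm) list"
    have B: "B vs \<in> lmeasurable \<and> measure lebesgue (B vs) \<le> \<omega> * s ^ CARD('n) / (2 * real (card X) + 1)"
      if vs: "poly_maps Q k vs" and iv: "deviation q u vs (ball x0 (2 * s)) \<le> ennreal (a powr q * s ^ CARD('n))" for vs
    proof -
      have m: "(\<lambda>z. G (u z) (tuple_at vs z)) \<in> borel_measurable (lebesgue_on \<Omega>)"
        using vs su by (intro G_measurable[OF u poly_maps_measurable]) (auto simp: poly_maps_def)
      have nn: "0 \<le> a powr q * s ^ CARD('n)" using s by simp
      have sm: "0 < s ^ CARD('n)" using s by simp
      note wt = weak_type_bound[OF m \<Omega> ball lmeasurable_ball E q nn iv]
      have "measure lebesgue (B vs) \<le> a powr q * s ^ CARD('n) / E powr q"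
        using wt(2) by (simp add: B_def)
      also have "\<dots> = s ^ CARD('n) / L powr q"
        using a L by (simp add: E_def powr_mult)
      also have "\<dots> \<le> s ^ CARD('n) / L"
      proof (rule divide_left_mono)
        show "L \<le> L powr q" using powr_mono[of 1 q L] q L by simp
      qed (use sm L in auto)
      also have "\<dots> \<le> s ^ CARD('n) / ((2 * real (card X) + 1) / \<omega>)"
        by (rule divide_left_mono) (use sm L \<omega> in auto)
      finally show ?thesis using wt(1) by (simp add: B_def mult.commute)
    qed
    have Bp: "B ps \<union> B rs \<in> lmeasurable" using B[OF ps ip] B[OF rs ir] by auto
    have "real (card X) * measure lebesgue (B ps \<union> B rs)
        \<le> real (card X) * (measure lebesgue (B ps) + measure lebesgue (B rs))"
      using B[OF ps ip] B[OF rs ir] by (intro mult_left_mono measure_Un_le) (auto simp: fmeasurableD)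
    also have "\<dots> \<le> real (card X) * (2 * (\<omega> * s ^ CARD('n) / (2 * real (card X) + 1)))"
      using B[OF ps ip] B[OF rs ir] by (intro mult_left_mono) auto
    also have "\<dots> = (2 * real (card X)) / (2 * real (card X) + 1) * (\<omega> * s ^ CARD('n))" by simp
    also have "\<dots> < 1 * (\<omega> * s ^ CARD('n))"
      using \<omega> s by (intro mult_strict_right_mono) (auto simp: divide_simps)
    also have "\<dots> = measure lebesgue (ball x0 s)"
      using s by (simp add: content_ball \<omega>_def)
    finally obtain c where c: "c \<in> ball x0 s" "\<And>x. x \<in> X \<Longrightarrow> c + s *\<^sub>R x \<notin> B ps \<union> B rs"
      using translated_nodes_avoid[OF X(1) Bp] by blast
    have close: "G (tuple_at ps (c + s *\<^sub>R x)) (tuple_at rs (c + s *\<^sub>R x)) \<le> 2 * E" if x: "x \<in> X" for x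
    proof -
      let ?z = "c + s *\<^sub>R x"
      have "dist x0 ?z \<le> dist x0 c + norm (s *\<^sub>R x)"
        using dist_triangle[of x0 ?z c] by (simp add: dist_norm)
      also have "\<dots> < s + s" using c(1) X(2)[OF x] s by (intro add_less_le_mono) (auto simp: mult_left_le)
      finally have z: "?z \<in> ball x0 (2 * s)" by simp
      then have 1: "G (u ?z) (tuple_at ps ?z) \<le> E" "G (u ?z) (tuple_at rs ?z) \<le> E"
        using c(2)[OF x] by (auto simp: B_def)
      have sz: "size (u ?z) = Q" using su z ball by blast
      have "G (tuple_at ps ?z) (tuple_at rs ?z) \<le> G (tuple_at ps ?z) (u ?z) + G (u ?z) (tuple_at rs ?z)"
        using len sz by (intro G_triangle) auto
      moreover have "G (tuple_at ps ?z) (u ?z) = G (u ?z) (tuple_at ps ?z)"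
        using len sz by (intro G_sym) auto
      ultimately show ?thesis using 1 by simp
    qed
    obtain \<sigma> where \<sigma>: "\<sigma> permutes {..<Q}" "\<And>i j. i < Q \<Longrightarrow> coeff_bounded k (C0 * (2 * E))
        (\<lambda>w. (ps ! i) (c + s *\<^sub>R w) $ j - (rs ! \<sigma> i) (c + s *\<^sub>R w) $ j)"
      using X(4)[OF ps rs close] by blast
    have "\<bar>partials is (\<lambda>x. (ps ! i) x $ j) z - partials is (\<lambda>x. (rs ! \<sigma> i) x $ j) z\<bar>
          \<le> (K * (C0 * (2 * L)) + 1) * a / s ^ length is * (1 + norm (z - x0) / s) ^ k"
      if i: "i < Q" and l: "length is \<le> k" for i j "is" z
    proof -
      have "\<sigma> i < Q" using permutes_in_image[OF \<sigma>(1)] i by auto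
      then have pr: "(\<lambda>x. (ps ! i) x $ j) \<in> poly_fun k" "(\<lambda>x. (rs ! \<sigma> i) x $ j) \<in> poly_fun k"
        using ps rs i by (auto simp: poly_maps_def)
      have "\<bar>partials is (\<lambda>x. (ps ! i) x $ j - (rs ! \<sigma> i) x $ j) z\<bar>
          \<le> K * (C0 * (2 * E)) / s ^ length is * (1 + norm (z - x0) / s) ^ k"
        unfolding K_def
      proof (rule rescaled_poly_bound[OF _ s _ _ _ l])
        show "(\<lambda>x. (ps ! i) x $ j - (rs ! \<sigma> i) x $ j) \<in> poly_fun k" by (rule poly_fun_diff[OF pr])
        show "0 \<le> C0 * (2 * E)" using X(3) E by simp
        show "coeff_bounded k (C0 * (2 * E)) (\<lambda>w. (ps ! i) (c + s *\<^sub>R w) $ j - (rs ! \<sigma> i) (c + s *\<^sub>R w) $ j)"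
          by (rule \<sigma>(2)[OF i])
        show "norm (c - x0) \<le> s" using c(1) by (simp add: dist_norm norm_minus_commute)
      qed
      also have "\<dots> \<le> (K * (C0 * (2 * L)) + 1) * a / s ^ length is * (1 + norm (z - x0) / s) ^ k"
        using a s by (intro mult_right_mono divide_right_mono) (auto simp: E_def algebra_simps)
      finally show ?thesis by (simp add: partials_diff[OF pr])
    qed
    then show "matched_within Q k ps rs x0 s ((K * (C0 * (2 * L)) + 1) * a)"
      unfolding matched_within_def using \<sigma>(1) by blast
  qed
qed

section \<open>Decay of the mean deviation at every point\<close>

lemma le_powr_self: "0 \<le> b \<Longrightarrow> 1 \<le> q \<Longrightarrow> b \<le> (1 + b) powr q" for b q :: real
  using powr_mono[of 1 q "1 + b"] by simp

text \<open>
  Numerical factors are moved inside the \<open>q\<close>-th power, so that constants multiply the amplitude \<open>M\<close>.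
\<close>

lemma absorb_factor:
  fixes b X q :: real
  assumes "0 \<le> b" "1 \<le> q" "0 \<le> X" shows "b * X powr q \<le> ((1 + b) * X) powr q"
  using mult_right_mono[OF le_powr_self[OF assms(1,2)], of "X powr q"] assms by (simp add: powr_mult)

lemma powr_add_le:
  fixes a b q :: real
  assumes "0 \<le> a" "0 \<le> b" "0 \<le> q" shows "(a + b) powr q \<le> 2 powr q * (a powr q + b powr q)"
proof -
  have "(a + b) powr q \<le> (2 * max a b) powr q" using assms by (intro powr_mono2) auto
  also have "\<dots> = 2 powr q * max a b powr q" using assms by (simp add: powr_mult)
  also have "\<dots> \<le> 2 powr q * (a powr q + b powr q)" by (intro mult_left_mono) (auto simp: max_def)
  finally show ?thesis .
qed

lemma deviation_mono: "S \<subseteq> T \<Longrightarrow> deviation q u ps S \<le> deviation q u ps T"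
  by (intro nn_integral_mono mult_left_mono) (auto simp: indicator_def)

lemma deviation_change:
  fixes u :: "real ^ 'n \<Rightarrow> (real ^ 'm) multiset"
  assumes ps: "poly_maps Q k ps" and rs: "poly_maps Q k rs" and \<Omega>: "open \<Omega>" and u: "qmeasurable_on Q \<Omega> u"
    and su: "\<And>x. x \<in> \<Omega> \<Longrightarrow> size (u x) = Q" and S: "S \<subseteq> \<Omega>" "S \<in> lmeasurable" and q: "0 \<le> q" and b: "0 \<le> b"
    and close: "\<And>z. z \<in> S \<Longrightarrow> G (tuple_at ps z) (tuple_at rs z) \<le> b"
  shows "deviation q u ps S \<le> ennreal (2 powr q) * (deviation q u rs S + ennreal (b powr q * measure lebesgue S))"
proof -
  let ?g = "\<lambda>vs z. G (u z) (tuple_at vs z)"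
  have len: "length ps = Q" "length rs = Q" using ps rs by (auto simp: poly_maps_def)
  have "?g rs \<in> borel_measurable (lebesgue_on \<Omega>)"
    using su len by (intro G_measurable[OF u poly_maps_measurable[OF rs]]) auto
  then have 1: "(\<lambda>z. ennreal (?g rs z powr q)) \<in> borel_measurable (lebesgue_on \<Omega>)" by measurable
  have Sm: "S \<in> sets lebesgue" using S(2) by (rule fmeasurableD)
  have 2: "\<Omega> \<inter> space lebesgue \<in> sets lebesgue" using \<Omega> by (simp add: lborelD)
  have "(\<lambda>z. ennreal (?g rs z powr q) * indicator \<Omega> z) \<in> borel_measurable lebesgue"
    by (rule iffD1[OF borel_measurable_restrict_space_iff_ennreal[OF 2] 1])
  then have "(\<lambda>z. (ennreal (?g rs z powr q) * indicator \<Omega> z) * indicator S z) \<in> borel_measurable lebesgue"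
    by (rule borel_measurable_times_ennreal[OF _ borel_measurable_indicator[OF Sm]])
  moreover have "(\<lambda>z. (ennreal (?g rs z powr q) * indicator \<Omega> z) * indicator S z)
      = (\<lambda>z. ennreal (?g rs z powr q) * indicator S z)"
    by (rule ext) (use S(1) in \<open>auto split: split_indicator\<close>)
  ultimately have m: "(\<lambda>z. ennreal (?g rs z powr q) * indicator S z) \<in> borel_measurable lebesgue" by simp
  have m2: "(\<lambda>z. ennreal (b powr q) * indicator S z) \<in> borel_measurable lebesgue"
    using Sm by (intro borel_measurable_times_ennreal borel_measurable_indicator borel_measurable_const)
  have "deviation q u ps S
      \<le> (\<integral>\<^sup>+z. ennreal (2 powr q) * (ennreal (?g rs z powr q) * indicator S z + ennreal (b powr q) * indicator S z) \<partial>lebesgue)"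
  proof (rule nn_integral_mono)
    fix z
    have "?g ps z powr q \<le> 2 powr q * (?g rs z powr q + b powr q)" if z: "z \<in> S"
    proof -
      have sz: "size (u z) = Q" using su S z by auto
      have "?g ps z \<le> ?g rs z + G (tuple_at rs z) (tuple_at ps z)" using sz len by (intro G_triangle) auto
      also have "G (tuple_at rs z) (tuple_at ps z) = G (tuple_at ps z) (tuple_at rs z)"
        using len by (intro G_sym) auto
      finally have "?g ps z \<le> ?g rs z + b" using close[OF z] by simp
      moreover have "0 \<le> ?g ps z" "0 \<le> ?g rs z" using sz len by (auto intro!: qdist_nonneg)
      ultimately have "?g ps z powr q \<le> (?g rs z + b) powr q" using q by (intro powr_mono2) auto
      also have "\<dots> \<le> 2 powr q * (?g rs z powr q + b powr q)"
        by (rule powr_add_le) (use \<open>0 \<le> ?g rs z\<close> b q in auto)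
      finally show ?thesis .
    qed
    then have "ennreal (?g ps z powr q) \<le> ennreal (2 powr q) * (ennreal (?g rs z powr q) + ennreal (b powr q))" if "z \<in> S"
      using that by (simp flip: ennreal_plus ennreal_mult add: ennreal_leI)
    then show "ennreal (?g ps z powr q) * indicator S z
        \<le> ennreal (2 powr q) * (ennreal (?g rs z powr q) * indicator S z + ennreal (b powr q) * indicator S z)"
      by (auto simp: indicator_def)
  qed
  also have "\<dots> = ennreal (2 powr q) * (deviation q u rs S + ennreal (b powr q) * emeasure lebesgue S)"
    using m m2 S(2) by (subst nn_integral_cmult) (auto simp: nn_integral_add nn_integral_cmult_indicator fmeasurableD)
  also have "ennreal (b powr q) * emeasure lebesgue S = ennreal (b powr q * measure lebesgue S)"
    using S(2) by (simp add: emeasure_eq_measure2 fmeasurableD2 ennreal_mult)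
  finally show ?thesis .
qed

text \<open>
  Puts the hypotheses into the form in which they are used, with all powers of the radii collected in the
  exponent \<open>n + t\<close>.
\<close>

lemma rescale_decay:
  fixes \<sigma> \<rho> n b \<beta> t r :: real
  assumes s: "0 < \<sigma>" "0 < \<rho>" and \<beta>: "0 \<le> \<beta>" and b: "0 \<le> b"
    and le: "ennreal (\<sigma> powr (- n)) * I \<le> ennreal (\<beta> * (\<sigma> / \<rho>) powr t * \<rho> powr (- n)) * J" and J: "J \<le> ennreal b"
  shows "I \<le> ennreal (\<beta> * (\<sigma> / \<rho>) powr (n + t) * b)"
proof -
  have "ennreal (\<sigma> powr n) * ennreal (\<sigma> powr (- n)) = 1"
    using s by (simp flip: ennreal_mult add: powr_add[symmetric])
  then have "I = ennreal (\<sigma> powr n) * (ennreal (\<sigma> powr (- n)) * I)" by (simp flip: mult.assoc)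
  also have "\<dots> \<le> ennreal (\<sigma> powr n) * (ennreal (\<beta> * (\<sigma> / \<rho>) powr t * \<rho> powr (- n)) * ennreal b)"
    by (intro mult_left_mono order_trans[OF le] J) auto
  also have "\<dots> = ennreal (\<sigma> powr n * (\<beta> * (\<sigma> / \<rho>) powr t * \<rho> powr (- n) * b))"
    using s \<beta> b by (simp add: ennreal_mult)
  also have "\<sigma> powr n * (\<beta> * (\<sigma> / \<rho>) powr t * \<rho> powr (- n) * b) = \<beta> * (\<sigma> / \<rho>) powr (n + t) * b"
    using s by (simp add: powr_add powr_divide powr_minus field_simps)
  finally show ?thesis .
qed

text \<open>
  The constants are written out as functions of the admissible data. In this way their independence of
  \<open>\<mu>\<close>, of the domains and of \<open>u\<close> is visible although they occur inside a locale in which these are fixed.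
\<close>

definition large_radius_const :: "nat \<Rightarrow> nat \<Rightarrow> nat \<Rightarrow> real \<Rightarrow> real \<Rightarrow> real \<Rightarrow> real" where
  "large_radius_const n m Q C1 C4 e1
    = 4 * (C1 * 8 powr e1 + real Q * (real m * C4) * (1 + unit_ball_vol (real n)))"

definition decay_const :: "nat \<Rightarrow> nat \<Rightarrow> nat \<Rightarrow> nat \<Rightarrow> real \<Rightarrow> real \<Rightarrow> real \<Rightarrow> real \<Rightarrow> real" where
  "decay_const n m k Q B \<rho>0 C e1 =
    (let C1 = 1 + B * \<rho>0 powr (- e1);
         C2 = C1 * (1 + B * 4 powr e1);
         C4 = C * 2 ^ k * C2 * 16 powr e1
     in 1 + B * (\<rho>0 / 32) powr (- e1) + C2 + large_radius_const n m Q C1 C4 e1)"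

text \<open>
  The setting of the decay estimate. The set \<open>W\<close> stands for \<open>\<Omega>''\<close>, \<open>ps x\<close> lists the branches of the
  polynomial at \<open>x\<close>, \<open>M\<close> bounds the data, \<open>\<rho>0\<close> is the largest radius at which the hypotheses
  are applied, \<open>C\<close> is the constant of \<open>matched_polynomials_close\<close>, and \<open>D\<close> is the constant of the decay estimate. The exponent \<open>e\<close> depends on \<open>\<mu>\<close>; powers
  with exponent \<open>e\<close> are estimated by powers with exponent \<open>e1\<close>, its value at \<open>\<mu> = 1\<close>, so that the constants
  do not depend on \<open>\<mu>\<close>.
\<close>

locale approximation_data =
  fixes k Q :: nat and q \<mu> e e1 B \<rho>0 M C D :: real
    and \<Omega> W \<Gamma> :: "(real ^ 'n) set" and u :: "real ^ 'n \<Rightarrow> (real ^ 'm) multiset"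
    and ps :: "real ^ 'n \<Rightarrow> (real ^ 'n \<Rightarrow> real ^ 'm) list"
  assumes e_def: "e = real CARD('n) + real k * q + q * \<mu>"
    and e1_def: "e1 = real CARD('n) + real k * q + q"
    and D_def: "D = decay_const CARD('n) CARD('m) k Q B \<rho>0 C e1"
    and q: "1 \<le> q" and \<mu>: "0 < \<mu>" "\<mu> < 1" and B: "0 \<le> B" and \<rho>0: "0 < \<rho>0" "\<rho>0 \<le> 1/4"
    and M: "0 < M" and C: "0 < C"
    and \<Omega>: "open \<Omega>" "W \<subseteq> \<Omega>"
    and u: "qmeasurable_on Q \<Omega> u" "\<And>x. x \<in> \<Omega> \<Longrightarrow> size (u x) = Q"
    and \<Gamma>: "closed \<Gamma>" "\<Gamma> \<inter> closure W \<noteq> {}"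
    and maps: "\<And>x. x \<in> closure W \<Longrightarrow> poly_maps Q k (ps x)"
    and base: "\<And>y x r. y \<in> \<Gamma> \<inter> closure W \<Longrightarrow> ball x r \<subseteq> W \<Longrightarrow> r \<le> 1 \<Longrightarrow>
      deviation q u (ps y) (ball x r) \<le> ennreal (M powr q)"
    and base_zero: "\<And>x r. ball x r \<subseteq> W \<Longrightarrow> r \<le> 1 \<Longrightarrow>
      deviation q u (replicate Q (\<lambda>_. 0)) (ball x r) \<le> ennreal (M powr q)"
    and decay_on: "\<And>y \<sigma> \<rho>. y \<in> \<Gamma> \<inter> closure W \<Longrightarrow> 0 < \<sigma> \<Longrightarrow> \<sigma> \<le> \<rho> / 2 \<Longrightarrow> \<rho> \<le> \<rho>0 \<Longrightarrow> ball y \<rho> \<subseteq> \<Omega> \<Longrightarrow>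
      ennreal (\<sigma> powr (- (real CARD('n) + real k * q))) * deviation q u (ps y) (ball y \<sigma>)
      \<le> ennreal (B * (\<sigma> / \<rho>) powr (q * \<mu>) * \<rho> powr (- (real CARD('n) + real k * q)))
        * deviation q u (ps y) (ball y \<rho>)"
    and decay_off: "\<And>x y \<sigma> \<rho>. x \<in> closure W - \<Gamma> \<Longrightarrow> y \<in> \<Gamma> \<inter> closure W \<Longrightarrow> 0 < \<sigma> \<Longrightarrow> \<sigma> \<le> \<rho> / 2 \<Longrightarrow>
      \<rho> < min (1/4) (infdist x \<Gamma>) \<Longrightarrow> ball x \<rho> \<subseteq> \<Omega> \<Longrightarrow>
      ennreal (\<sigma> powr (- (real CARD('n) + real k * q))) * deviation q u (ps x) (ball x \<sigma>)
      \<le> ennreal (B * (\<sigma> / \<rho>) powr (q * \<mu>) * \<rho> powr (- (real CARD('n) + real k * q)))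
        * deviation q u (ps y) (ball x \<rho>)"
    and matched: "\<And>vs rs x s a. poly_maps Q k vs \<Longrightarrow> poly_maps Q k rs \<Longrightarrow> ball x (2 * s) \<subseteq> \<Omega> \<Longrightarrow>
      0 < s \<Longrightarrow> 0 < a \<Longrightarrow>
      deviation q u vs (ball x (2 * s)) \<le> ennreal (a powr q * s ^ CARD('n)) \<Longrightarrow>
      deviation q u rs (ball x (2 * s)) \<le> ennreal (a powr q * s ^ CARD('n)) \<Longrightarrow>
      matched_within Q k vs rs x s (C * a)"
begin

lemma e: "0 < e" "e \<le> e1" "0 \<le> e1"
proof -
  have "0 \<le> real k * q" "0 \<le> q * \<mu>" "q * \<mu> \<le> q" using q \<mu> by (auto simp: mult_left_le)
  moreover have "0 < real CARD('n)" by simp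
  ultimately show "0 < e" "e \<le> e1" "0 \<le> e1" unfolding e_def e1_def by linarith+
qed

lemma powr_e_le:
  assumes "1 \<le> (t::real)" shows "t powr e \<le> t powr e1"
  using assms e by (intro powr_mono) auto

lemma powr_minus_e_le:
  assumes "0 < t" "t \<le> (1::real)" shows "t powr (- e) \<le> t powr (- e1)"
  using assms e by (intro powr_mono') auto

lemma decay_from_radius:
  fixes \<sigma> \<rho> :: real
  assumes "0 < \<sigma>" "0 < \<rho>" "\<rho> \<le> 1" "I \<le> ennreal (B * (\<sigma> / \<rho>) powr e * M powr q)"
  shows "I \<le> ennreal (((1 + B * \<rho> powr (- e1)) * M) powr q * \<sigma> powr e)"
proof -
  have "B * (\<sigma> / \<rho>) powr e * M powr q = B * \<rho> powr (- e) * M powr q * \<sigma> powr e"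
    using assms by (simp add: powr_divide powr_minus field_simps)
  also have "\<dots> \<le> (B * \<rho> powr (- e1)) * M powr q * \<sigma> powr e"
    using assms B powr_minus_e_le by (intro mult_right_mono mult_left_mono) auto
  also have "\<dots> \<le> ((1 + B * \<rho> powr (- e1)) * M) powr q * \<sigma> powr e"
    using B q M by (intro mult_right_mono absorb_factor) auto
  finally show ?thesis using assms(4) by (meson ennreal_leI order_trans)
qed

text \<open>
  A deviation of order \<open>s powr e\<close> on a ball of radius comparable to \<open>s\<close> means a pointwise difference of order
  \<open>s powr (k + \<mu>)\<close>, in the normalisation of \<open>matched_polynomials_close\<close>.
\<close>

lemma amplitude:
  assumes "1 \<le> t" "0 < s" "0 \<le> c"
  shows "(t * s) powr e * (c * M) powr q \<le> (c * t powr e1 * M * s powr (real k + \<mu>)) powr q * s ^ CARD('n)"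
proof -
  have e_split: "e = (real k + \<mu>) * q + real CARD('n)" by (simp add: e_def algebra_simps)
  have "(t * s) powr e = t powr e * s powr e" using assms by (simp add: powr_mult)
  also have "\<dots> \<le> t powr e1 * s powr e" by (rule mult_right_mono[OF powr_e_le]) (use assms in auto)
  also have "\<dots> \<le> (t powr e1) powr q * s powr e"
  proof (rule mult_right_mono)
    have "(t powr e1) powr 1 \<le> (t powr e1) powr q"
      using assms q e(3) by (intro powr_mono ge_one_powr_ge_zero) auto
    then show "t powr e1 \<le> (t powr e1) powr q" using assms by simp
  qed simp
  also have "s powr e = (s powr (real k + \<mu>)) powr q * s ^ CARD('n)"
    unfolding e_split powr_add[of s "(real k + \<mu>) * q"] powr_powr using assms by (simp add: powr_realpow)
  finally have "(t * s) powr e * (c * M) powr q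
      \<le> (t powr e1) powr q * ((s powr (real k + \<mu>)) powr q * s ^ CARD('n)) * (c * M) powr q"
    by (rule mult_right_mono) simp
  also have "\<dots> = (c * t powr e1 * M * s powr (real k + \<mu>)) powr q * s ^ CARD('n)"
    using assms M by (simp add: powr_mult)
  finally show ?thesis .
qed

definition C1 :: real where "C1 = 1 + B * \<rho>0 powr (- e1)"
definition C2 :: real where "C2 = C1 * (1 + B * 4 powr e1)"

lemma C12: "1 \<le> C1" "C1 \<le> C2"
proof -
  show "1 \<le> C1" using B by (simp add: C1_def)
  then show "C1 \<le> C2" using B by (simp add: C2_def distrib_left)
qed

lemma decay_at_Gamma:
  assumes y: "y \<in> \<Gamma> \<inter> closure W" and b: "ball y \<rho>0 \<subseteq> W" and \<sigma>: "0 < \<sigma>" "\<sigma> \<le> \<rho>0 / 2"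
  shows "deviation q u (ps y) (ball y \<sigma>) \<le> ennreal ((C1 * M) powr q * \<sigma> powr e)"
  unfolding C1_def
proof (rule decay_from_radius[OF \<sigma>(1) \<rho>0(1)])
  show "deviation q u (ps y) (ball y \<sigma>) \<le> ennreal (B * (\<sigma> / \<rho>0) powr e * M powr q)"
    unfolding e_def by (rule rescale_decay[OF \<sigma>(1) \<rho>0(1) B _ decay_on[OF y \<sigma>] base[OF y b]])
       (use \<rho>0 b \<Omega> in auto)
qed (use \<rho>0 in auto)

text \<open>
  Here the second hypothesis is used with an outer radius bounded below, and the polynomial of any point of
  \<open>\<Gamma>\<close> serves on its right-hand side.
\<close>

lemma decay_away_from_Gamma:
  assumes x: "x \<in> closure W" and b: "ball x \<rho>0 \<subseteq> W" and far: "\<rho>0 / 16 \<le> infdist x \<Gamma>"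
    and \<sigma>: "0 < \<sigma>" "\<sigma> \<le> \<rho>0 / 64"
  shows "deviation q u (ps x) (ball x \<sigma>) \<le> ennreal (((1 + B * (\<rho>0 / 32) powr (- e1)) * M) powr q * \<sigma> powr e)"
proof (rule decay_from_radius[OF \<sigma>(1)])
  show r: "0 < \<rho>0 / 32" "\<rho>0 / 32 \<le> 1" using \<rho>0 by auto
  obtain y where y: "y \<in> \<Gamma> \<inter> closure W" using \<Gamma> by blast
  have xn: "x \<in> closure W - \<Gamma>" using x far \<rho>0 by (auto simp: infdist_zero)
  have b': "ball x (\<rho>0 / 32) \<subseteq> W" using b subset_ball[of "\<rho>0 / 32" \<rho>0 x] \<rho>0 by auto
  show "deviation q u (ps x) (ball x \<sigma>) \<le> ennreal (B * (\<sigma> / (\<rho>0 / 32)) powr e * M powr q)"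
    unfolding e_def by (rule rescale_decay[OF \<sigma>(1) r(1) B _ decay_off[OF xn y \<sigma>(1)] base[OF y b']])
       (use \<rho>0 b' \<Omega> \<sigma> far in auto)
qed

lemma nearest_point:
  assumes x: "x \<in> closure W" and b: "ball x (2 * \<rho>0) \<subseteq> W" and near: "infdist x \<Gamma> < \<rho>0 / 16"
  obtains y where "y \<in> \<Gamma> \<inter> closure W" "dist x y = infdist x \<Gamma>" "ball y \<rho>0 \<subseteq> W"
proof -
  have "\<Gamma> \<noteq> {}" using \<Gamma> by auto
  then obtain y where y: "y \<in> \<Gamma>" "infdist x \<Gamma> = dist x y"
    using infdist_attains_inf[OF \<Gamma>(1)] by blast
  have "y \<in> ball x (2 * \<rho>0)" using y near \<rho>0 by auto
  then have "y \<in> W" using b by auto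
  moreover have "ball y \<rho>0 \<subseteq> ball x (2 * \<rho>0)" 
  proof
    fix z assume "z \<in> ball y \<rho>0"
    then show "z \<in> ball x (2 * \<rho>0)" using dist_triangle[of x z y] y near \<rho>0 by auto
  qed
  ultimately show thesis using that[of y] y b closure_subset[of W] by auto
qed


text \<open>
  The second hypothesis with outer radius half the distance \<open>\<delta>\<close> to \<open>\<Gamma>\<close>: that ball is contained in the ball of
  radius \<open>2 \<delta>\<close> about the nearest point, where the decay is known, and \<open>\<delta>\<close> cancels.
\<close>

lemma decay_near_Gamma_small:
  assumes x: "x \<in> closure W - \<Gamma>" and b: "ball x \<rho>0 \<subseteq> W"
    and y: "y \<in> \<Gamma> \<inter> closure W" "dist x y = infdist x \<Gamma>" "ball y \<rho>0 \<subseteq> W"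
    and near: "infdist x \<Gamma> < \<rho>0 / 16" and \<delta>: "0 < infdist x \<Gamma>"
    and \<sigma>: "0 < \<sigma>" "\<sigma> \<le> infdist x \<Gamma> / 4"
  shows "deviation q u (ps x) (ball x \<sigma>) \<le> ennreal ((C2 * M) powr q * \<sigma> powr e)"
proof -
  let ?\<delta> = "infdist x \<Gamma>"
  have "deviation q u (ps y) (ball x (?\<delta> / 2)) \<le> deviation q u (ps y) (ball y (2 * ?\<delta>))"
  proof (rule deviation_mono, rule subsetI)
    fix z assume "z \<in> ball x (?\<delta> / 2)"
    then show "z \<in> ball y (2 * ?\<delta>)" using dist_triangle[of y z x] y(2) \<delta> by (auto simp: dist_commute)
  qed
  also have "\<dots> \<le> ennreal ((C1 * M) powr q * (2 * ?\<delta>) powr e)"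
    by (rule decay_at_Gamma[OF y(1,3)]) (use near \<delta> in auto)
  finally have J: "deviation q u (ps y) (ball x (?\<delta> / 2)) \<le> ennreal ((C1 * M) powr q * (2 * ?\<delta>) powr e)" .
  have "ball x (?\<delta> / 2) \<subseteq> ball x \<rho>0" by (rule subset_ball) (use near \<rho>0 \<delta> in linarith)
  then have sub: "ball x (?\<delta> / 2) \<subseteq> \<Omega>" using b \<Omega>(2) by blast
  have "deviation q u (ps x) (ball x \<sigma>)
      \<le> ennreal (B * (\<sigma> / (?\<delta> / 2)) powr e * ((C1 * M) powr q * (2 * ?\<delta>) powr e))"
    by (rule rescale_decay[OF \<sigma>(1) _ B _ decay_off[OF x y(1) \<sigma>(1) _ _ sub] J, folded e_def])
       (use \<sigma> \<delta> near \<rho>0 in auto)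
  also have "B * (\<sigma> / (?\<delta> / 2)) powr e * ((C1 * M) powr q * (2 * ?\<delta>) powr e)
      = B * 4 powr e * (C1 * M) powr q * \<sigma> powr e"
  proof -
    have "(\<sigma> / (?\<delta> / 2)) powr e * (2 * ?\<delta>) powr e = (4 * \<sigma>) powr e"
      using \<sigma> \<delta> by (simp flip: powr_mult)
    also have "\<dots> = 4 powr e * \<sigma> powr e" using \<sigma> by (simp add: powr_mult)
    finally show ?thesis by (simp add: mult_ac)
  qed
  also have "\<dots> \<le> B * 4 powr e1 * (C1 * M) powr q * \<sigma> powr e"
    using B powr_e_le[of 4] by (intro mult_right_mono mult_left_mono) auto
  also have "\<dots> \<le> ((1 + B * 4 powr e1) * (C1 * M)) powr q * \<sigma> powr e"
    using B q M C12 by (intro mult_right_mono absorb_factor) auto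
  finally show ?thesis by (simp add: C2_def mult_ac ennreal_leI)
qed

definition C4 :: real where "C4 = C * 2 ^ k * C2 * 16 powr e1"

lemma C4_pos: "0 < C4" using C C12 by (simp add: C4_def)

text \<open>
  At scale \<open>\<delta>\<close> the polynomials at \<open>x\<close> and at the nearest point \<open>y\<close> are both close to \<open>u\<close>, hence matched with a
  difference of order \<open>\<delta> powr (k + \<mu>)\<close>. On the larger ball of radius \<open>\<sigma>\<close> the difference has grown by
  \<open>(\<sigma> / \<delta>) ^ k\<close> at most, which leaves \<open>\<sigma> ^ k * \<delta> powr \<mu>\<close>, and \<open>\<delta>\<close> is at most a multiple of \<open>\<sigma>\<close>. So the decay
  at \<open>y\<close> carries over to \<open>x\<close>.
\<close>

lemma decay_near_Gamma_large:
  assumes x: "x \<in> closure W - \<Gamma>" and b: "ball x \<rho>0 \<subseteq> W"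
    and y: "y \<in> \<Gamma> \<inter> closure W" "dist x y = infdist x \<Gamma>" "ball y \<rho>0 \<subseteq> W"
    and near: "infdist x \<Gamma> < \<rho>0 / 16" and \<delta>: "0 < infdist x \<Gamma>"
    and \<sigma>: "infdist x \<Gamma> / 4 \<le> \<sigma>" "\<sigma> \<le> \<rho>0 / 64"
  shows "deviation q u (ps x) (ball x \<sigma>) \<le> ennreal ((large_radius_const CARD('n) CARD('m) Q C1 C4 e1 * M) powr q * \<sigma> powr e)"
proof -
  let ?\<delta> = "infdist x \<Gamma>"
  (* The ball of radius \<open>2 s = \<delta> / 4\<close> about \<open>x\<close> is the largest one covered by the estimate for small
     radii, and it lies in the ball of radius \<open>16 s = 2 \<delta>\<close> about \<open>y\<close>. *)
  define s where "s = ?\<delta> / 8"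
  have s: "0 < s" "2 * s \<le> \<sigma>" "?\<delta> = 8 * s" using \<delta> \<sigma> by (auto simp: s_def)
  have \<sigma>0: "0 < \<sigma>" using s by linarith
  define a where "a = C2 * 16 powr e1 * M * s powr (real k + \<mu>)"
  have a: "0 < a" using C12 M s by (simp add: a_def)
  have mx: "poly_maps Q k (ps x)" "poly_maps Q k (ps y)" using maps x y by auto
  have s_e: "(16 * s) powr e * (C2 * M) powr q \<le> a powr q * s ^ CARD('n)"
    using amplitude[of 16 s C2] C12 s by (simp add: a_def)
  have bs: "ball x (2 * s) \<subseteq> ball x \<rho>0" by (rule subset_ball) (use near s \<rho>0 in linarith)
  have dx: "deviation q u (ps x) (ball x (2 * s)) \<le> ennreal (a powr q * s ^ CARD('n))"
  proof -
    have "deviation q u (ps x) (ball x (2 * s)) \<le> ennreal ((C2 * M) powr q * (2 * s) powr e)"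
      by (rule decay_near_Gamma_small[OF x b y near \<delta>]) (use s in auto)
    also have "\<dots> \<le> ennreal ((C2 * M) powr q * (16 * s) powr e)"
      using s e(1) by (intro ennreal_leI mult_left_mono powr_mono2) auto
    finally show ?thesis using s_e by (simp add: mult.commute) (meson ennreal_leI order_trans)
  qed
  have dy: "deviation q u (ps y) (ball x (2 * s)) \<le> ennreal (a powr q * s ^ CARD('n))"
  proof -
    have "deviation q u (ps y) (ball x (2 * s)) \<le> deviation q u (ps y) (ball y (16 * s))"
    proof (rule deviation_mono, rule subsetI)
      fix z assume "z \<in> ball x (2 * s)"
      then show "z \<in> ball y (16 * s)" using dist_triangle[of y z x] y(2) s by (auto simp: dist_commute)
    qed
    also have "\<dots> \<le> ennreal ((C1 * M) powr q * (16 * s) powr e)"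
      by (rule decay_at_Gamma[OF y(1,3)]) (use near s in auto)
    also have "\<dots> \<le> ennreal ((C2 * M) powr q * (16 * s) powr e)"
      using C12 M q by (intro ennreal_leI mult_right_mono powr_mono2) auto
    finally show ?thesis using s_e by (simp add: mult.commute) (meson ennreal_leI order_trans)
  qed
  have sub: "ball x (2 * s) \<subseteq> \<Omega>" using bs b \<Omega>(2) by blast
  obtain \<pi> where \<pi>: "\<pi> permutes {..<Q}" "\<And>i j is z. i < Q \<Longrightarrow> length is \<le> k \<Longrightarrow>
        \<bar>partials is (\<lambda>z. (ps x ! i) z $ j) z - partials is (\<lambda>z. (ps y ! \<pi> i) z $ j) z\<bar>
          \<le> C * a / s ^ length is * (1 + norm (z - x) / s) ^ k"
    using matched[OF mx sub s(1) a dx dy] unfolding matched_within_def by blast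
  have len: "length (ps x) = Q" "length (ps y) = Q" using mx by (auto simp: poly_maps_def)
  define h where "h = real CARD('m) * (C4 * M * \<sigma> powr (real k + \<mu>))"
  have h: "0 \<le> h" using C4_pos M by (simp add: h_def)
  have close: "G (tuple_at (ps x) z) (tuple_at (ps y) z) \<le> real Q * h" if z: "z \<in> ball x \<sigma>" for z
  proof -
    have comp: "\<bar>(ps x ! i) z $ j - (ps y ! \<pi> i) z $ j\<bar> \<le> C4 * M * \<sigma> powr (real k + \<mu>)" if i: "i < Q" for i j
    proof -
      have "norm (z - x) \<le> \<sigma>" using z by (simp add: dist_norm norm_minus_commute)
      then have "norm (z - x) / s \<le> \<sigma> / s" using s by (intro divide_right_mono) auto
      moreover have "1 \<le> \<sigma> / s" using s by simp
      ultimately have "1 + norm (z - x) / s \<le> 2 * (\<sigma> / s)" by linarith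
      then have "(1 + norm (z - x) / s) ^ k \<le> (2 * (\<sigma> / s)) ^ k" using s by (intro power_mono) auto
      then have "C * a * (1 + norm (z - x) / s) ^ k \<le> C * a * (2 ^ k * \<sigma> ^ k / s ^ k)"
        using C a by (intro mult_left_mono) (auto simp: power_mult_distrib power_divide)
      also have "\<dots> = C4 * M * (s powr \<mu> * \<sigma> ^ k)"
        using s by (simp add: a_def C4_def powr_add powr_realpow)
      also have "\<dots> \<le> C4 * M * (\<sigma> powr \<mu> * \<sigma> ^ k)"
        using C4_pos M s \<mu> \<sigma>0 by (intro mult_left_mono mult_right_mono powr_mono2) auto
      also have "\<sigma> powr \<mu> * \<sigma> ^ k = \<sigma> powr (real k + \<mu>)" using \<sigma>0 by (simp add: powr_add powr_realpow)
      finally show ?thesis using \<pi>(2)[OF i, of "[]" j z] by simp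
    qed
    show ?thesis
    proof (rule qdist_map_le[OF len \<pi>(1) h])
      fix i assume i: "i < Q"
      have "norm ((ps x ! i) z - (ps y ! \<pi> i) z) \<le> (\<Sum>j\<in>UNIV. \<bar>((ps x ! i) z - (ps y ! \<pi> i) z) $ j\<bar>)"
        by (rule norm_le_l1_cart)
      also have "\<dots> \<le> (\<Sum>j\<in>(UNIV :: 'm set). C4 * M * \<sigma> powr (real k + \<mu>))"
        using comp[OF i] by (intro sum_mono) simp
      finally show "\<bar>norm ((ps x ! i) z - (ps y ! \<pi> i) z)\<bar> \<le> h" by (simp add: h_def)
    qed
  qed
  have "ball x \<sigma> \<subseteq> ball x \<rho>0" by (rule subset_ball) (use \<sigma> \<rho>0 in linarith)
  then have sub2: "ball x \<sigma> \<subseteq> \<Omega>" using b \<Omega>(2) by blast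
  have dy2: "deviation q u (ps y) (ball x \<sigma>) \<le> ennreal ((C1 * 8 powr e1 * M) powr q * \<sigma> powr e)"
  proof -
    have "deviation q u (ps y) (ball x \<sigma>) \<le> deviation q u (ps y) (ball y (8 * \<sigma>))"
    proof (rule deviation_mono, rule subsetI)
      fix z assume "z \<in> ball x \<sigma>"
      then show "z \<in> ball y (8 * \<sigma>)" using dist_triangle[of y z x] y(2) s \<sigma> \<delta> by (auto simp: dist_commute)
    qed
    also have "\<dots> \<le> ennreal ((C1 * M) powr q * (8 * \<sigma>) powr e)"
      by (rule decay_at_Gamma[OF y(1,3)]) (use \<sigma> \<sigma>0 in auto)
    also have "(C1 * M) powr q * (8 * \<sigma>) powr e \<le> (C1 * 8 powr e1 * M) powr q * \<sigma> powr e"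
    proof -
      have "(8 powr e1) powr 1 \<le> (8 powr e1 :: real) powr q"
        using q e(3) by (intro powr_mono ge_one_powr_ge_zero) auto
      then have "8 powr e1 \<le> (8 powr e1 :: real) powr q" by simp
      moreover have "8 powr e \<le> (8 :: real) powr e1" by (rule powr_e_le) simp
      ultimately have "8 powr e \<le> (8 powr e1 :: real) powr q" by linarith
      then have "(C1 * M) powr q * (8 powr e * \<sigma> powr e) \<le> (C1 * M) powr q * ((8 powr e1) powr q * \<sigma> powr e)"
        by (intro mult_left_mono mult_right_mono) auto
      then show ?thesis using \<sigma>0 C12 M by (simp add: powr_mult mult_ac)
    qed
    finally show ?thesis by (simp add: ennreal_leI)
  qed
  let ?\<omega> = "unit_ball_vol (real CARD('n))"
  let ?c1 = "C1 * 8 powr e1" and ?c2 = "real Q * (real CARD('m) * C4) * (1 + ?\<omega>)"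
  have c: "0 \<le> ?c1" "0 \<le> ?c2" using C12 C4_pos by auto
  have vol: "(real Q * h) powr q * measure lebesgue (ball x \<sigma>) \<le> (?c2 * M) powr q * \<sigma> powr e"
  proof -
    let ?A = "real Q * (real CARD('m) * C4) * M"
    have A: "0 \<le> ?A" using C4_pos M by simp
    have "(real Q * h) powr q * measure lebesgue (ball x \<sigma>)
        = (?A * \<sigma> powr (real k + \<mu>)) powr q * (?\<omega> * \<sigma> ^ CARD('n))"
      using \<sigma>0 by (simp add: h_def content_ball mult_ac)
    also have "\<dots> = ?\<omega> * ?A powr q * ((\<sigma> powr (real k + \<mu>)) powr q * \<sigma> ^ CARD('n))"
      using A by (simp add: powr_mult)
    also have "(\<sigma> powr (real k + \<mu>)) powr q * \<sigma> ^ CARD('n) = \<sigma> powr e"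
      using \<sigma>0 by (simp add: powr_powr powr_realpow[symmetric] powr_add[symmetric] e_def algebra_simps)
    also have "?\<omega> * ?A powr q * \<sigma> powr e \<le> ((1 + ?\<omega>) * ?A) powr q * \<sigma> powr e"
      using A q by (intro mult_right_mono absorb_factor) auto
    finally show ?thesis by (simp add: mult_ac)
  qed
  have "deviation q u (ps x) (ball x \<sigma>) \<le> ennreal (2 powr q) *
      (deviation q u (ps y) (ball x \<sigma>) + ennreal ((real Q * h) powr q * measure lebesgue (ball x \<sigma>)))"
    by (rule deviation_change[OF mx \<Omega>(1) u sub2]) (use q h close in auto)
  also have "\<dots> \<le> ennreal (2 powr q) *
      (ennreal ((?c1 * M) powr q * \<sigma> powr e) + ennreal ((?c2 * M) powr q * \<sigma> powr e))"
    by (intro mult_left_mono add_mono dy2 ennreal_leI vol) auto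
  also have "\<dots> = ennreal (2 powr q * ((?c1 * M) powr q + (?c2 * M) powr q) * \<sigma> powr e)"
    by (simp flip: ennreal_plus ennreal_mult add: algebra_simps)
  also have "\<dots> \<le> ennreal (2 powr q * (2 powr q * ((?c1 + ?c2) * M) powr q) * \<sigma> powr e)"
  proof (intro ennreal_leI mult_right_mono mult_left_mono)
    have "(?c1 * M) powr q \<le> ((?c1 + ?c2) * M) powr q" "(?c2 * M) powr q \<le> ((?c1 + ?c2) * M) powr q"
      using c M q by (auto intro!: powr_mono2 mult_right_mono)
    then have "(?c1 * M) powr q + (?c2 * M) powr q \<le> 2 * ((?c1 + ?c2) * M) powr q" by linarith
    also have "\<dots> \<le> 2 powr q * ((?c1 + ?c2) * M) powr q"
      using powr_mono[of 1 q 2] q by (intro mult_right_mono) auto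
    finally show "(?c1 * M) powr q + (?c2 * M) powr q \<le> 2 powr q * ((?c1 + ?c2) * M) powr q" .
  qed auto
  also have "2 powr q * (2 powr q * ((?c1 + ?c2) * M) powr q) = (large_radius_const CARD('n) CARD('m) Q C1 C4 e1 * M) powr q"
  proof -
    have "(4::real) powr q = 2 powr q * 2 powr q" by (simp flip: powr_mult)
    moreover have "(large_radius_const CARD('n) CARD('m) Q C1 C4 e1 * M) powr q = (4 * ((?c1 + ?c2) * M)) powr q" by (simp add: large_radius_const_def mult_ac)
    moreover have "(4 * ((?c1 + ?c2) * M)) powr q = 4 powr q * ((?c1 + ?c2) * M) powr q"
      using c M by (subst powr_mult) auto
    ultimately show ?thesis by simp
  qed
  finally show ?thesis .
qed

lemma decay:
  assumes x: "x \<in> closure W" and b: "ball x (2 * \<rho>0) \<subseteq> W" and \<sigma>: "0 < \<sigma>" "\<sigma> \<le> \<rho>0 / 64"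
  shows "deviation q u (ps x) (ball x \<sigma>) \<le> ennreal ((D * M) powr q * \<sigma> powr e)"
proof -
  define C0 where "C0 = 1 + B * (\<rho>0 / 32) powr (- e1)"
  have D: "D = C0 + C2 + large_radius_const CARD('n) CARD('m) Q C1 C4 e1"
    by (simp add: D_def decay_const_def Let_def C0_def C1_def C2_def C4_def)
  have pos: "1 \<le> C0" "1 \<le> C2" "0 \<le> large_radius_const CARD('n) CARD('m) Q C1 C4 e1"
    using B C12 C4_pos by (auto simp: C0_def large_radius_const_def intro!: add_nonneg_nonneg)
  have weaken: "deviation q u (ps x) (ball x \<sigma>) \<le> ennreal ((D * M) powr q * \<sigma> powr e)"
    if "deviation q u (ps x) (ball x \<sigma>) \<le> ennreal ((c * M) powr q * \<sigma> powr e)" "0 \<le> c" "c \<le> D" for c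
  proof -
    have "(c * M) powr q * \<sigma> powr e \<le> (D * M) powr q * \<sigma> powr e"
      using that M q by (intro mult_right_mono powr_mono2) auto
    then show ?thesis using that(1) by (meson ennreal_leI order_trans)
  qed
  have b1: "ball x \<rho>0 \<subseteq> W" using b subset_ball[of \<rho>0 "2 * \<rho>0" x] \<rho>0 by auto
  show ?thesis
  proof (cases "x \<in> \<Gamma>")
    case True
    show "deviation q u (ps x) (ball x \<sigma>) \<le> ennreal ((D * M) powr q * \<sigma> powr e)"
      by (rule weaken[OF decay_at_Gamma[of x \<sigma>]]) (use True x b1 \<sigma> \<rho>0 C12 pos D in auto)
  next
    case False
    then have xn: "x \<in> closure W - \<Gamma>" using x by simp
    have \<delta>: "0 < infdist x \<Gamma>"
      using False \<Gamma> by (metis Int_empty_left infdist_nonneg in_closed_iff_infdist_zero order_less_le)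
    show "deviation q u (ps x) (ball x \<sigma>) \<le> ennreal ((D * M) powr q * \<sigma> powr e)"
    proof (cases "\<rho>0 / 16 \<le> infdist x \<Gamma>")
      case True
      show ?thesis
        by (rule weaken[OF decay_away_from_Gamma[OF x b1 True \<sigma>, folded C0_def]]) (use pos D in auto)
    next
      case False
      then have near: "infdist x \<Gamma> < \<rho>0 / 16" by simp
      obtain y where y: "y \<in> \<Gamma> \<inter> closure W" "dist x y = infdist x \<Gamma>" "ball y \<rho>0 \<subseteq> W"
        using nearest_point[OF x b near] .
      show ?thesis
      proof (cases "\<sigma> \<le> infdist x \<Gamma> / 4")
        case True
        show ?thesis
          by (rule weaken[OF decay_near_Gamma_small[OF xn b1 y near \<delta> \<sigma>(1) True]]) (use pos D in auto)
      next
        case False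
        show ?thesis
          by (rule weaken[OF decay_near_Gamma_large[OF xn b1 y near \<delta> _ \<sigma>(2)]]) (use False pos D in auto)
      qed
    qed
  qed
qed

end

section \<open>Agreement with the approximating polynomials almost everywhere\<close>

context approximation_data
begin

lemma D_pos: "1 \<le> D"
proof -
  have "0 \<le> large_radius_const CARD('n) CARD('m) Q C1 C4 e1"
    using C12 C4_pos by (auto simp: large_radius_const_def intro!: add_nonneg_nonneg)
  moreover have "D = 1 + B * (\<rho>0 / 32) powr (- e1) + C2 + large_radius_const CARD('n) CARD('m) Q C1 C4 e1"
    by (simp add: D_def decay_const_def Let_def C1_def C2_def C4_def)
  moreover have "0 \<le> B * (\<rho>0 / 32) powr (- e1)" using B by simp
  ultimately show ?thesis using C12 by linarith
qed

lemma length_ps: "x \<in> closure W \<Longrightarrow> length (ps x) = Q"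
  using maps by (auto simp: poly_maps_def)

lemma bad_set_small:
  assumes x: "x \<in> closure W" and b: "ball x (2 * \<rho>0) \<subseteq> W" and \<sigma>: "0 < \<sigma>" "\<sigma> \<le> \<rho>0 / 64" and \<eta>: "0 < \<eta>"
  shows "{z \<in> ball x \<sigma>. \<eta> < G (u z) (tuple_at (ps x) z)} \<in> lmeasurable"
    "measure lebesgue {z \<in> ball x \<sigma>. \<eta> < G (u z) (tuple_at (ps x) z)} \<le> (D * M / \<eta>) powr q * \<sigma> powr e"
proof -
  have m: "(\<lambda>z. G (u z) (tuple_at (ps x) z)) \<in> borel_measurable (lebesgue_on \<Omega>)"
    using u length_ps[OF x] by (intro G_measurable[OF u(1) poly_maps_measurable[OF maps[OF x]]]) auto
  have "ball x \<sigma> \<subseteq> ball x (2 * \<rho>0)" by (rule subset_ball) (use \<sigma> \<rho>0 in linarith)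
  then have s: "ball x \<sigma> \<subseteq> \<Omega>" using b \<Omega>(2) by blast
  have nn: "0 \<le> (D * M) powr q * \<sigma> powr e" by simp
  note wt = weak_type_bound[OF m \<Omega>(1) s lmeasurable_ball \<eta> q nn decay[OF x b \<sigma>]]
  show "{z \<in> ball x \<sigma>. \<eta> < G (u z) (tuple_at (ps x) z)} \<in> lmeasurable" by (rule wt(1))
  show "measure lebesgue {z \<in> ball x \<sigma>. \<eta> < G (u z) (tuple_at (ps x) z)} \<le> (D * M / \<eta>) powr q * \<sigma> powr e"
    using wt(2) D_pos M \<eta> by (simp add: powr_divide)
qed

text \<open>
  In a small cube at \<open>x\<close> the set where \<open>u\<close> is within \<open>r\<close> of \<open>T\<close> fills more than half of the volume, by
  density, while the set where \<open>u\<close> is farther than \<open>\<eta>\<close> from the polynomial has a measure of order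
  \<open>h powr e\<close>, which is small compared to the volume because \<open>e > n\<close>. So some point of the cube is in the first
  set but not in the second, and the polynomial is almost constant on the cube.
\<close>

lemma density_point_value:
  assumes x: "x \<in> closure W" and b: "ball x (2 * \<rho>0) \<subseteq> W" and T: "size T = Q" and \<eta>: "0 < \<eta>"
    and ms: "{z \<in> \<Omega>. G (u z) T < r} \<in> sets lebesgue"
    and dens: "\<exists>d>0. \<forall>h. 0 < h \<and> h < d \<longrightarrow>
      norm (integral (cbox x (x + h *\<^sub>R One)) (indicat_real {z \<in> \<Omega>. G (u z) T < r}) /\<^sub>R h ^ DIM(real ^ 'n) - 1) < 1/2"
  shows "G (tuple_at (ps x) x) T < r + 2 * \<eta>"
proof -
  let ?n = "real CARD('n)"
  let ?A = "{z \<in> \<Omega>. G (u z) T < r}"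
  let ?Q = "\<lambda>h. cbox x (x + h *\<^sub>R One)"
  let ?bad = "\<lambda>h. {z \<in> ball x ((?n + 1) * h). \<eta> < G (u z) (tuple_at (ps x) z)}"
  have n: "0 < ?n" by simp
  have in_ball: "z \<in> ball x ((?n + 1) * h)" if h: "0 < h" and z: "z \<in> ?Q h" for h z
  proof -
    have "dist x z = norm (z - x)" by (simp add: dist_norm norm_minus_commute)
    also have "\<dots> \<le> (\<Sum>i\<in>UNIV. \<bar>(z - x) $ i\<bar>)" by (rule norm_le_l1_cart)
    also have "\<dots> \<le> (\<Sum>i\<in>(UNIV :: 'n set). h)"
    proof (rule sum_mono)
      fix i
      have "x $ i \<le> z $ i \<and> z $ i \<le> (x + h *\<^sub>R One) $ i" using z by (simp add: mem_box_cart)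
      moreover have "(One :: real ^ 'n) $ i = 1"
      proof -
        have ax: "axis i 1 \<in> (Basis :: (real ^ 'n) set)" by (simp add: axis_in_Basis_iff)
        have "One \<bullet> axis i (1 :: real) = (\<Sum>b\<in>(Basis :: (real ^ 'n) set). if b = axis i 1 then 1 else 0)"
          unfolding inner_sum_left by (rule sum.cong) (use ax in \<open>auto simp: inner_Basis\<close>)
        then show ?thesis using ax by (simp add: cart_eq_inner_axis)
      qed
      ultimately show "\<bar>(z - x) $ i\<bar> \<le> h" by simp
    qed
    also have "\<dots> < (?n + 1) * h" using h by simp
    finally show ?thesis by simp
  qed
  have ev_dens: "\<forall>\<^sub>F h in at_right 0. h ^ CARD('n) / 2 < measure lebesgue (?A \<inter> ?Q h)"
  proof -
    obtain d where d: "d > 0" "\<And>h. 0 < h \<Longrightarrow> h < d \<Longrightarrow>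
        norm (integral (?Q h) (indicat_real ?A) /\<^sub>R h ^ DIM(real ^ 'n) - 1) < 1/2"
      using dens by blast
    have "h ^ CARD('n) / 2 < measure lebesgue (?A \<inter> ?Q h)" if h: "h \<in> {0<..<d}" for h
    proof -
      have "?A \<inter> ?Q h \<in> lmeasurable"
        by (rule fmeasurableI2[OF lmeasurable_cbox[of x "x + h *\<^sub>R One"]]) (use ms in auto)
      then have I: "integral (?Q h) (indicat_real ?A) = measure lebesgue (?A \<inter> ?Q h)"
        by (rule integral_indicator)
      define m where "m = measure lebesgue (?A \<inter> ?Q h)"
      define X where "X = h ^ CARD('n)"
      have X: "0 < X" using h by (simp add: X_def)
      have dim: "DIM(real ^ 'n) = CARD('n)" by simp
      have "norm (m /\<^sub>R X - 1) < 1/2"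
        using d(2)[of h] h unfolding I m_def[symmetric] dim X_def[symmetric] by auto
      moreover have "m /\<^sub>R X = m / X" by (simp only: real_scaleR_def divide_inverse mult.commute)
      ultimately have "1/2 < m / X" unfolding real_norm_def by linarith
      then have "X / 2 < m" using X by (simp add: field_simps)
      then show ?thesis by (simp only: m_def X_def)
    qed
    then show ?thesis using d(1) by (auto simp: eventually_at_right_field intro!: exI[of _ d])
  qed
  have ev_h: "\<forall>\<^sub>F h in at_right 0. (0::real) < h \<and> (?n + 1) * h \<le> \<rho>0 / 64"
  proof -
    have "(?n + 1) * h \<le> \<rho>0 / 64" if "h < \<rho>0 / 64 / (?n + 1)" for h
      using that n by (simp add: field_simps)
    then show ?thesis using \<rho>0 n unfolding eventually_at_right_field
      by (intro exI[of _ "\<rho>0 / 64 / (?n + 1)"]) (auto intro!: divide_pos_pos)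
  qed
  have ev_bad: "\<forall>\<^sub>F h in at_right 0. measure lebesgue (?bad h) < h ^ CARD('n) / 2"
  proof -
    define c where "c = (D * M / \<eta>) powr q * (?n + 1) powr e"
    have en: "0 < e - ?n" using q \<mu> by (simp add: e_def add_nonneg_pos)
    have "((\<lambda>h. c * h powr (e - ?n)) \<longlongrightarrow> c * 0) (at_right 0)"
      by (intro tendsto_mult tendsto_const tendsto_zero_powrI[of _ _ _ "e - ?n"] en)
         (auto simp: eventually_at_right_field intro!: tendsto_ident_at exI[of _ 1])
    then have "\<forall>\<^sub>F h in at_right 0. c * h powr (e - ?n) < 1/2"
      by (rule order_tendstoD) simp
    moreover note ev_h
    ultimately show ?thesis
    proof eventually_elim
      case (elim h)
      have "measure lebesgue (?bad h) \<le> (D * M / \<eta>) powr q * ((?n + 1) * h) powr e"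
        using elim n by (intro bad_set_small x b \<eta>) auto
      also have "\<dots> = (c * h powr (e - ?n)) * h ^ CARD('n)"
        using elim n by (simp add: c_def powr_mult powr_diff powr_realpow)
      also have "\<dots> < 1/2 * h ^ CARD('n)" using elim by (intro mult_strict_right_mono) auto
      finally show ?case by simp
    qed
  qed
  have ev_cont: "\<forall>\<^sub>F h in at_right 0. \<forall>z\<in>?Q h. \<bar>G (tuple_at (ps x) z) T - G (tuple_at (ps x) x) T\<bar> < \<eta>"
  proof -
    have "isCont (\<lambda>z. G (tuple_at (ps x) z) T) x"
      by (rule G_tuple_isCont) (use poly_maps_isCont[OF maps[OF x]] length_ps[OF x] T in auto)
    then obtain d where d: "d > 0" "\<And>z. dist z x < d \<Longrightarrow> dist (G (tuple_at (ps x) z) T) (G (tuple_at (ps x) x) T) < \<eta>"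
      using \<eta> unfolding continuous_at_eps_delta by metis
    have "\<bar>G (tuple_at (ps x) z) T - G (tuple_at (ps x) x) T\<bar> < \<eta>" if h: "0 < h" "h < d / (?n + 1)" and z: "z \<in> ?Q h" for h z
    proof -
      have "dist x z < (?n + 1) * h" using in_ball[OF h(1) z] by simp
      also have "\<dots> < d" using h n by (simp add: field_simps)
      finally show ?thesis using d(2)[of z] by (simp add: dist_commute dist_real_def)
    qed
    moreover have "0 < d / (?n + 1)" using d n by simp
    ultimately show ?thesis unfolding eventually_at_right_field by (intro exI[of _ "d / (?n + 1)"]) auto
  qed
  from ev_dens ev_bad ev_cont ev_h
  have "\<forall>\<^sub>F h in at_right 0. h ^ CARD('n) / 2 < measure lebesgue (?A \<inter> ?Q h) \<and>
      measure lebesgue (?bad h) < h ^ CARD('n) / 2 \<and>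
      (\<forall>z\<in>?Q h. \<bar>G (tuple_at (ps x) z) T - G (tuple_at (ps x) x) T\<bar> < \<eta>) \<and> (0::real) < h \<and> (?n + 1) * h \<le> \<rho>0 / 64"
    by eventually_elim blast
  then obtain h where h: "h ^ CARD('n) / 2 < measure lebesgue (?A \<inter> ?Q h)"
      "measure lebesgue (?bad h) < h ^ CARD('n) / 2"
      "\<And>z. z \<in> ?Q h \<Longrightarrow> \<bar>G (tuple_at (ps x) z) T - G (tuple_at (ps x) x) T\<bar> < \<eta>"
      "(0::real) < h" "(?n + 1) * h \<le> \<rho>0 / 64"
    using eventually_happens'[OF trivial_limit_at_right_real] by blast
  have "\<not> ?A \<inter> ?Q h \<subseteq> ?bad h"
  proof
    assume "?A \<inter> ?Q h \<subseteq> ?bad h"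
    moreover have "?A \<inter> ?Q h \<in> sets lebesgue" using ms by (intro sets.Int) auto
    moreover have "?bad h \<in> lmeasurable"
      by (rule bad_set_small(1)[OF x b _ h(5) \<eta>]) (use h n in simp)
    ultimately have "measure lebesgue (?A \<inter> ?Q h) \<le> measure lebesgue (?bad h)"
      by (rule measure_mono_fmeasurable)
    then show False using h by linarith
  qed
  then obtain z where z: "z \<in> \<Omega>" "G (u z) T < r" "z \<in> ?Q h" "z \<notin> ?bad h" by blast
  have close: "G (u z) (tuple_at (ps x) z) \<le> \<eta>" using z(4) in_ball[OF h(4) z(3)] by auto
  have "G (tuple_at (ps x) z) T \<le> G (tuple_at (ps x) z) (u z) + G (u z) T"
    using T length_ps[OF x] u(2)[OF z(1)] by (intro G_triangle) auto
  moreover have "G (tuple_at (ps x) z) (u z) = G (u z) (tuple_at (ps x) z)"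
    using length_ps[OF x] u(2)[OF z(1)] by (intro G_sym) auto
  ultimately show ?thesis using close z(2) h(3)[OF z(3)] by linarith
qed

text \<open>
  The densities are required for countably many sets only: \<open>T\<close> in a countable dense set and rational \<open>r\<close>. Since
  \<open>u x\<close> has such \<open>T\<close> arbitrarily close to it, the values of \<open>u\<close> and of the polynomial at \<open>x\<close> agree.
\<close>

lemma values_ae:
  obtains N where "negligible N"
    "\<And>x. x \<in> closure W \<Longrightarrow> ball x (2 * \<rho>0) \<subseteq> W \<Longrightarrow> x \<notin> N \<Longrightarrow> tuple_at (ps x) x = u x"
proof -
  obtain T0 :: "(real ^ 'm) multiset set" where T0: "countable T0" "\<And>T. T \<in> T0 \<Longrightarrow> size T = Q"
    "\<And>T \<eta>. size T = Q \<Longrightarrow> 0 < \<eta> \<Longrightarrow> \<exists>S\<in>T0. G T S < \<eta>"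
    using tuples_separable[of Q thesis] by blast
  let ?A = "\<lambda>T r. {z \<in> \<Omega>. G (u z) T < r}"
  have ms: "?A T r \<in> sets lebesgue" if "T \<in> T0" for T r
  proof -
    have "(\<lambda>z. G (u z) T) \<in> borel_measurable (lebesgue_on \<Omega>)"
      using u(1) T0(2)[OF that] by (auto simp: qmeasurable_on_def)
    then have "{z \<in> space (lebesgue_on \<Omega>). G (u z) T < r} \<in> sets (lebesgue_on \<Omega>)"
      unfolding borel_measurable_iff_less by blast
    then show ?thesis using \<Omega>(1) by (auto simp: sets_restrict_space_iff lborelD)
  qed
  let ?P = "\<lambda>T r N. negligible N \<and> (\<forall>x e. x \<notin> N \<longrightarrow> 0 < e \<longrightarrow> (\<exists>d>0. \<forall>h. 0 < h \<and> h < d \<longrightarrow>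
      norm (integral (cbox x (x + h *\<^sub>R One)) (indicat_real (?A T r)) /\<^sub>R h ^ DIM(real ^ 'n) - indicat_real (?A T r) x) < e))"
  have ex: "\<exists>N. ?P T r N"
    if "T \<in> T0" for T r
  proof -
    have "\<And>a b. indicat_real (?A T r) integrable_on cbox a b"
      unfolding integrable_on_indicator
      by (rule fmeasurableI2[OF lmeasurable_cbox]) (use ms[OF that] in auto)
    then show ?thesis by (rule integrable_ccontinuous_explicit) blast
  qed
  define N where "N T r = (SOME N. ?P T r N)" for T r
  have NP: "?P T r (N T r)" if "T \<in> T0" for T r
    unfolding N_def by (rule someI_ex[OF ex[OF that]])
  have N: "\<And>T r. T \<in> T0 \<Longrightarrow> negligible (N T r)"
    "\<And>T r x e. T \<in> T0 \<Longrightarrow> x \<notin> N T r \<Longrightarrow> 0 < e \<Longrightarrow> \<exists>d>0. \<forall>h. 0 < h \<and> h < d \<longrightarrow>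
      norm (integral (cbox x (x + h *\<^sub>R One)) (indicat_real (?A T r)) /\<^sub>R h ^ DIM(real ^ 'n) - indicat_real (?A T r) x) < e"
    using NP by blast+
  show thesis
  proof (rule that[of "\<Union>((\<lambda>(T, r). N T r) ` (T0 \<times> \<rat>))"])
    show "negligible (\<Union>((\<lambda>(T, r). N T r) ` (T0 \<times> \<rat>)))"
      using T0(1) N(1) by (intro negligible_countable_Union countable_image countable_SIGMA countable_rat) auto
    fix x assume x: "x \<in> closure W" and b: "ball x (2 * \<rho>0) \<subseteq> W"
      and xN: "x \<notin> \<Union>((\<lambda>(T, r). N T r) ` (T0 \<times> \<rat>))"
    have x\<Omega>: "x \<in> \<Omega>" using b \<rho>0 \<Omega>(2) by (auto simp: subset_iff)
    have sz: "size (u x) = Q" "length (ps x) = Q" using u(2)[OF x\<Omega>] length_ps[OF x] by auto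
    have small: "G (u x) (tuple_at (ps x) x) \<le> t" if t: "0 < t" for t
    proof -
      obtain r where r: "r \<in> \<rat>" "0 < r" "r < t / 4" using Rats_dense_in_real[of 0 "t / 4"] t by auto
      obtain T where T: "T \<in> T0" "G (u x) T < r" using T0(3)[OF sz(1) r(2)] by blast
      have "x \<notin> N T r" using xN T(1) r(1) by auto
      from N(2)[OF T(1) this, of "1/2"] have dens: "\<exists>d>0. \<forall>h. 0 < h \<and> h < d \<longrightarrow>
        norm (integral (cbox x (x + h *\<^sub>R One)) (indicat_real (?A T r)) /\<^sub>R h ^ DIM(real ^ 'n) - 1) < 1/2"
        using x\<Omega> T(2) by simp
      have "G (tuple_at (ps x) x) T < r + 2 * (t / 4)"
        by (rule density_point_value[OF x b T0(2)[OF T(1)] _ ms[OF T(1)] dens]) (use t in simp)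
      moreover have "G (u x) (tuple_at (ps x) x) \<le> G (u x) T + G T (tuple_at (ps x) x)"
        using sz T0(2)[OF T(1)] by (intro G_triangle) auto
      moreover have "G T (tuple_at (ps x) x) = G (tuple_at (ps x) x) T"
        using sz T0(2)[OF T(1)] by (intro G_sym) auto
      ultimately show ?thesis using T(2) r by linarith
    qed
    have "G (u x) (tuple_at (ps x) x) \<le> 0" by (rule field_le_epsilon) (use small in auto)
    moreover have "0 \<le> G (u x) (tuple_at (ps x) x)" using sz by (intro qdist_nonneg) auto
    ultimately have "u x = tuple_at (ps x) x" using sz by (intro G_eq_0) auto
    then show "tuple_at (ps x) x = u x" by simp
  qed
qed

end

section \<open>Jets and Hoelder estimates\<close>

definition derivative_tensor :: "nat \<Rightarrow> (real ^ 'n \<Rightarrow> real ^ 'm) \<Rightarrow> real ^ 'n \<Rightarrow> ('n, 'm::finite) tensor" where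
  "derivative_tensor j p x = (\<lambda>is. if length is = j then (\<chi> c. partials is (\<lambda>z. p z $ c) x) else 0)"

lemma finite_index_lists: "finite {is :: 'n::finite list. length is = j}"
  using finite_lists_length_eq[of "UNIV :: 'n set" j] by simp

lemma tensor_norm_nonneg: "0 \<le> tensor_norm j T"
  by (simp add: tensor_norm_def sum_nonneg)

lemma tensor_norm_le:
  fixes T :: "('n::finite, 'm::finite) tensor"
  assumes "\<And>is c. length is = j \<Longrightarrow> \<bar>T is $ c\<bar> \<le> b"
  shows "tensor_norm j T \<le> real (CARD('n) ^ j) * (real CARD('m) * b)"
proof -
  have "tensor_norm j T = L2_set (\<lambda>is. norm (T is)) {is. length is = j}"
    by (simp add: tensor_norm_def L2_set_def)
  also have "\<dots> \<le> (\<Sum>is | length is = j. norm (T is))" by (rule L2_set_le_sum) simp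
  also have "\<dots> \<le> (\<Sum>is\<in>{is :: 'n list. length is = j}. real CARD('m) * b)"
  proof (rule sum_mono)
    fix "is" :: "'n list" assume "is \<in> {is. length is = j}"
    then have "norm (T is) \<le> (\<Sum>c\<in>(UNIV :: 'm set). b)"
      using assms by (intro order_trans[OF norm_le_l1_cart sum_mono]) auto
    then show "norm (T is) \<le> real CARD('m) * b" by simp
  qed
  also have "\<dots> = real (CARD('n) ^ j) * (real CARD('m) * b)"
    using card_lists_length_eq[of "UNIV :: 'n set" j] by simp
  finally show ?thesis .
qed

definition tensor_const :: "nat \<Rightarrow> nat \<Rightarrow> nat \<Rightarrow> nat \<Rightarrow> real" where
  "tensor_const n m Q j = real Q * (real (n ^ j) * real m)"

lemma tdist_map_le:
  fixes f g :: "(real ^ 'n \<Rightarrow> real ^ 'm) \<Rightarrow> ('n::finite, 'm::finite) tensor"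
  assumes "length vs = Q" "length rs = Q" "\<sigma> permutes {..<Q}" "0 \<le> b"
    and "\<And>i is c. i < Q \<Longrightarrow> length is = j \<Longrightarrow> \<bar>f (vs ! i) is $ c - g (rs ! \<sigma> i) is $ c\<bar> \<le> b"
  shows "tdist j (mset (map f vs)) (mset (map g rs)) \<le> tensor_const CARD('n) CARD('m) Q j * b"
proof -
  have "tdist j (mset (map f vs)) (mset (map g rs)) \<le> real Q * (real (CARD('n) ^ j) * (real CARD('m) * b))"
  proof (rule qdist_map_le[OF assms(1-3)])
    show "0 \<le> real (CARD('n) ^ j) * (real CARD('m) * b)" using assms(4) by simp
    fix i assume "i < Q"
    then show "\<bar>tensor_norm j (f (vs ! i) - g (rs ! \<sigma> i))\<bar> \<le> real (CARD('n) ^ j) * (real CARD('m) * b)"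
      using tensor_norm_le[of j "f (vs ! i) - g (rs ! \<sigma> i)" b] assms(5)
      by (simp add: abs_of_nonneg[OF tensor_norm_nonneg])
  qed
  then show ?thesis by (simp add: tensor_const_def mult_ac)
qed

lemma partials_zero: "partials is (\<lambda>_. 0) z = (0 :: real)"
  using partials_diff[OF poly_fun_const[of 0 0] poly_fun_const[of 0 0], of "is"] by (auto dest: fun_cong)

lemma poly_maps_zero: "poly_maps Q k (replicate Q (\<lambda>_. 0))"
  by (auto simp: poly_maps_def poly_fun_const)

text \<open>
  The Taylor remainders of finitely many branches are summed, so that one bound serves for all of
  them, whichever branch the matching selects; likewise in the next lemma.
\<close>

lemma partials_tensor_remainder:
  fixes ps :: "(real ^ 'n \<Rightarrow> real ^ 'm) list"
  assumes "poly_maps Q k ps"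
  shows "((\<lambda>h. (\<Sum>i<Q. \<Sum>is | length is = j. \<Sum>c\<in>UNIV.
      \<bar>partials is (\<lambda>z. (ps ! i) z $ c) (x + h) - partials is (\<lambda>z. (ps ! i) z $ c) x
        - (\<Sum>l\<in>UNIV. h $ l * partials (l # is) (\<lambda>z. (ps ! i) z $ c) x)\<bar>) / norm h) \<longlongrightarrow> 0) (at 0)"
  unfolding sum_divide_distrib
proof (intro tendsto_null_sum)
  fix i :: nat and "is" :: "'n list" and c :: 'm
  assume "i \<in> {..<Q}"
  then have "(\<lambda>z. (ps ! i) z $ c) \<in> poly_fun k" using assms by (auto simp: poly_maps_def)
  from poly_fun_has_derivative[OF partials_poly_fun[OF this, of "is"], of x]
  show "((\<lambda>h. \<bar>partials is (\<lambda>z. (ps ! i) z $ c) (x + h) - partials is (\<lambda>z. (ps ! i) z $ c) x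
        - (\<Sum>l\<in>UNIV. h $ l * partials (l # is) (\<lambda>z. (ps ! i) z $ c) x)\<bar> / norm h) \<longlongrightarrow> 0) (at 0)"
    by (simp add: has_derivative_at)
qed

lemma partials_tensor_isCont:
  fixes ps :: "(real ^ 'n \<Rightarrow> real ^ 'm) list"
  assumes "poly_maps Q k ps"
  shows "isCont (\<lambda>y. \<Sum>i<Q. \<Sum>is | length is = j. \<Sum>c\<in>UNIV.
      \<bar>partials is (\<lambda>z. (ps ! i) z $ c) y - partials is (\<lambda>z. (ps ! i) z $ c) x\<bar>) x"
proof (intro continuous_sum continuous_rabs continuous_diff continuous_const)
  fix i :: nat and "is" :: "'n list" and c :: 'm
  assume "i \<in> {..<Q}"
  then have "(\<lambda>z. (ps ! i) z $ c) \<in> poly_fun k" using assms by (auto simp: poly_maps_def)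
  then show "isCont (partials is (\<lambda>z. (ps ! i) z $ c)) x"
    by (rule poly_fun_isCont[OF partials_poly_fun])
qed

lemma member_le_triple_sum:
  fixes f :: "nat \<Rightarrow> 'n::finite list \<Rightarrow> 'm::finite \<Rightarrow> real"
  assumes "i < Q" "length is = j"
  shows "\<bar>f i is c\<bar> \<le> (\<Sum>i<Q. \<Sum>is | length is = j. \<Sum>c\<in>UNIV. \<bar>f i is c\<bar>)"
proof -
  have "\<bar>f i is c\<bar> \<le> (\<Sum>c\<in>UNIV. \<bar>f i is c\<bar>)" by (rule member_le_sum) auto
  also have "\<dots> \<le> (\<Sum>is | length is = j. \<Sum>c\<in>UNIV. \<bar>f i is c\<bar>)"
    by (rule member_le_sum[of "is" _ "\<lambda>is. \<Sum>c\<in>UNIV. \<bar>f i is c\<bar>"])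
       (use assms finite_index_lists in \<open>auto intro: sum_nonneg\<close>)
  also have "\<dots> \<le> (\<Sum>i<Q. \<Sum>is | length is = j. \<Sum>c\<in>UNIV. \<bar>f i is c\<bar>)"
    by (rule member_le_sum[of i _ "\<lambda>i. \<Sum>is | length is = j. \<Sum>c\<in>UNIV. \<bar>f i is c\<bar>"])
       (use assms in \<open>auto intro: sum_nonneg\<close>)
  finally show ?thesis .
qed

text \<open>
  The factors are those of the comparison of \<open>P x\<close> with \<open>P y\<close> at the scale \<open>dist x y\<close>, and of \<open>P x\<close> with the zero
  polynomial at the scale \<open>\<rho>0 / 128\<close>. The last summand of \<open>holder_const\<close> covers pairs of points at distance
  at least \<open>\<rho>0 / 192\<close>, where the difference of the top derivatives is bounded by their suprema.
\<close>

definition pair_const :: "nat \<Rightarrow> real \<Rightarrow> real \<Rightarrow> real \<Rightarrow> real" where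
  "pair_const k C D e1 = C * (D * 3 powr e1) * 2 ^ k"

definition sup_const :: "nat \<Rightarrow> nat \<Rightarrow> real \<Rightarrow> real \<Rightarrow> real \<Rightarrow> real" where
  "sup_const n k \<rho>0 C D = C * (D * (128 / \<rho>0) ^ n) * (128 / \<rho>0) ^ k"

definition holder_const :: "nat \<Rightarrow> nat \<Rightarrow> nat \<Rightarrow> nat \<Rightarrow> real \<Rightarrow> real \<Rightarrow> real \<Rightarrow> real \<Rightarrow> real" where
  "holder_const n m k Q \<rho>0 C D e1 = (\<Sum>j\<le>k. tensor_const n m Q j * sup_const n k \<rho>0 C D)
     + tensor_const n m Q k * (pair_const k C D e1 + 2 * sup_const n k \<rho>0 C D * (192 / \<rho>0))"

context approximation_data
begin

text \<open>
  The points to which \<open>decay\<close> applies. The closure of \<open>\<Omega>'\<close> consists of such points.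
\<close>

definition "deep = {x \<in> closure W. ball x (2 * \<rho>0) \<subseteq> W}"

lemma deepD: "x \<in> deep \<Longrightarrow> x \<in> closure W" "x \<in> deep \<Longrightarrow> ball x (2 * \<rho>0) \<subseteq> W"
  by (auto simp: deep_def)

text \<open>
  This is the estimate from which the regularity follows: the derivatives of order \<open>j\<close> of the polynomials
  at \<open>x\<close> and \<open>y\<close> differ by a multiple of the power \<open>k + \<mu> - j\<close> of the distance.
\<close>

lemma pair_matching:
  assumes x: "x \<in> deep" and y: "y \<in> deep" and xy: "x \<noteq> y" "dist x y \<le> \<rho>0 / 192"
  obtains \<pi> where "\<pi> permutes {..<Q}"
    "\<And>i c is z. i < Q \<Longrightarrow> length is \<le> k \<Longrightarrow> dist x z \<le> dist x y \<Longrightarrow>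
      \<bar>partials is (\<lambda>z. (ps x ! i) z $ c) z - partials is (\<lambda>z. (ps y ! \<pi> i) z $ c) z\<bar>
        \<le> pair_const k C D e1 * M * dist x y powr (real k + \<mu> - real (length is))"
proof -
  note x' = deepD[OF x] and y' = deepD[OF y]
  define s where "s = dist x y"
  have s: "0 < s" "s \<le> \<rho>0 / 192" using xy by (auto simp: s_def)
  define a where "a = D * 3 powr e1 * M * s powr (real k + \<mu>)"
  have a: "0 < a" using D_pos M s by (simp add: a_def)
  have amp: "(3 * s) powr e * (D * M) powr q \<le> a powr q * s ^ CARD('n)"
    using amplitude[of 3 s D] D_pos s by (simp add: a_def)
  have dx: "deviation q u (ps x) (ball x (2 * s)) \<le> ennreal (a powr q * s ^ CARD('n))"
  proof -
    have "deviation q u (ps x) (ball x (2 * s)) \<le> ennreal ((D * M) powr q * (2 * s) powr e)"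
      by (rule decay[OF x']) (use s in auto)
    also have "(D * M) powr q * (2 * s) powr e \<le> (D * M) powr q * (3 * s) powr e"
      using s e(1) by (intro mult_left_mono powr_mono2) auto
    also have "\<dots> \<le> a powr q * s ^ CARD('n)" using amp by (simp add: mult.commute)
    finally show ?thesis by (simp add: ennreal_leI)
  qed
  have dy: "deviation q u (ps y) (ball x (2 * s)) \<le> ennreal (a powr q * s ^ CARD('n))"
  proof -
    have "deviation q u (ps y) (ball x (2 * s)) \<le> deviation q u (ps y) (ball y (3 * s))"
    proof (rule deviation_mono, rule subsetI)
      fix z assume "z \<in> ball x (2 * s)"
      then show "z \<in> ball y (3 * s)" using dist_triangle[of y z x] by (auto simp: s_def dist_commute)
    qed
    also have "\<dots> \<le> ennreal ((D * M) powr q * (3 * s) powr e)"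
      by (rule decay[OF y']) (use s in auto)
    also have "(D * M) powr q * (3 * s) powr e \<le> a powr q * s ^ CARD('n)" using amp by (simp add: mult.commute)
    finally show ?thesis by (simp add: ennreal_leI)
  qed
  have "ball x (2 * s) \<subseteq> ball x (2 * \<rho>0)" by (rule subset_ball) (use s \<rho>0 in linarith)
  then have sub: "ball x (2 * s) \<subseteq> \<Omega>" using x'(2) \<Omega>(2) by blast
  obtain \<pi> where \<pi>: "\<pi> permutes {..<Q}" "\<And>i j is z. i < Q \<Longrightarrow> length is \<le> k \<Longrightarrow>
        \<bar>partials is (\<lambda>z. (ps x ! i) z $ j) z - partials is (\<lambda>z. (ps y ! \<pi> i) z $ j) z\<bar>
          \<le> C * a / s ^ length is * (1 + norm (z - x) / s) ^ k"
    using matched[OF maps[OF x'(1)] maps[OF y'(1)] sub s(1) a dx dy] unfolding matched_within_def by blast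
  show thesis
  proof (rule that[OF \<pi>(1)])
    fix i c z and "is" :: "'n list" assume i: "i < Q" and l: "length is \<le> k" and z: "dist x z \<le> dist x y"
    have "norm (z - x) / s \<le> 1" using z s by (simp add: s_def dist_norm norm_minus_commute)
    then have "(1 + norm (z - x) / s) ^ k \<le> 2 ^ k" using s by (intro power_mono) auto
    then have "C * a / s ^ length is * (1 + norm (z - x) / s) ^ k \<le> C * a / s ^ length is * 2 ^ k"
      using C a s by (intro mult_left_mono) auto
    also have "\<dots> = pair_const k C D e1 * M * s powr (real k + \<mu> - real (length is))"
      using s by (simp add: pair_const_def a_def powr_diff powr_realpow)
    finally show "\<bar>partials is (\<lambda>z. (ps x ! i) z $ c) z - partials is (\<lambda>z. (ps y ! \<pi> i) z $ c) z\<bar>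
        \<le> pair_const k C D e1 * M * dist x y powr (real k + \<mu> - real (length is))"
      using \<pi>(2)[OF i l, of c z] by (simp add: s_def)
  qed
qed

text \<open>
  The zero polynomial is another polynomial from which \<open>u\<close> deviates by at most \<open>M\<close> in the mean, by
  \<open>base_zero\<close>, and matching with it bounds the polynomial itself.
\<close>

lemma partials_bounded:
  assumes x: "x \<in> deep" and i: "i < Q" and l: "length is \<le> k"
  shows "\<bar>partials is (\<lambda>z. (ps x ! i) z $ c) x\<bar> \<le> sup_const CARD('n) k \<rho>0 C D * M"
proof -
  note x' = deepD[OF x]
  define s where "s = \<rho>0 / 128"
  have s: "0 < s" "s \<le> 1" "2 * s \<le> \<rho>0 / 64" using \<rho>0 by (auto simp: s_def)
  define a where "a = D * M / s ^ CARD('n)"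
  have a: "0 < a" using D_pos M s by (simp add: a_def)
  have amp: "(D * M) powr q \<le> a powr q * s ^ CARD('n)"
  proof -
    define X where "X = s ^ CARD('n)"
    have X: "0 < X" "X \<le> 1" using s by (auto simp: X_def intro: power_le_one)
    have "X powr q \<le> X powr 1" using X q by (intro powr_mono') auto
    moreover have "0 < X powr q" using X by simp
    ultimately have "1 \<le> X / X powr q" using X by (simp add: le_divide_eq_1_pos)
    then have "(D * M) powr q * 1 \<le> (D * M) powr q * (X / X powr q)" by (rule mult_left_mono) simp
    also have "\<dots> = (D * M / X) powr q * X"
      using X D_pos M by (subst powr_divide) auto
    also have "\<dots> = a powr q * s ^ CARD('n)" by (simp add: a_def X_def)
    finally show ?thesis by simp
  qed
  have "ball x (2 * s) \<subseteq> ball x (2 * \<rho>0)" by (rule subset_ball) (use s \<rho>0 in linarith)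
  then have subW: "ball x (2 * s) \<subseteq> W" using x'(2) by blast
  then have sub: "ball x (2 * s) \<subseteq> \<Omega>" using \<Omega>(2) by blast
  have dx: "deviation q u (ps x) (ball x (2 * s)) \<le> ennreal (a powr q * s ^ CARD('n))"
  proof -
    have "deviation q u (ps x) (ball x (2 * s)) \<le> ennreal ((D * M) powr q * (2 * s) powr e)"
      by (rule decay[OF x']) (use s in auto)
    also have "(D * M) powr q * (2 * s) powr e \<le> (D * M) powr q * 1"
      using s \<rho>0 e(1) by (intro mult_left_mono powr_le1) auto
    also have "\<dots> \<le> a powr q * s ^ CARD('n)" using amp by simp
    finally show ?thesis by (simp add: ennreal_leI)
  qed
  have d0: "deviation q u (replicate Q (\<lambda>_. 0)) (ball x (2 * s)) \<le> ennreal (a powr q * s ^ CARD('n))"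
  proof -
    have "deviation q u (replicate Q (\<lambda>_. 0)) (ball x (2 * s)) \<le> ennreal (M powr q)"
      by (rule base_zero[OF subW]) (use s \<rho>0 in linarith)
    also have "M powr q \<le> (D * M) powr q" using D_pos M q by (intro powr_mono2) auto
    also have "\<dots> \<le> a powr q * s ^ CARD('n)" by (rule amp)
    finally show ?thesis by (simp add: ennreal_leI)
  qed
  obtain \<pi> where \<pi>: "\<pi> permutes {..<Q}" "\<And>i j is z. i < Q \<Longrightarrow> length is \<le> k \<Longrightarrow>
        \<bar>partials is (\<lambda>z. (ps x ! i) z $ j) z - partials is (\<lambda>z. ((replicate Q (\<lambda>_. 0) :: (real ^ 'n \<Rightarrow> real ^ 'm) list) ! \<pi> i) z $ j) z\<bar>
          \<le> C * a / s ^ length is * (1 + norm (z - x) / s) ^ k"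
    using matched[OF maps[OF x'(1)] poly_maps_zero sub s(1) a dx d0] unfolding matched_within_def by blast
  have "\<pi> i < Q" using permutes_in_image[OF \<pi>(1)] i by auto
  then have "\<bar>partials is (\<lambda>z. (ps x ! i) z $ c) x\<bar> \<le> C * a / s ^ length is"
    using \<pi>(2)[OF i l, of c x] by (simp add: partials_zero)
  also have "\<dots> \<le> C * a / s ^ k"
    using C a s l by (intro divide_left_mono power_decreasing) auto
  also have "\<dots> = sup_const CARD('n) k \<rho>0 C D * M"
    using \<rho>0 by (simp add: sup_const_def a_def s_def field_simps)
  finally show ?thesis .
qed

definition jet :: "nat \<Rightarrow> real ^ 'n \<Rightarrow> ('n, 'm) tensor multiset" where
  "jet j x = mset (map (\<lambda>p. derivative_tensor j p x) (ps x))"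

lemma jet_props:
  assumes x: "x \<in> deep"
  shows "size (jet j x) = Q" "\<forall>T\<in>#jet j x. T \<in> tensors j"
    "jet 0 x = image_mset tensor0 (tuple_at (ps x) x)"
proof -
  show "size (jet j x) = Q" using length_ps[OF deepD(1)[OF x]] by (simp add: jet_def)
  show "\<forall>T\<in>#jet j x. T \<in> tensors j" by (auto simp: jet_def derivative_tensor_def tensors_def)
  have "derivative_tensor 0 p x = tensor0 (p x)" for p :: "real ^ 'n \<Rightarrow> real ^ 'm"
    by (rule ext) (simp add: derivative_tensor_def tensor0_def vec_eq_iff)
  then show "jet 0 x = image_mset tensor0 (tuple_at (ps x) x)"
    by (simp add: jet_def multiset.map_comp o_def)
qed

abbreviation "K1 \<equiv> pair_const k C D e1 * M"

lemma K1_nonneg: "0 \<le> K1"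
  using C D_pos M by (simp add: pair_const_def)

text \<open>
  The jet at \<open>x + h\<close> differs from the derivatives of \<open>P x\<close> at \<open>x + h\<close> by the order \<open>k + \<mu> - j\<close> in \<open>norm h\<close>, which
  exceeds 1 as \<open>j < k\<close>. So what has to be differentiated is the single polynomial \<open>P x\<close>.
\<close>

lemma jet_has_qderiv:
  assumes S: "open S" "S \<subseteq> deep" and x: "x \<in> S" and j: "j < k"
  shows "has_qderiv j (jet j) x (jet (Suc j) x)"
proof -
  let ?T = "tensor_const CARD('n) CARD('m) Q j"
  have xg: "x \<in> deep" using x S by blast
  have len: "length (ps x) = Q" using length_ps[OF deepD(1)[OF xg]] .
  have px: "poly_maps Q k (ps x)" by (rule maps[OF deepD(1)[OF xg]])
  let ?M = "mset (map (\<lambda>p. (derivative_tensor j p x, derivative_tensor (Suc j) p x)) (ps x))"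
  let ?aff = "\<lambda>h. mset (map (\<lambda>p. tensor_affine (derivative_tensor j p x) (derivative_tensor (Suc j) p x) h) (ps x))"
  define rem where "rem h = (\<Sum>i<Q. \<Sum>is | length is = j. \<Sum>c\<in>UNIV.
      \<bar>partials is (\<lambda>z. (ps x ! i) z $ c) (x + h) - partials is (\<lambda>z. (ps x ! i) z $ c) x
        - (\<Sum>l\<in>UNIV. h $ l * partials (l # is) (\<lambda>z. (ps x ! i) z $ c) x)\<bar>)" for h
  let ?b = "\<lambda>h. ?T * (K1 * norm h powr (real k + \<mu> - real j - 1) + rem h / norm h)"
  have "((\<lambda>h. norm h powr (real k + \<mu> - real j - 1)) \<longlongrightarrow> 0) (at (0 :: real ^ 'n))"
    by (rule tendsto_zero_powrI[of _ _ _ "real k + \<mu> - real j - 1"])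
       (use j \<mu> in \<open>auto intro!: tendsto_norm_zero tendsto_ident_at\<close>)
  moreover have "((\<lambda>h. rem h / norm h) \<longlongrightarrow> 0) (at 0)"
    unfolding rem_def by (rule partials_tensor_remainder[OF px])
  ultimately have "(?b \<longlongrightarrow> ?T * (K1 * 0 + 0)) (at 0)" by (intro tendsto_intros)
  then have b0: "(?b \<longlongrightarrow> 0) (at 0)" by simp
  obtain r where r: "r > 0" "ball x r \<subseteq> S" using S x openE by blast
  have bound: "norm (tdist j (jet j (x + h)) (?aff h) / norm h) \<le> ?b h"
    if h: "h \<noteq> 0" "norm h < min r (\<rho>0 / 192)" for h
  proof -
    let ?y = "x + h"
    have d: "dist ?y x = norm h" by (simp add: dist_norm)
    have "?y \<in> ball x r" using h by (simp add: dist_norm)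
    then have yg: "?y \<in> deep" using r S by blast
    have "?y \<noteq> x" "dist ?y x \<le> \<rho>0 / 192" using h d by auto
    then obtain \<pi> where \<pi>: "\<pi> permutes {..<Q}"
      "\<And>i c is z. i < Q \<Longrightarrow> length is \<le> k \<Longrightarrow> dist ?y z \<le> dist ?y x \<Longrightarrow>
        \<bar>partials is (\<lambda>z. (ps ?y ! i) z $ c) z - partials is (\<lambda>z. (ps x ! \<pi> i) z $ c) z\<bar>
          \<le> K1 * dist ?y x powr (real k + \<mu> - real (length is))"
      using pair_matching[OF yg xg] by metis
    have leny: "length (ps ?y) = Q" using length_ps[OF deepD(1)[OF yg]] .
    have rem0: "0 \<le> rem h" unfolding rem_def by (intro sum_nonneg) auto
    have le: "tdist j (jet j ?y) (?aff h) \<le> ?T * (K1 * norm h powr (real k + \<mu> - real j) + rem h)"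
      unfolding jet_def
    proof (rule tdist_map_le[OF leny len \<pi>(1)])
      show "0 \<le> K1 * norm h powr (real k + \<mu> - real j) + rem h" using K1_nonneg rem0 by simp
      fix i c and "is" :: "'n list" assume i: "i < Q" and l: "length is = j"
      have \<pi>i: "\<pi> i < Q" using permutes_in_image[OF \<pi>(1)] i by auto
      let ?f = "\<lambda>z. (ps ?y ! i) z $ c" and ?g = "\<lambda>z. (ps x ! \<pi> i) z $ c"
      let ?R = "partials is ?g (x + h) - partials is ?g x - (\<Sum>l\<in>UNIV. h $ l * partials (l # is) ?g x)"
      have "\<bar>partials is ?f ?y - partials is ?g ?y\<bar> \<le> K1 * norm h powr (real k + \<mu> - real j)"
        using \<pi>(2)[OF i, of "is" ?y c] l j d by simp
      moreover have "\<bar>?R\<bar> \<le> rem h"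
        unfolding rem_def
        using member_le_triple_sum[of "\<pi> i" Q "is" j "\<lambda>i is c. partials is (\<lambda>z. (ps x ! i) z $ c) (x + h)
          - partials is (\<lambda>z. (ps x ! i) z $ c) x - (\<Sum>l\<in>UNIV. h $ l * partials (l # is) (\<lambda>z. (ps x ! i) z $ c) x)" c]
          \<pi>i l by simp
      moreover have "derivative_tensor j (ps ?y ! i) ?y is $ c
          - tensor_affine (derivative_tensor j (ps x ! \<pi> i) x) (derivative_tensor (Suc j) (ps x ! \<pi> i) x) h is $ c
          = (partials is ?f ?y - partials is ?g ?y) + ?R"
        using l by (simp add: derivative_tensor_def tensor_affine_def)
      ultimately show "\<bar>derivative_tensor j (ps ?y ! i) ?y is $ c
          - tensor_affine (derivative_tensor j (ps x ! \<pi> i) x) (derivative_tensor (Suc j) (ps x ! \<pi> i) x) h is $ c\<bar>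
          \<le> K1 * norm h powr (real k + \<mu> - real j) + rem h"
        by linarith
    qed
    have "0 \<le> tdist j (jet j ?y) (?aff h)"
      by (rule qdist_nonneg) (simp add: jet_def len leny)
    then have "norm (tdist j (jet j ?y) (?aff h) / norm h) = tdist j (jet j ?y) (?aff h) / norm h" by simp
    also have "\<dots> \<le> ?T * (K1 * norm h powr (real k + \<mu> - real j) + rem h) / norm h"
      using le by (rule divide_right_mono) simp
    also have "norm h powr (real k + \<mu> - real j) = norm h powr (real k + \<mu> - real j - 1) * norm h"
      using h by (simp add: powr_diff)
    also have "?T * (K1 * (norm h powr (real k + \<mu> - real j - 1) * norm h) + rem h) / norm h = ?b h"
      using h by (simp add: field_simps)
    finally show ?thesis .
  qed
  have "\<forall>\<^sub>F h in at 0. norm (tdist j (jet j (x + h)) (?aff h) / norm h) \<le> ?b h"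
    unfolding eventually_at
    by (rule exI[of _ "min r (\<rho>0 / 192)"]) (use r \<rho>0 bound in auto)
  then have lim: "((\<lambda>h. tdist j (jet j (x + h)) (?aff h) / norm h) \<longlongrightarrow> 0) (at 0)"
    by (rule Lim_null_comparison[OF _ b0])
  show ?thesis
    unfolding has_qderiv_def
  proof (intro exI[of _ ?M] conjI)
    show "image_mset fst ?M = jet j x" "image_mset snd ?M = jet (Suc j) x"
      by (simp_all add: jet_def multiset.map_comp o_def)
    show "\<forall>A\<in>#jet (Suc j) x. A \<in> tensors (Suc j)" by (rule jet_props[OF xg])
    have "image_mset (\<lambda>(a, A). tensor_affine a A h) ?M = ?aff h" for h
      by (simp add: multiset.map_comp o_def)
    then show "((\<lambda>h. tdist j (jet j (x + h)) (image_mset (\<lambda>(a, A). tensor_affine a A h) ?M) / norm h) \<longlongrightarrow> 0) (at 0)"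
      using lim by simp
  qed
qed

lemma jet_continuous:
  assumes x: "x \<in> deep" and j: "j \<le> k" and \<epsilon>: "0 < \<epsilon>"
  obtains r where "0 < r" "\<And>y. y \<in> deep \<Longrightarrow> dist y x < r \<Longrightarrow> tdist j (jet j y) (jet j x) < \<epsilon>"
proof -
  let ?T = "tensor_const CARD('n) CARD('m) Q j"
  have len: "length (ps x) = Q" using length_ps[OF deepD(1)[OF x]] .
  have px: "poly_maps Q k (ps x)" by (rule maps[OF deepD(1)[OF x]])
  define rem where "rem y = (\<Sum>i<Q. \<Sum>is | length is = j. \<Sum>c\<in>UNIV.
      \<bar>partials is (\<lambda>z. (ps x ! i) z $ c) y - partials is (\<lambda>z. (ps x ! i) z $ c) x\<bar>)" for y
  let ?b = "\<lambda>y. ?T * (K1 * dist y x powr (real k + \<mu> - real j) + rem y)"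
  have p: "0 < real k + \<mu> - real j" using j \<mu> by linarith
  have "((\<lambda>y. dist y x powr (real k + \<mu> - real j)) \<longlongrightarrow> 0) (at x)"
    by (rule tendsto_zero_powrI[OF _ tendsto_const _ p]) (auto intro!: tendsto_eq_intros)
  moreover have "(rem \<longlongrightarrow> 0) (at x)"
    using partials_tensor_isCont[OF px, where j = j and x = x] unfolding isCont_def rem_def[symmetric]
    by (simp add: rem_def)
  ultimately have "(?b \<longlongrightarrow> ?T * (K1 * 0 + 0)) (at x)" by (intro tendsto_intros)
  then have "\<forall>\<^sub>F y in at x. ?b y < \<epsilon>" using \<epsilon> by (intro order_tendstoD) auto
  then obtain r where r: "0 < r" "\<And>y. y \<noteq> x \<Longrightarrow> dist y x < r \<Longrightarrow> ?b y < \<epsilon>"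
    unfolding eventually_at by auto
  show thesis
  proof (rule that[of "min r (\<rho>0 / 192)"])
    show "0 < min r (\<rho>0 / 192)" using r \<rho>0 by simp
    fix y assume y: "y \<in> deep" and d: "dist y x < min r (\<rho>0 / 192)"
    have leny: "length (ps y) = Q" using length_ps[OF deepD(1)[OF y]] .
    show "tdist j (jet j y) (jet j x) < \<epsilon>"
    proof (cases "y = x")
      case True
      have "tdist j (jet j x) (jet j x) \<le> ?T * 0"
        unfolding jet_def by (rule tdist_map_le[OF len len permutes_id]) auto
      then show ?thesis using True \<epsilon> by simp
    next
      case False
      have dd: "dist y x \<le> \<rho>0 / 192" using d by simp
      obtain \<pi> where \<pi>: "\<pi> permutes {..<Q}"
        "\<And>i c is z. i < Q \<Longrightarrow> length is \<le> k \<Longrightarrow> dist y z \<le> dist y x \<Longrightarrow>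
          \<bar>partials is (\<lambda>z. (ps y ! i) z $ c) z - partials is (\<lambda>z. (ps x ! \<pi> i) z $ c) z\<bar>
            \<le> K1 * dist y x powr (real k + \<mu> - real (length is))"
        using pair_matching[OF y x False dd] by metis
      have "tdist j (jet j y) (jet j x) \<le> ?b y"
        unfolding jet_def
      proof (rule tdist_map_le[OF leny len \<pi>(1)])
        show "0 \<le> K1 * dist y x powr (real k + \<mu> - real j) + rem y"
          using K1_nonneg by (auto simp: rem_def intro!: add_nonneg_nonneg sum_nonneg)
        fix i c and "is" :: "'n list" assume i: "i < Q" and l: "length is = j"
        have \<pi>i: "\<pi> i < Q" using permutes_in_image[OF \<pi>(1)] i by auto
        let ?f = "\<lambda>z. (ps y ! i) z $ c" and ?g = "\<lambda>z. (ps x ! \<pi> i) z $ c"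
        have "\<bar>partials is ?f y - partials is ?g y\<bar> \<le> K1 * dist y x powr (real k + \<mu> - real j)"
          using \<pi>(2)[OF i, of "is" y c] l j by simp
        moreover have "\<bar>partials is ?g y - partials is ?g x\<bar> \<le> rem y"
          unfolding rem_def
          using member_le_triple_sum[of "\<pi> i" Q "is" j "\<lambda>i is c. partials is (\<lambda>z. (ps x ! i) z $ c) y
            - partials is (\<lambda>z. (ps x ! i) z $ c) x" c] \<pi>i l by simp
        ultimately show "\<bar>derivative_tensor j (ps y ! i) y is $ c - derivative_tensor j (ps x ! \<pi> i) x is $ c\<bar>
            \<le> K1 * dist y x powr (real k + \<mu> - real j) + rem y"
          using l by (simp add: derivative_tensor_def)
      qed
      also have "\<dots> < \<epsilon>" using r(2)[OF False] d by simp
      finally show ?thesis .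
    qed
  qed
qed

text \<open>
  The derivatives of order \<open>k\<close> of a polynomial of degree \<open>k\<close> are constant. Hence, for close points, the jets
  at \<open>x\<close> and \<open>y\<close> can be compared at the single point \<open>x\<close>.
\<close>

lemma jet_top_holder:
  assumes x: "x \<in> deep" and y: "y \<in> deep" and xy: "x \<noteq> y"
  shows "tdist k (jet k x) (jet k y) / dist x y powr \<mu>
    \<le> tensor_const CARD('n) CARD('m) Q k * (K1 + 2 * (sup_const CARD('n) k \<rho>0 C D * M) * (192 / \<rho>0))"
proof -
  let ?T = "tensor_const CARD('n) CARD('m) Q k"
  have len: "length (ps x) = Q" "length (ps y) = Q" using length_ps x y deepD(1) by auto
  have T: "0 \<le> ?T" by (simp add: tensor_const_def)
  let ?K2 = "sup_const CARD('n) k \<rho>0 C D * M"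
  have K2: "0 \<le> ?K2" using C D_pos M \<rho>0 by (simp add: sup_const_def)
  have dp: "0 < dist x y powr \<mu>" using xy by simp
  have "tdist k (jet k x) (jet k y) \<le> ?T * ((K1 + 2 * ?K2 * (192 / \<rho>0)) * dist x y powr \<mu>)"
  proof (cases "dist x y \<le> \<rho>0 / 192")
    case True
    obtain \<pi> where \<pi>: "\<pi> permutes {..<Q}"
      "\<And>i c is z. i < Q \<Longrightarrow> length is \<le> k \<Longrightarrow> dist x z \<le> dist x y \<Longrightarrow>
        \<bar>partials is (\<lambda>z. (ps x ! i) z $ c) z - partials is (\<lambda>z. (ps y ! \<pi> i) z $ c) z\<bar>
          \<le> K1 * dist x y powr (real k + \<mu> - real (length is))"
      using pair_matching[OF x y xy True] by metis
    have "tdist k (jet k x) (jet k y) \<le> ?T * (K1 * dist x y powr \<mu>)"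
      unfolding jet_def
    proof (rule tdist_map_le[OF len \<pi>(1)])
      show "0 \<le> K1 * dist x y powr \<mu>" using K1_nonneg by simp
      fix i c and "is" :: "'n list" assume i: "i < Q" and l: "length is = k"
      have \<pi>i: "\<pi> i < Q" using permutes_in_image[OF \<pi>(1)] i by auto
      have "(\<lambda>z. (ps y ! \<pi> i) z $ c) \<in> poly_fun k"
        using maps[OF deepD(1)[OF y]] len \<pi>i by (auto simp: poly_maps_def)
      then have "partials is (\<lambda>z. (ps y ! \<pi> i) z $ c) y = partials is (\<lambda>z. (ps y ! \<pi> i) z $ c) x"
        using l by (rule partials_top_const)
      then show "\<bar>derivative_tensor k (ps x ! i) x is $ c - derivative_tensor k (ps y ! \<pi> i) y is $ c\<bar>
          \<le> K1 * dist x y powr \<mu>"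
        using \<pi>(2)[OF i, of "is" x c] l by (simp add: derivative_tensor_def)
    qed
    also have "\<dots> \<le> ?T * ((K1 + 2 * ?K2 * (192 / \<rho>0)) * dist x y powr \<mu>)"
      using T K2 \<rho>0 dp by (intro mult_left_mono mult_right_mono) auto
    finally show ?thesis .
  next
    case False
    have "tdist k (jet k x) (jet k y) \<le> ?T * (2 * ?K2)"
      unfolding jet_def
    proof (rule tdist_map_le[OF len permutes_id])
      show "0 \<le> 2 * ?K2" using K2 by simp
      fix i c and "is" :: "'n list" assume i: "i < Q" and l: "length is = k"
      show "\<bar>derivative_tensor k (ps x ! i) x is $ c - derivative_tensor k (ps y ! id i) y is $ c\<bar> \<le> 2 * ?K2"
        using partials_bounded[OF x i, of "is" c] partials_bounded[OF y i, of "is" c] l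
        by (simp add: derivative_tensor_def)
    qed
    also have "\<dots> \<le> ?T * ((K1 + 2 * ?K2 * (192 / \<rho>0)) * dist x y powr \<mu>)"
    proof (rule mult_left_mono[OF _ T])
      have r: "0 < \<rho>0 / 192" "\<rho>0 / 192 \<le> 1" using \<rho>0 by auto
      have "\<rho>0 / 192 = (\<rho>0 / 192) powr 1" using r by simp
      also have "\<dots> \<le> (\<rho>0 / 192) powr \<mu>" using r \<mu> by (intro powr_mono') auto
      also have "\<dots> \<le> dist x y powr \<mu>" using r \<mu> False by (intro powr_mono2) auto
      finally have "1 \<le> (192 / \<rho>0) * dist x y powr \<mu>" using r \<rho>0 by (simp add: field_simps)
      then have "2 * ?K2 * 1 \<le> 2 * ?K2 * ((192 / \<rho>0) * dist x y powr \<mu>)" using K2 by (intro mult_left_mono) auto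
      moreover have "0 \<le> K1 * dist x y powr \<mu>" using K1_nonneg by simp
      ultimately show "2 * ?K2 \<le> (K1 + 2 * ?K2 * (192 / \<rho>0)) * dist x y powr \<mu>" by (simp add: algebra_simps)
    qed
    finally show ?thesis .
  qed
  then show ?thesis using dp by (simp add: pos_divide_le_eq mult.assoc)
qed

lemma jet_bounded:
  assumes x: "x \<in> deep" and j: "j \<le> k"
  shows "qabs (tensor_norm j) (jet j x) \<le> tensor_const CARD('n) CARD('m) Q j * (sup_const CARD('n) k \<rho>0 C D * M)"
proof -
  have len: "length (ps x) = Q" using length_ps[OF deepD(1)[OF x]] .
  let ?zs = "replicate Q (\<lambda>_. 0) :: (real ^ 'n \<Rightarrow> real ^ 'm) list"
  let ?K2 = "sup_const CARD('n) k \<rho>0 C D * M"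
  have K2: "0 \<le> ?K2" using C D_pos M \<rho>0 by (simp add: sup_const_def)
  have "tdist j (mset (map (\<lambda>p. derivative_tensor j p x) (ps x))) (mset (map (\<lambda>_. 0) ?zs))
      \<le> tensor_const CARD('n) CARD('m) Q j * ?K2"
  proof (rule tdist_map_le[OF len _ permutes_id K2])
    fix i c and "is" :: "'n list" assume i: "i < Q" and l: "length is = j"
    then show "\<bar>derivative_tensor j (ps x ! i) x is $ c - 0 is $ c\<bar> \<le> ?K2"
      using partials_bounded[OF x i, of "is" c] j by (simp add: derivative_tensor_def)
  qed simp
  moreover have "size (jet j x) = Q" by (rule jet_props[OF x])
  ultimately show ?thesis by (simp add: qabs_def jet_def)
qed

theorem holder_estimate:
  assumes S: "open S" "closure S \<subseteq> deep"
  shows "(\<lambda>x. tuple_at (ps x) x) \<in> holder_space Q k \<mu> S"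
    "holder_norm Q k \<mu> S (\<lambda>x. tuple_at (ps x) x)
      \<le> ennreal (holder_const CARD('n) CARD('m) k Q \<rho>0 C D e1 * M)"
proof -
  let ?T = "tensor_const CARD('n) CARD('m) Q"
  have Sg: "S \<subseteq> deep" using S closure_subset by blast
  let ?K2 = "sup_const CARD('n) k \<rho>0 C D * M"
  have K2: "0 \<le> ?K2" using C D_pos M \<rho>0 by (simp add: sup_const_def)
  have T: "0 \<le> ?T j" for j by (simp add: tensor_const_def)
  let ?H = "?T k * (K1 + 2 * ?K2 * (192 / \<rho>0))"
  have H: "0 \<le> ?H" using T K1_nonneg K2 \<rho>0 by simp
  have semi: "holder_seminorm k \<mu> S (jet k) \<le> ennreal ?H"
    unfolding holder_seminorm_def
    by (rule SUP_least) (use jet_top_holder Sg in \<open>auto intro!: ennreal_leI\<close>)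
  have jets: "jet \<in> holder_jets Q k \<mu> S (\<lambda>x. tuple_at (ps x) x)"
    unfolding holder_jets_def
  proof (intro CollectI conjI ballI allI impI)
    show "jet 0 x = image_mset tensor0 (tuple_at (ps x) x)" if "x \<in> closure S" for x
      using jet_props(3) that S by blast
    show "size (jet j x) = Q" if "j \<le> k" "x \<in> closure S" for j x
      using jet_props(1) that S by blast
    show "T \<in> tensors j" if "j \<le> k" "x \<in> closure S" "T \<in># jet j x" for j x T
      using jet_props(2) that S by blast
    show "has_qderiv j (jet j) x (jet (Suc j) x)" if "j < k" "x \<in> S" for j x
      by (rule jet_has_qderiv[OF S(1) Sg that(2,1)])
    show "\<exists>r>0. \<forall>y\<in>closure S. dist y x < r \<longrightarrow> tdist j (jet j y) (jet j x) < \<epsilon>"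
      if jx: "j \<le> k" "x \<in> closure S" "0 < \<epsilon>" for j x \<epsilon>
    proof -
      have xg: "x \<in> deep" using jx S by blast
      show ?thesis by (rule jet_continuous[OF xg jx(1,3)]) (use S in blast)
    qed
    show "holder_seminorm k \<mu> S (jet k) < \<infinity>"
      using semi by (simp add: le_less_trans)
  qed
  then show "(\<lambda>x. tuple_at (ps x) x) \<in> holder_space Q k \<mu> S" by (auto simp: holder_space_def)
  have "holder_norm Q k \<mu> S (\<lambda>x. tuple_at (ps x) x)
      \<le> (\<Sum>j\<le>k. SUP x\<in>S. ennreal (qabs (tensor_norm j) (jet j x))) + holder_seminorm k \<mu> S (jet k)"
    unfolding holder_norm_def by (rule INF_lower[OF jets])
  also have "\<dots> \<le> (\<Sum>j\<le>k. ennreal (?T j * ?K2)) + ennreal ?H"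
  proof (intro add_mono sum_mono semi SUP_least ennreal_leI)
    show "qabs (tensor_norm j) (jet j x) \<le> ?T j * ?K2" if "j \<in> {..k}" "x \<in> S" for j x
      using jet_bounded[of x j] that Sg by auto
  qed
  also have "\<dots> = ennreal ((\<Sum>j\<le>k. ?T j * ?K2) + ?H)"
    using T K2 H by (subst sum_ennreal) (auto simp: ennreal_plus[symmetric] sum_nonneg simp del: ennreal_plus)
  also have "(\<Sum>j\<le>k. ?T j * ?K2) + ?H = holder_const CARD('n) CARD('m) k Q \<rho>0 C D e1 * M"
  proof -
    have "(\<Sum>j\<le>k. ?T j * ?K2) = (\<Sum>j\<le>k. ?T j * sup_const CARD('n) k \<rho>0 C D) * M"
      by (simp only: sum_distrib_right mult.assoc)
    moreover have "?H = ?T k * (pair_const k C D e1 + 2 * sup_const CARD('n) k \<rho>0 C D * (192 / \<rho>0)) * M"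
      by (simp only: distrib_right distrib_left mult_ac)
    ultimately show ?thesis by (simp only: holder_const_def distrib_right)
  qed
  finally show "holder_norm Q k \<mu> S (\<lambda>x. tuple_at (ps x) x)
      \<le> ennreal (holder_const CARD('n) CARD('m) k Q \<rho>0 C D e1 * M)" .
qed

end

section \<open>Regularity of the multivalued function\<close>

lemma qpoly_list:
  assumes "R \<in> qpoly Q k" obtains vs where "poly_maps Q k vs" "R = tuple_at vs"
proof -
  obtain Ms where Ms: "size Ms = Q" "\<forall>p\<in>#Ms. \<forall>i. (\<lambda>x. p x $ i) \<in> poly_fun k"
    "R = (\<lambda>x. image_mset (\<lambda>p. p x) Ms)"
    using assms unfolding qpoly_def by blast
  obtain vs where vs: "mset vs = Ms" using ex_mset by blast
  show thesis
  proof (rule that[of vs])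
    show "poly_maps Q k vs" using Ms(1,2) vs by (auto simp: poly_maps_def)
    show "R = tuple_at vs" using Ms(3) vs by auto
  qed
qed

lemma deviation_from_zero:
  assumes "\<And>z. z \<in> S \<Longrightarrow> size (u z) = Q"
  shows "deviation q u (replicate Q (\<lambda>_. 0)) S = (\<integral>\<^sup>+z\<in>S. ennreal (qabs norm (u z) powr q) \<partial>lebesgue)"
  by (rule nn_integral_cong) (use assms in \<open>auto simp: indicator_def qabs_def\<close>)

text \<open>
  On a ball inside \<open>W\<close> the deviation from a bounded polynomial is bounded by the data; this fixes
  the amplitude \<open>M\<close> of the locale.
\<close>

lemma base_bound:
  fixes u :: "real ^ 'n \<Rightarrow> (real ^ 'm) multiset"
  assumes vs: "poly_maps Q k vs" and \<Omega>: "open \<Omega>" and u: "qmeasurable_on Q \<Omega> u"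
    and su: "\<And>x. x \<in> \<Omega> \<Longrightarrow> size (u x) = Q" and b: "ball x r \<subseteq> W" "W \<subseteq> \<Omega>" and r: "r \<le> 1"
    and q: "1 \<le> q" and \<beta>: "0 \<le> \<beta>" and I: "0 \<le> I"
    and bound: "\<And>z. z \<in> \<Omega> \<Longrightarrow> qabs norm (tuple_at vs z) \<le> \<beta>"
    and int: "(\<integral>\<^sup>+z\<in>W. ennreal (qabs norm (u z) powr q) \<partial>lebesgue) \<le> ennreal I"
  shows "deviation q u vs (ball x r)
    \<le> ennreal ((2 * (2 + unit_ball_vol (real CARD('n))) * (\<beta> powr q + I) powr (1 / q)) powr q)"
proof -
  let ?\<omega> = "unit_ball_vol (real CARD('n))"
  let ?N = "(\<beta> powr q + I) powr (1 / q)"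
  have N: "?N powr q = \<beta> powr q + I" using q I by (simp add: powr_powr)
  have len: "length vs = Q" using vs by (simp add: poly_maps_def)
  have vol: "measure lebesgue (ball x r) \<le> ?\<omega>"
  proof (cases "0 \<le> r")
    case True
    have "?\<omega> * r ^ CARD('n) \<le> ?\<omega> * 1" using True r by (intro mult_left_mono power_le_one) auto
    then show ?thesis using True by (simp add: content_ball)
  next
    case False
    then have empty: "ball x r = {}" by auto
    show ?thesis unfolding empty by simp
  qed
  have bO: "ball x r \<subseteq> \<Omega>" by (rule subset_trans[OF b])
  have sz: "size (u z) = Q" if "z \<in> ball x r" for z using su bO that by blast
  have "deviation q u (replicate Q (\<lambda>_. 0)) (ball x r)
      = (\<integral>\<^sup>+z\<in>ball x r. ennreal (qabs norm (u z) powr q) \<partial>lebesgue)"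
    by (rule deviation_from_zero) (rule sz)
  also have "\<dots> \<le> (\<integral>\<^sup>+z\<in>W. ennreal (qabs norm (u z) powr q) \<partial>lebesgue)"
    by (intro nn_integral_mono mult_left_mono) (use b in \<open>auto simp: indicator_def\<close>)
  also note int
  finally have d0: "deviation q u (replicate Q (\<lambda>_. 0)) (ball x r) \<le> ennreal I" .
  have "deviation q u vs (ball x r) \<le> ennreal (2 powr q) *
      (deviation q u (replicate Q (\<lambda>_. 0)) (ball x r) + ennreal (\<beta> powr q * measure lebesgue (ball x r)))"
  proof (rule deviation_change[OF vs poly_maps_zero \<Omega> u su bO])
    fix z assume "z \<in> ball x r"
    then show "G (tuple_at vs z) (tuple_at (replicate Q (\<lambda>_. 0)) z) \<le> \<beta>"
      using bound[of z] bO len by (auto simp: qabs_def)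
  qed (use q \<beta> in auto)
  also have "\<dots> \<le> ennreal (2 powr q) * (ennreal I + ennreal (\<beta> powr q * ?\<omega>))"
    using vol by (intro mult_left_mono add_mono d0 ennreal_leI) auto
  also have "\<dots> = ennreal (2 powr q * (I + \<beta> powr q * ?\<omega>))"
    using I by (simp flip: ennreal_plus ennreal_mult)
  also have "2 powr q * (I + \<beta> powr q * ?\<omega>) \<le> 2 powr q * ((1 + ?\<omega>) * ?N powr q)"
    unfolding N using I by (intro mult_left_mono) (auto simp: algebra_simps)
  also have "\<dots> \<le> 2 powr q * ((1 + (1 + ?\<omega>)) * ?N) powr q"
    using q by (intro mult_left_mono absorb_factor) auto
  also have "\<dots> = (2 * (2 + ?\<omega>) * ?N) powr q"
  proof -
    have "1 + (1 + ?\<omega>) = 2 + ?\<omega>" by simp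
    then show ?thesis by (simp only: powr_mult)
  qed
  finally show ?thesis by (simp add: ennreal_leI)
qed

text \<open>
  The radius \<open>\<rho>0\<close> is chosen such that the balls of radius \<open>2 * \<rho>0\<close> about points of the closure of \<open>\<Omega>'\<close> stay
  in \<open>\<Omega>''\<close>, and such that the first hypothesis applies at radius \<open>\<rho>0\<close>. The constants \<open>B\<close>, \<open>e1\<close>, \<open>D\<close>, \<open>K\<close>
  involve neither \<open>\<mu>\<close> nor the domains, which is what allows to choose \<open>K\<close> before \<open>\<mu>\<close> in the theorem.
\<close>

lemma regularity_core:
  fixes k Q :: nat and q \<beta>1 \<beta>2 \<epsilon> d \<mu> \<beta> C0 :: real
    and \<Omega> \<Omega>' \<Omega>'' \<Gamma> :: "(real ^ 'n) set" and u :: "real ^ 'n \<Rightarrow> (real ^ 'm) multiset" and P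
  defines "n \<equiv> CARD('n)" and "m \<equiv> CARD('m)" and "\<rho>0 \<equiv> min \<epsilon> (d / 2)" and "B \<equiv> max \<beta>1 \<beta>2"
  defines "e1 \<equiv> real n + real k * q + q"
  defines "D \<equiv> decay_const n m k Q B \<rho>0 C0 e1"
  defines "K \<equiv> holder_const n m k Q \<rho>0 C0 D e1 * (2 * (2 + unit_ball_vol (real n)))"
  assumes q: "1 \<le> q" and \<beta>12: "0 < \<beta>1" "0 < \<beta>2" and \<epsilon>: "0 < \<epsilon>" "\<epsilon> < 1/4" and \<mu>: "0 < \<mu>" "\<mu> < 1" and C0: "0 < C0"
    and matched: "\<And>(vs :: (real ^ 'n \<Rightarrow> real ^ 'm) list) rs x0 s a.
      poly_maps Q k vs \<Longrightarrow> poly_maps Q k rs \<Longrightarrow> open \<Omega> \<Longrightarrow> qmeasurable_on Q \<Omega> u \<Longrightarrow>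
      (\<And>x. x \<in> \<Omega> \<Longrightarrow> size (u x) = Q) \<Longrightarrow> ball x0 (2 * s) \<subseteq> \<Omega> \<Longrightarrow> 0 < s \<Longrightarrow> 0 < a \<Longrightarrow> 1 \<le> q \<Longrightarrow>
      deviation q u vs (ball x0 (2 * s)) \<le> ennreal (a powr q * s ^ CARD('n)) \<Longrightarrow>
      deviation q u rs (ball x0 (2 * s)) \<le> ennreal (a powr q * s ^ CARD('n)) \<Longrightarrow>
      matched_within Q k vs rs x0 s (C0 * a)"
    and \<Omega>: "open \<Omega>" and su: "\<forall>x\<in>\<Omega>. size (u x) = Q" and u: "qmeasurable_on Q \<Omega> u"
    and int: "(\<integral>\<^sup>+x\<in>\<Omega>''. ennreal (qabs norm (u x) powr q) \<partial>lebesgue) < \<infinity>"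
    and \<Gamma>: "closed \<Gamma>" "\<Gamma> \<inter> closure \<Omega>'' \<noteq> {}"
    and \<Omega>': "open \<Omega>'" "compact (closure \<Omega>')" "closure \<Omega>' \<subseteq> \<Omega>''" "\<Omega>' \<noteq> {}"
    and \<Omega>'': "open \<Omega>''" "compact (closure \<Omega>'')" "closure \<Omega>'' \<subseteq> \<Omega>"
    and d: "setdist \<Omega>' (- \<Omega>'') = d" and \<beta>: "0 < \<beta>"
    and on: "\<forall>x0\<in>\<Gamma> \<inter> closure \<Omega>''.
         P x0 \<in> qpoly Q k \<and> (\<forall>x\<in>\<Omega>. qabs norm (P x0 x) \<le> \<beta>) \<and>
         (\<forall>\<sigma> \<rho>. 0 < \<sigma> \<and> \<sigma> \<le> \<rho> / 2 \<and> \<rho> / 2 \<le> \<epsilon> / 2 \<longrightarrow>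
            ennreal (\<sigma> powr (- real CARD('n) - real k * q)) *
              (\<integral>\<^sup>+x\<in>ball x0 \<sigma> \<inter> \<Omega>. ennreal (G (u x) (P x0 x) powr q) \<partial>lebesgue)
            \<le> ennreal (\<beta>1 * (\<sigma> / \<rho>) powr (q * \<mu>) * \<rho> powr (- real CARD('n) - real k * q)) *
              (\<integral>\<^sup>+x\<in>ball x0 \<rho> \<inter> \<Omega>. ennreal (G (u x) (P x0 x) powr q) \<partial>lebesgue))"
    and off: "\<forall>x0\<in>closure \<Omega>'' - \<Gamma>.
         P x0 \<in> qpoly Q k \<and>
         (\<forall>y\<in>\<Gamma> \<inter> closure \<Omega>''. \<forall>\<sigma> \<rho>.
            0 < \<sigma> \<and> \<sigma> \<le> \<rho> / 2 \<and> \<rho> / 2 < 1/2 * min (1/4) (infdist x0 \<Gamma>) \<longrightarrow>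
            ennreal (\<sigma> powr (- real CARD('n) - real k * q)) *
              (\<integral>\<^sup>+x\<in>ball x0 \<sigma> \<inter> \<Omega>. ennreal (G (u x) (P x0 x) powr q) \<partial>lebesgue)
            \<le> ennreal (\<beta>2 * (\<sigma> / \<rho>) powr (q * \<mu>) * \<rho> powr (- real CARD('n) - real k * q)) *
              (\<integral>\<^sup>+x\<in>ball x0 \<rho> \<inter> \<Omega>. ennreal (G (u x) (P y x) powr q) \<partial>lebesgue))"
  shows "\<exists>v. (AE x\<in>\<Omega>' in lebesgue. v x = u x) \<and> v \<in> holder_space Q k \<mu> \<Omega>' \<and>
    holder_norm Q k \<mu> \<Omega>' v \<le> ennreal ((\<bar>K\<bar> + 1) * (\<beta> powr q +
      enn2real (\<integral>\<^sup>+x\<in>\<Omega>''. ennreal (qabs norm (u x) powr q) \<partial>lebesgue)) powr (1 / q))"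
proof -
  define I where "I = enn2real (\<integral>\<^sup>+x\<in>\<Omega>''. ennreal (qabs norm (u x) powr q) \<partial>lebesgue)"
  have I: "0 \<le> I" "(\<integral>\<^sup>+x\<in>\<Omega>''. ennreal (qabs norm (u x) powr q) \<partial>lebesgue) \<le> ennreal I"
    using int by (auto simp: I_def)
  define N where "N = (\<beta> powr q + I) powr (1 / q)"
  define M where "M = 2 * (2 + unit_ball_vol (real n)) * N"
  have "0 < \<beta> powr q + I" using \<beta> I by (simp add: add_pos_nonneg)
  then have N: "0 < N" by (simp add: N_def)
  have \<omega>: "0 < 2 * (2 + unit_ball_vol (real n))" by (simp add: add_pos_nonneg)
  have M: "0 < M" using N \<omega> by (simp add: M_def)
  have sub: "\<Omega>'' \<subseteq> \<Omega>" using \<Omega>''(3) closure_subset by blast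
  have "- \<Omega>'' \<noteq> {}"
    using \<Omega>''(2) by (metis Compl_empty_eq Compl_UNIV_eq closure_UNIV compact_imp_bounded double_complement not_bounded_UNIV)
  have d': "setdist (closure \<Omega>') (- \<Omega>'') = d" using d by simp
  have "0 < setdist (closure \<Omega>') (- \<Omega>'')"
    using \<Omega>' \<Omega>'' \<open>- \<Omega>'' \<noteq> {}\<close> by (subst setdist_gt_0_compact_closed) (auto simp: closed_Compl)
  then have d0: "0 < d" using d' by simp
  have \<rho>0: "0 < \<rho>0" "\<rho>0 \<le> 1/4" "\<rho>0 \<le> \<epsilon>" "2 * \<rho>0 \<le> d" using d0 \<epsilon> by (auto simp: \<rho>0_def)
  have balls: "ball x (2 * \<rho>0) \<subseteq> \<Omega>''" if x: "x \<in> closure \<Omega>'" for x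
  proof
    fix z assume z: "z \<in> ball x (2 * \<rho>0)"
    show "z \<in> \<Omega>''"
    proof (rule ccontr)
      assume "z \<notin> \<Omega>''"
      then have "setdist (closure \<Omega>') (- \<Omega>'') \<le> dist x z" using x by (intro setdist_le_dist) auto
      then show False using z d' \<rho>0 by simp
    qed
  qed
  have Pq: "P x \<in> qpoly Q k" if "x \<in> closure \<Omega>''" for x using on off that by blast
  define ps where "ps x = (SOME vs. poly_maps Q k vs \<and> P x = tuple_at vs)" for x
  have ps: "poly_maps Q k (ps x)" "P x = tuple_at (ps x)" if "x \<in> closure \<Omega>''" for x
  proof -
    have "\<exists>vs. poly_maps Q k vs \<and> P x = tuple_at vs" using qpoly_list[OF Pq[OF that]] by metis
    then have "poly_maps Q k (ps x) \<and> P x = tuple_at (ps x)" unfolding ps_def by (rule someI_ex)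
    then show "poly_maps Q k (ps x)" "P x = tuple_at (ps x)" by auto
  qed
  have neg: "- real CARD('n) - real k * q = - (real CARD('n) + real k * q)" by simp
  have inter: "S \<inter> \<Omega> = S" if "S \<subseteq> \<Omega>" for S using that by blast
  interpret approximation_data k Q q \<mu> "real n + real k * q + q * \<mu>" e1 B \<rho>0 M C0 D \<Omega> \<Omega>'' \<Gamma> u ps
  proof
    show "real n + real k * q + q * \<mu> = real CARD('n) + real k * q + q * \<mu>"
      "e1 = real CARD('n) + real k * q + q" "D = decay_const CARD('n) CARD('m) k Q B \<rho>0 C0 e1"
      by (simp_all add: n_def m_def e1_def D_def)
    show "0 \<le> B" using \<beta>12 by (simp add: B_def)
    show "size (u x) = Q" if "x \<in> \<Omega>" for x using su that by blast
    show "poly_maps Q k (ps x)" if "x \<in> closure \<Omega>''" for x by (rule ps(1)[OF that])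
    show "deviation q u (ps y) (ball x r) \<le> ennreal (M powr q)"
      if y: "y \<in> \<Gamma> \<inter> closure \<Omega>''" and b: "ball x r \<subseteq> \<Omega>''" and r: "r \<le> 1" for y x r
      unfolding M_def N_def n_def
    proof (rule base_bound[OF _ \<Omega> u _ b sub r q _ I(1) _ I(2)])
      have yc: "y \<in> closure \<Omega>''" using y by simp
      show "poly_maps Q k (ps y)" by (rule ps(1)[OF yc])
      show "qabs norm (tuple_at (ps y) z) \<le> \<beta>" if "z \<in> \<Omega>" for z
        using on y that unfolding ps(2)[OF yc, symmetric] by (metis (no_types, lifting) ps(2)[OF yc])
    qed (use su \<beta> in auto)
    show "deviation q u (replicate Q (\<lambda>_. 0)) (ball x r) \<le> ennreal (M powr q)"
      if b: "ball x r \<subseteq> \<Omega>''" and r: "r \<le> 1" for x r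
    proof -
      have "size (u z) = Q" if "z \<in> ball x r" for z using su b sub that by blast
      then have "deviation q u (replicate Q (\<lambda>_. 0)) (ball x r)
          = (\<integral>\<^sup>+z\<in>ball x r. ennreal (qabs norm (u z) powr q) \<partial>lebesgue)"
        by (rule deviation_from_zero)
      also have "(\<integral>\<^sup>+z\<in>ball x r. ennreal (qabs norm (u z) powr q) \<partial>lebesgue)
          \<le> (\<integral>\<^sup>+z\<in>\<Omega>''. ennreal (qabs norm (u z) powr q) \<partial>lebesgue)"
        by (intro nn_integral_mono mult_left_mono) (use b in \<open>auto simp: indicator_def\<close>)
      also have "\<dots> \<le> ennreal I" by (rule I(2))
      also have "I \<le> M powr q"
      proof -
        have "I \<le> N powr q" using I q by (simp add: N_def powr_powr)
        also have "\<dots> \<le> M powr q"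
        proof (rule powr_mono2)
          have \<omega>1: "0 \<le> unit_ball_vol (real n)" by simp
          have "1 * N \<le> 2 * (2 + unit_ball_vol (real n)) * N"
            by (rule mult_right_mono) (use N \<omega>1 in \<open>simp_all\<close>)
          then show "N \<le> M" by (simp add: M_def)
        qed (use N q in auto)
        finally show ?thesis .
      qed
      finally show ?thesis by (simp add: ennreal_leI)
    qed
    show "ennreal (\<sigma> powr (- (real CARD('n) + real k * q))) * deviation q u (ps y) (ball y \<sigma>)
      \<le> ennreal (B * (\<sigma> / \<rho>) powr (q * \<mu>) * \<rho> powr (- (real CARD('n) + real k * q)))
        * deviation q u (ps y) (ball y \<rho>)"
      if y: "y \<in> \<Gamma> \<inter> closure \<Omega>''" and \<sigma>: "0 < \<sigma>" "\<sigma> \<le> \<rho> / 2" and \<rho>: "\<rho> \<le> \<rho>0" and b: "ball y \<rho> \<subseteq> \<Omega>" for y \<sigma> \<rho>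
    proof -
      have "ball y \<sigma> \<subseteq> ball y \<rho>" by (rule subset_ball) (use \<sigma> in linarith)
      then have b': "ball y \<sigma> \<subseteq> \<Omega>" using b by blast
      have "0 < \<sigma> \<and> \<sigma> \<le> \<rho> / 2 \<and> \<rho> / 2 \<le> \<epsilon> / 2" using \<sigma> \<rho> \<rho>0 by auto
      with on y have "ennreal (\<sigma> powr (- real CARD('n) - real k * q)) *
              (\<integral>\<^sup>+x\<in>ball y \<sigma> \<inter> \<Omega>. ennreal (G (u x) (P y x) powr q) \<partial>lebesgue)
            \<le> ennreal (\<beta>1 * (\<sigma> / \<rho>) powr (q * \<mu>) * \<rho> powr (- real CARD('n) - real k * q)) *
              (\<integral>\<^sup>+x\<in>ball y \<rho> \<inter> \<Omega>. ennreal (G (u x) (P y x) powr q) \<partial>lebesgue)" by blast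
      then have "ennreal (\<sigma> powr (- (real CARD('n) + real k * q))) * deviation q u (ps y) (ball y \<sigma>)
        \<le> ennreal (\<beta>1 * (\<sigma> / \<rho>) powr (q * \<mu>) * \<rho> powr (- (real CARD('n) + real k * q))) * deviation q u (ps y) (ball y \<rho>)"
        using ps(2)[of y] y unfolding neg inter[OF b] inter[OF b'] by simp
      also have "\<dots> \<le> ennreal (B * (\<sigma> / \<rho>) powr (q * \<mu>) * \<rho> powr (- (real CARD('n) + real k * q))) * deviation q u (ps y) (ball y \<rho>)"
        by (intro mult_right_mono ennreal_leI) (auto simp: B_def)
      finally show ?thesis .
    qed
    show "ennreal (\<sigma> powr (- (real CARD('n) + real k * q))) * deviation q u (ps x) (ball x \<sigma>)
      \<le> ennreal (B * (\<sigma> / \<rho>) powr (q * \<mu>) * \<rho> powr (- (real CARD('n) + real k * q)))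
        * deviation q u (ps y) (ball x \<rho>)"
      if x: "x \<in> closure \<Omega>'' - \<Gamma>" and y: "y \<in> \<Gamma> \<inter> closure \<Omega>''" and \<sigma>: "0 < \<sigma>" "\<sigma> \<le> \<rho> / 2"
        and \<rho>: "\<rho> < min (1/4) (infdist x \<Gamma>)" and b: "ball x \<rho> \<subseteq> \<Omega>" for x y \<sigma> \<rho>
    proof -
      have "ball x \<sigma> \<subseteq> ball x \<rho>" by (rule subset_ball) (use \<sigma> in linarith)
      then have b': "ball x \<sigma> \<subseteq> \<Omega>" using b by blast
      have "0 < \<sigma> \<and> \<sigma> \<le> \<rho> / 2 \<and> \<rho> / 2 < 1/2 * min (1/4) (infdist x \<Gamma>)" using \<sigma> \<rho> by auto
      with off x y have "ennreal (\<sigma> powr (- real CARD('n) - real k * q)) *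
              (\<integral>\<^sup>+z\<in>ball x \<sigma> \<inter> \<Omega>. ennreal (G (u z) (P x z) powr q) \<partial>lebesgue)
            \<le> ennreal (\<beta>2 * (\<sigma> / \<rho>) powr (q * \<mu>) * \<rho> powr (- real CARD('n) - real k * q)) *
              (\<integral>\<^sup>+z\<in>ball x \<rho> \<inter> \<Omega>. ennreal (G (u z) (P y z) powr q) \<partial>lebesgue)" by blast
      then have "ennreal (\<sigma> powr (- (real CARD('n) + real k * q))) * deviation q u (ps x) (ball x \<sigma>)
        \<le> ennreal (\<beta>2 * (\<sigma> / \<rho>) powr (q * \<mu>) * \<rho> powr (- (real CARD('n) + real k * q))) * deviation q u (ps y) (ball x \<rho>)"
        using ps(2)[of y] ps(2)[of x] x y unfolding neg inter[OF b] inter[OF b'] by simp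
      also have "\<dots> \<le> ennreal (B * (\<sigma> / \<rho>) powr (q * \<mu>) * \<rho> powr (- (real CARD('n) + real k * q))) * deviation q u (ps y) (ball x \<rho>)"
        by (intro mult_right_mono ennreal_leI) (auto simp: B_def)
      finally show ?thesis .
    qed
    show "matched_within Q k vs rs x s (C0 * a)"
      if "poly_maps Q k vs" "poly_maps Q k rs" "ball x (2 * s) \<subseteq> \<Omega>" "0 < s" "0 < a"
        "deviation q u vs (ball x (2 * s)) \<le> ennreal (a powr q * s ^ CARD('n))"
        "deviation q u rs (ball x (2 * s)) \<le> ennreal (a powr q * s ^ CARD('n))" for vs rs x s a
      by (rule matched[OF that(1,2) \<Omega> u _ that(3-5) q that(6,7)]) (use su in blast)
  qed fact+
  have cl: "closure \<Omega>' \<subseteq> deep"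
    using balls \<Omega>'(3) closure_subset[of \<Omega>''] by (auto simp: deep_def)
  obtain Z where Z: "negligible Z"
    "\<And>x. x \<in> closure \<Omega>'' \<Longrightarrow> ball x (2 * \<rho>0) \<subseteq> \<Omega>'' \<Longrightarrow> x \<notin> Z \<Longrightarrow> tuple_at (ps x) x = u x"
    using values_ae by blast
  let ?v = "\<lambda>x. tuple_at (ps x) x"
  have "AE x\<in>\<Omega>' in lebesgue. ?v x = u x"
  proof (rule AE_I')
    show "Z \<in> null_sets lebesgue" using Z(1) by (simp add: negligible_iff_null_sets)
    show "{x \<in> space lebesgue. \<not> (x \<in> \<Omega>' \<longrightarrow> ?v x = u x)} \<subseteq> Z"
      using Z(2) cl closure_subset[of \<Omega>'] by (auto simp: deep_def)
  qed
  moreover have "?v \<in> holder_space Q k \<mu> \<Omega>'" by (rule holder_estimate(1)[OF \<Omega>'(1) cl])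
  moreover have "holder_norm Q k \<mu> \<Omega>' ?v \<le> ennreal ((\<bar>K\<bar> + 1) * (\<beta> powr q + I) powr (1 / q))"
  proof -
    have "holder_norm Q k \<mu> \<Omega>' ?v \<le> ennreal (holder_const n m k Q \<rho>0 C0 D e1 * M)"
      using holder_estimate(2)[OF \<Omega>'(1) cl] by (simp add: n_def m_def)
    also have "holder_const n m k Q \<rho>0 C0 D e1 * M = K * N" by (simp add: K_def M_def)
    also have "K * N \<le> (\<bar>K\<bar> + 1) * N" using N by (intro mult_right_mono) auto
    finally show ?thesis by (simp add: N_def ennreal_leI)
  qed
  ultimately show ?thesis unfolding I_def by (intro exI[of _ ?v] conjI)
qed

theorem lemma2p8:
  fixes k Q :: nat and q A \<beta>1 \<beta>2 \<epsilon> d :: real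
  assumes "Q \<ge> 1" and "q \<ge> 1" and "A > 0" and "\<beta>1 > 0" and "\<beta>2 > 0"
    and "0 < \<epsilon>" and "\<epsilon> < 1/4"
  shows "\<exists>C>0. \<forall>\<mu>. 0 < \<mu> \<and> \<mu> < 1 \<longrightarrow> (\<exists>l. 0 < l \<and> l < 1 \<and>
    (\<forall>(\<Omega> :: (real ^ 'n) set) \<Omega>' \<Omega>'' \<Gamma> (u :: real ^ 'n \<Rightarrow> (real ^ 'm) multiset) P \<beta>.
      open \<Omega> \<and> convex \<Omega> \<and> \<Omega> \<noteq> {} \<and>
      (\<forall>x\<in>\<Omega>. size (u x) = Q) \<and> qmeasurable_on Q \<Omega> u \<and>
      (\<integral>\<^sup>+x\<in>\<Omega>''. ennreal (qabs norm (u x) powr q) \<partial>lebesgue) < \<infinity> \<and>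
      closed \<Gamma> \<and> \<Gamma> \<subseteq> closure \<Omega> \<and> \<Gamma> \<inter> closure \<Omega>'' \<noteq> {} \<and>
      open \<Omega>' \<and> open \<Omega>'' \<and>
      compact (closure \<Omega>') \<and> closure \<Omega>' \<subseteq> \<Omega>'' \<and>
      compact (closure \<Omega>'') \<and> closure \<Omega>'' \<subseteq> \<Omega> \<and>
      convex \<Omega>' \<and> \<Omega>' \<noteq> {} \<and> weighted A \<Omega>' \<and>
      setdist \<Omega>' (- \<Omega>'') = d \<and>
      \<beta> > 0 \<and>
      (\<forall>x0\<in>\<Gamma> \<inter> closure \<Omega>''.
         P x0 \<in> qpoly Q k \<and> (\<forall>x\<in>\<Omega>. qabs norm (P x0 x) \<le> \<beta>) \<and>
         (\<forall>\<sigma> \<rho>. 0 < \<sigma> \<and> \<sigma> \<le> \<rho> / 2 \<and> \<rho> / 2 \<le> \<epsilon> / 2 \<longrightarrow>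
            ennreal (\<sigma> powr (- real CARD('n) - real k * q)) *
              (\<integral>\<^sup>+x\<in>ball x0 \<sigma> \<inter> \<Omega>. ennreal (G (u x) (P x0 x) powr q) \<partial>lebesgue)
            \<le> ennreal (\<beta>1 * (\<sigma> / \<rho>) powr (q * \<mu>) * \<rho> powr (- real CARD('n) - real k * q)) *
              (\<integral>\<^sup>+x\<in>ball x0 \<rho> \<inter> \<Omega>. ennreal (G (u x) (P x0 x) powr q) \<partial>lebesgue))) \<and>
      (\<forall>x0\<in>closure \<Omega>'' - \<Gamma>.
         P x0 \<in> qpoly Q k \<and>
         (\<forall>y\<in>\<Gamma> \<inter> closure \<Omega>''. \<forall>\<sigma> \<rho>.
            0 < \<sigma> \<and> \<sigma> \<le> \<rho> / 2 \<and> \<rho> / 2 < 1/2 * min (1/4) (infdist x0 \<Gamma>) \<longrightarrow>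
            ennreal (\<sigma> powr (- real CARD('n) - real k * q)) *
              (\<integral>\<^sup>+x\<in>ball x0 \<sigma> \<inter> \<Omega>. ennreal (G (u x) (P x0 x) powr q) \<partial>lebesgue)
            \<le> ennreal (\<beta>2 * (\<sigma> / \<rho>) powr (q * \<mu>) * \<rho> powr (- real CARD('n) - real k * q)) *
              (\<integral>\<^sup>+x\<in>ball x0 \<rho> \<inter> \<Omega>. ennreal (G (u x) (P y x) powr q) \<partial>lebesgue)))
      \<longrightarrow>
      (\<exists>v. (AE x\<in>\<Omega>' in lebesgue. v x = u x) \<and>
         v \<in> holder_space Q k l \<Omega>' \<and>
         holder_norm Q k l \<Omega>' v \<le>
           ennreal (C * (\<beta> powr q +
             enn2real (\<integral>\<^sup>+x\<in>\<Omega>''. ennreal (qabs norm (u x) powr q) \<partial>lebesgue)) powr (1 / q)))))"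
proof -
  obtain C0 where C0: "0 < C0"
    "\<And>\<Omega> u (ps :: (real ^ 'n \<Rightarrow> real ^ 'm) list) rs x0 s q a.
      poly_maps Q k ps \<Longrightarrow> poly_maps Q k rs \<Longrightarrow> open \<Omega> \<Longrightarrow> qmeasurable_on Q \<Omega> u \<Longrightarrow>
      (\<And>x. x \<in> \<Omega> \<Longrightarrow> size (u x) = Q) \<Longrightarrow> ball x0 (2 * s) \<subseteq> \<Omega> \<Longrightarrow> 0 < s \<Longrightarrow> 0 < a \<Longrightarrow> 1 \<le> q \<Longrightarrow>
      deviation q u ps (ball x0 (2 * s)) \<le> ennreal (a powr q * s ^ CARD('n)) \<Longrightarrow>
      deviation q u rs (ball x0 (2 * s)) \<le> ennreal (a powr q * s ^ CARD('n)) \<Longrightarrow>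
      matched_within Q k ps rs x0 s (C0 * a)"
    using matched_polynomials_close[of Q k thesis] by blast
  define \<rho>0 where "\<rho>0 = min \<epsilon> (d / 2)"
  define B where "B = max \<beta>1 \<beta>2"
  define e1 where "e1 = real CARD('n) + real k * q + q"
  define D where "D = decay_const CARD('n) CARD('m) k Q B \<rho>0 C0 e1"
  define K where "K = holder_const CARD('n) CARD('m) k Q \<rho>0 C0 D e1 * (2 * (2 + unit_ball_vol (real CARD('n))))"
  show ?thesis
    (* The summand 1 makes the constant positive; the Hoelder exponent is \<open>\<mu>\<close>. *)
    apply (rule exI[of _ "\<bar>K\<bar> + 1"], rule conjI, simp, intro allI impI)
    subgoal for \<mu>
      apply (intro exI[of _ \<mu>] conjI allI impI; (elim conjE)?)
        apply assumption
       apply assumption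
      unfolding K_def D_def e1_def B_def \<rho>0_def
      apply (rule regularity_core[OF assms(2,4-7)]; (assumption | rule C0(1) | (rule C0(2); assumption)))
      done
    done
qed

end
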